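(* Let $r\ge2$ be an integer, let $f$ be a $C^r$ immersion of a $C^r$ manifold $X$ into an open subset $V$ of $\mathbb{R}^m$, and let $g:V\to\mathbb{R}$ be a $C^r$ function. Set $$\Sigma=\{\pi\in\mathcal{L}(\mathbb{R}^m,\mathbb{R})\mid (g+\pi)\circ f:X\to\mathbb{R}\text{ is not a Morse function}\}.$$ Then, for any real number $s$ satisfying $$s\ge m-1+\frac{1}{r-1},$$ the set $\Sigma$ has $s$-dimensional Hausdorff measure zero in $\mathcal{L}(\mathbb{R}^m,\mathbb{R})$.
   Context: All manifolds are without boundary and have a countable basis. $\mathcal{L}(\mathbb{R}^m,\mathbb{R})$ is the space of all linear mappings $\mathbb{R}^m\to\mathbb{R}$, identified with $\mathbb{R}^m$ in the obvious way. Here $(g+\pi)\circ f$ is the function $q\mapsto g(f(q))+\pi(f(q))$. A point $x\in X$ is a critical point of a $C^1$ function $h:X\to\mathbb{R}$ if $\operatorname{rank}dh_x=0$. A $C^r$ function $h:X\to\mathbb{R}$ ($r\ge2$) is a Morse function if all of its critical points are nondegenerate (the Hessian in local coordinates is nonsingular). Hausdorff measure: for a real number $s\geq 0$ and $B\subset\mathbb{R}^N$, the $s$-dimensional Hausdorff outer measure of $B$ is the number of points of $B$ if $s=0$, and for $s>0$ it is $\lim_{\delta\to0}\mathcal{H}^s_\delta(B)$, where $\mathcal{H}^s_\delta(B)=\inf\{\sum_{j=1}^\infty(\operatorname{diam}C_j)^s\mid B\subset\bigcup_{j=1}^\infty C_j,\ \operatorname{diam}C_j\le\delta\}$. A set has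 $s$-dimensional Hausdorff measure zero if this outer measure is $0$. *)

theory Defs
  imports "HOL-Analysis.Analysis"
begin

section \<open>Maps of class \<open>C\<^sup>k\<close> on open sets\<close>

text \<open>Meant for an open set \<open>S\<close> in a finite-dimensional space. There, continuity of
  \<open>x \<mapsto> Df(x) v\<close> for each fixed \<open>v\<close> is the same as continuity of \<open>Df\<close> in operator norm, so
  quantifying over all directions \<open>v\<close> gives the usual notion.\<close>

primrec Ck_on :: "nat \<Rightarrow> ('a::real_normed_vector \<Rightarrow> 'b::real_normed_vector) \<Rightarrow> 'a set \<Rightarrow> bool"
where
  "Ck_on 0 f S \<longleftrightarrow> continuous_on S f"
| "Ck_on (Suc k) f S \<longleftrightarrow>
     (\<forall>x\<in>S. f differentiable (at x)) \<and>
     (\<forall>v. Ck_on k (\<lambda>x. frechet_derivative f (at x) v) S)"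


section \<open>Manifolds of class \<open>C\<^sup>r\<close>\<close>

text \<open>A chart is a pair \<open>(U, \<phi>)\<close>. The model space \<open>'e\<close> plays the role of \<open>\<real>\<^sup>n\<close>. It is a
  finite-dimensional normed space rather than a type of class \<^class>\<open>euclidean_space\<close>, because
  the latter would exclude \<open>n = 0\<close>.\<close>

type_synonym ('p, 'e) chart = "'p set \<times> ('p \<Rightarrow> 'e)"

definition is_chart :: "'p topology \<Rightarrow> ('p, 'e::real_normed_vector) chart \<Rightarrow> bool" where
  "is_chart X c \<longleftrightarrow> (case c of (U, \<phi>) \<Rightarrow>
     openin X U \<and> open (\<phi> ` U) \<and>
     homeomorphic_map (subtopology X U) (top_of_set (\<phi> ` U)) \<phi>)"

definition Cr_atlas :: "nat \<Rightarrow> 'p topology \<Rightarrow> ('p, 'e::real_normed_vector) chart set \<Rightarrow> bool" where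
  "Cr_atlas r X \<A> \<longleftrightarrow>
     (\<forall>c\<in>\<A>. is_chart X c) \<and>
     (\<Union>(U, \<phi>)\<in>\<A>. U) = topspace X \<and>
     (\<forall>(U, \<phi>)\<in>\<A>. \<forall>(W, \<psi>)\<in>\<A>. Ck_on r (\<psi> \<circ> inv_into U \<phi>) (\<phi> ` (U \<inter> W)))"

text \<open>The atlas need not be maximal: all notions below give the same result for an atlas and
  for the maximal one containing it.\<close>

definition Cr_manifold :: "nat \<Rightarrow> 'p topology \<Rightarrow> ('p, 'e::real_normed_vector) chart set \<Rightarrow> bool" where
  "Cr_manifold r X \<A> \<longleftrightarrow>
     (\<exists>B::'e set. finite B \<and> span B = UNIV) \<and>
     Hausdorff_space X \<and> second_countable X \<and> Cr_atlas r X \<A>"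

definition Cr_map ::
  "nat \<Rightarrow> ('p, 'e::real_normed_vector) chart set \<Rightarrow> ('p \<Rightarrow> 'b::real_normed_vector) \<Rightarrow> bool" where
  "Cr_map r \<A> f \<longleftrightarrow> (\<forall>(U, \<phi>)\<in>\<A>. Ck_on r (f \<circ> inv_into U \<phi>) (\<phi> ` U))"

definition chart_deriv ::
  "('p, 'e::real_normed_vector) chart \<Rightarrow> ('p \<Rightarrow> 'b::real_normed_vector) \<Rightarrow> 'p \<Rightarrow> 'e \<Rightarrow> 'b" where
  "chart_deriv c f q = (case c of (U, \<phi>) \<Rightarrow>
     frechet_derivative (f \<circ> inv_into U \<phi>) (at (\<phi> q)))"

definition Cr_immersion ::
  "nat \<Rightarrow> ('p, 'e::real_normed_vector) chart set \<Rightarrow> ('p \<Rightarrow> 'b::real_normed_vector) \<Rightarrow> bool" where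
  "Cr_immersion r \<A> f \<longleftrightarrow>
     Cr_map r \<A> f \<and> (\<forall>c\<in>\<A>. \<forall>q\<in>fst c. inj (chart_deriv c f q))"


section \<open>Morse functions\<close>

text \<open>Being critical, and (at a critical point) nonsingularity of the Hessian, do not depend on
  the chart, so requiring them in every chart of the atlas around the point is harmless.\<close>

definition critical_point ::
  "('p, 'e::real_normed_vector) chart set \<Rightarrow> ('p \<Rightarrow> real) \<Rightarrow> 'p \<Rightarrow> bool" where
  "critical_point \<A> h q \<longleftrightarrow>
     (\<forall>c\<in>\<A>. q \<in> fst c \<longrightarrow> dim (range (chart_deriv c h q)) = 0)"

definition chart_hessian ::
  "('p, 'e::real_normed_vector) chart \<Rightarrow> ('p \<Rightarrow> real) \<Rightarrow> 'p \<Rightarrow> 'e \<Rightarrow> 'e \<Rightarrow> real" where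
  "chart_hessian c h q v w = (case c of (U, \<phi>) \<Rightarrow>
     frechet_derivative
       (\<lambda>x. frechet_derivative (h \<circ> inv_into U \<phi>) (at x) v) (at (\<phi> q)) w)"

definition nonsingular_form :: "('e::real_vector \<Rightarrow> 'e \<Rightarrow> real) \<Rightarrow> bool" where
  "nonsingular_form b \<longleftrightarrow> (\<forall>v. (\<forall>w. b v w = 0) \<longrightarrow> v = 0)"

definition nondegenerate_at ::
  "('p, 'e::real_normed_vector) chart set \<Rightarrow> ('p \<Rightarrow> real) \<Rightarrow> 'p \<Rightarrow> bool" where
  "nondegenerate_at \<A> h q \<longleftrightarrow>
     (\<forall>c\<in>\<A>. q \<in> fst c \<longrightarrow> nonsingular_form (chart_hessian c h q))"

definition Morse_function ::
  "nat \<Rightarrow> 'p topology \<Rightarrow> ('p, 'e::real_normed_vector) chart set \<Rightarrow> ('p \<Rightarrow> real) \<Rightarrow> bool" where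
  "Morse_function r X \<A> h \<longleftrightarrow>
     Cr_map r \<A> h \<and>
     (\<forall>q\<in>topspace X. critical_point \<A> h q \<longrightarrow> nondegenerate_at \<A> h q)"


section \<open>Hausdorff measure\<close>

text \<open>\<^const>\<open>diameter\<close> is real-valued and carries no information for unbounded sets, hence the
  explicit boundedness condition, which is what \<open>diam C\<^sub>j \<le> \<delta>\<close> entails in the usual convention.\<close>

definition hausdorff_pre :: "real \<Rightarrow> real \<Rightarrow> 'a::metric_space set \<Rightarrow> ennreal" where
  "hausdorff_pre s \<delta> B =
     Inf {(\<Sum>j. ennreal (diameter (C j) powr s)) | C :: nat \<Rightarrow> 'a set.
            B \<subseteq> (\<Union>j. C j) \<and> (\<forall>j. bounded (C j) \<and> diameter (C j) \<le> \<delta>)}"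

definition hausdorff_outer_measure :: "real \<Rightarrow> 'a::metric_space set \<Rightarrow> ennreal" where
  "hausdorff_outer_measure s B =
     (if s = 0 then emeasure (count_space UNIV) B
      else Lim (at_right 0) (\<lambda>\<delta>. hausdorff_pre s \<delta> B))"


section \<open>Linear functionals as vectors\<close>

text \<open>The identification of the dual of \<open>\<real>\<^sup>m\<close> with \<open>\<real>\<^sup>m\<close>.\<close>

definition dual_coords :: "(real ^ 'm \<Rightarrow> real) \<Rightarrow> real ^ 'm" where
  "dual_coords \<pi> = (\<chi> i. \<pi> (axis i 1))"

end

theory Submission
  imports Defs
begin

text \<open>Put \<open>k = r - 1\<close>. In a chart, \<open>(g + \<pi>) \<circ> f\<close> is critical at \<open>x\<close> iff \<open>P (x, \<pi>) = 0\<close>, where the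
  gradient \<open>P\<close> is of class \<open>C\<^sup>k\<close> and affine in \<open>\<pi>\<close>; since \<open>f\<close> is an immersion, the zero set of \<open>P\<close> is
  transversal and behaves like an \<open>m\<close>-dimensional set. Degeneracy means that \<open>D\<^sub>xP\<close> is singular, so the
  claim is a sharp Sard theorem for the projection \<open>(x, \<pi>) \<mapsto> \<pi>\<close> of this set.

  If \<open>k = 1\<close>, or if \<open>D\<^sub>xP\<close> has corank at least two, it is enough to cover the zero set by pieces of diameter
  \<open>\<epsilon>\<close> and to observe that each piece projects close to an affine subspace of codimension one (two), with
  error \<open>o(\<epsilon>)\<close> (\<open>O(\<epsilon>\<^sup>2)\<close>). If the corank is one, a Lyapunov--Schmidt reduction to one variable \<open>t\<close> turns
  the degenerate parameters into the envelope \<open>q = \<partial>\<^sub>tq = 0\<close> of a one-parameter family of hypersurfaces. Where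
  some \<open>\<partial>\<^sub>t\<^sup>jq\<close> with \<open>2 \<le> j \<le> k\<close> is nonzero, the envelope has dimension at most \<open>m - 1\<close>; where all of them
  vanish, Taylor's formula puts \<open>\<pi>\<close> within \<open>o(\<epsilon>\<^sup>k)\<close> of a fixed hypersurface, for \<open>t\<close> in an interval of
  length \<open>\<epsilon>\<close>. Summing over the \<open>1 / \<epsilon>\<close> intervals gives exactly the exponent \<open>m - 1 + 1 / k\<close>, with the
  little-o providing measure zero.\<close>

section \<open>Calculus of \<open>C\<^sup>k\<close> maps\<close>

text \<open>The zero set of the gradient is never parametrised. Transversality enters only through
  an inequality: locally, differences of its points are almost orthogonal to a fixed subspace, which
  is enough for counting grid cells. What forces the reduction to one variable is that linear
  approximation is too crude in corank one. Codimension one with error \<epsilon>^2 costs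
  \<epsilon>^(-m) (\<epsilon> / \<epsilon>^2)^(m - 1) \<epsilon>^(2 s), which tends to 0 only for s
  > m - 1/2, whereas for k \<ge> 2 the critical exponent is at most m - 1/2. Derivatives up to order
  k must be exploited, and a Taylor expansion does this once the degeneracy is concentrated in a
  single variable. In corank at least two this is impossible, but there the second normal direction
  lowers the threshold to s > m - 1, already for maps of class C^2.\<close>

lemma has_frechet_derivative:
  "f differentiable (at x) \<Longrightarrow> (f has_derivative frechet_derivative f (at x)) (at x)"
  by (simp add: frechet_derivative_works)

lemma Ck_on_cong:
  assumes "open S" "\<And>x. x \<in> S \<Longrightarrow> f x = g x" "Ck_on k f S"
  shows "Ck_on k g S"
  using assms(2,3)
proof (induction k arbitrary: f g)
  case 0
  then show ?case by (simp add: continuous_on_eq)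
next
  case (Suc k)
  have d: "(g has_derivative frechet_derivative f (at x)) (at x)" if "x \<in> S" for x
    by (rule has_derivative_transform_within_open[where f = f, OF _ \<open>open S\<close> that])
      (use Suc.prems that in \<open>auto intro: has_frechet_derivative\<close>)
  then have e: "frechet_derivative g (at x) = frechet_derivative f (at x)" if "x \<in> S" for x
    using that frechet_derivative_at by metis
  have "Ck_on k (\<lambda>x. frechet_derivative g (at x) v) S" for v
    by (rule Suc.IH[of "\<lambda>x. frechet_derivative f (at x) v"]) (use Suc.prems e in auto)
  with d show ?case by (auto simp: differentiable_def)
qed

lemma Ck_on_subset: "Ck_on k f S \<Longrightarrow> T \<subseteq> S \<Longrightarrow> Ck_on k f T"
  by (induction k arbitrary: f) (auto intro: continuous_on_subset)

lemma Ck_on_SucI: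
  assumes "open S" "\<And>x. x \<in> S \<Longrightarrow> (f has_derivative f' x) (at x)"
    and "\<And>v. Ck_on k (\<lambda>x. f' x v) S"
  shows "Ck_on (Suc k) f S"
proof -
  have e: "f' x = frechet_derivative f (at x)" if "x \<in> S" for x
    using frechet_derivative_at[OF assms(2)[OF that]] .
  have "Ck_on k (\<lambda>x. frechet_derivative f (at x) v) S" for v
    by (rule Ck_on_cong[OF assms(1) _ assms(3)[of v]]) (simp add: e)
  then show ?thesis using assms(2) by (auto simp: differentiable_def)
qed

lemma Ck_on_imp_continuous_on: "Ck_on k f S \<Longrightarrow> continuous_on S f"
  by (cases k)
    (auto intro: differentiable_imp_continuous_on simp: differentiable_at_imp_differentiable_on)

lemma Ck_on_Suc_imp: "Ck_on (Suc k) f S \<Longrightarrow> Ck_on k f S"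
proof (induction k arbitrary: f)
  case 0
  then show ?case using Ck_on_imp_continuous_on[of "Suc 0" f S] by simp
next
  case (Suc k)
  then show ?case by (subst Ck_on.simps) (metis Ck_on.simps(2))
qed

lemma Ck_on_mono: "Ck_on k f S \<Longrightarrow> j \<le> k \<Longrightarrow> Ck_on j f S"
  by (induction k) (auto simp: le_Suc_eq simp del: Ck_on.simps dest: Ck_on_Suc_imp)

lemma Ck_on_has_derivative:
  "Ck_on k f S \<Longrightarrow> 0 < k \<Longrightarrow> x \<in> S \<Longrightarrow> (f has_derivative frechet_derivative f (at x)) (at x)"
  by (cases k) (auto intro: has_frechet_derivative)

lemma Ck_on_const [simp]: "open S \<Longrightarrow> Ck_on k (\<lambda>x. c) S"
  by (induction k arbitrary: c) (auto simp del: Ck_on.simps(2) intro!: Ck_on_SucI derivative_eq_intros)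

lemma Ck_on_bounded_linear:
  assumes "open S" "bounded_linear f"
  shows "Ck_on k f S"
proof (cases k)
  case 0
  then show ?thesis using assms by (simp add: linear_continuous_on)
next
  case (Suc j)
  then show ?thesis
    by (auto simp del: Ck_on.simps(2) intro!: Ck_on_SucI Ck_on_const assms bounded_linear_imp_has_derivative)
qed

lemma Ck_on_linear_comp:
  assumes "open S" "bounded_linear L" "Ck_on k f S"
  shows "Ck_on k (\<lambda>x. L (f x)) S"
  using assms(3)
proof (induction k arbitrary: f)
  case 0
  then show ?case using bounded_linear.continuous_on[OF assms(2)] by simp
next
  case (Suc k)
  show ?case
    by (rule Ck_on_SucI[OF assms(1) bounded_linear.has_derivative[OF assms(2)
          Ck_on_has_derivative[OF Suc.prems]]])
      (use Suc in auto)
qed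

lemma Ck_on_add:
  assumes "open S" "Ck_on k f S" "Ck_on k g S"
  shows "Ck_on k (\<lambda>x. f x + g x) S"
  using assms(2,3)
proof (induction k arbitrary: f g)
  case 0
  then show ?case by (simp add: continuous_on_add)
next
  case (Suc k)
  show ?case
    by (rule Ck_on_SucI[OF assms(1) has_derivative_add[OF Ck_on_has_derivative[OF Suc.prems(1)]
          Ck_on_has_derivative[OF Suc.prems(2)]]])
      (use Suc in auto)
qed

lemma Ck_on_sum:
  assumes "open S" "\<And>i. i \<in> I \<Longrightarrow> Ck_on k (f i) S"
  shows "Ck_on k (\<lambda>x. \<Sum>i\<in>I. f i x) S"
  using assms(2)
  by (induction I rule: infinite_finite_induct) (auto intro!: Ck_on_add Ck_on_const assms(1))

lemma Ck_on_scaleR: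
  assumes "open S" "Ck_on k f S" "Ck_on k g S"
  shows "Ck_on k (\<lambda>x. f x *\<^sub>R g x) S"
  using assms(2,3)
proof (induction k arbitrary: f g)
  case 0
  then show ?case by (simp add: continuous_on_scaleR)
next
  case (Suc k)
  have 1: "Ck_on k f S" "Ck_on k g S" using Suc.prems Ck_on_Suc_imp by blast+
  show ?case
    by (rule Ck_on_SucI[OF assms(1) has_derivative_scaleR[OF Ck_on_has_derivative[OF Suc.prems(1)]
          Ck_on_has_derivative[OF Suc.prems(2)]]])
      (use Suc 1 in \<open>auto intro!: Ck_on_add assms(1)\<close>)
qed

lemma Ck_on_minus:
  assumes "open S" "Ck_on k f S"
  shows "Ck_on k (\<lambda>x. - f x) S"
  using Ck_on_linear_comp[OF assms(1) bounded_linear_minus[OF bounded_linear_ident] assms(2)] .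

lemma Ck_on_diff:
  assumes "open S" "Ck_on k f S" "Ck_on k g S"
  shows "Ck_on k (\<lambda>x. f x - g x) S"
  using Ck_on_add[OF assms(1,2) Ck_on_minus[OF assms(1,3)]] by simp

lemma Ck_on_inner_left:
  assumes "open S" "Ck_on k f S"
  shows "Ck_on k (\<lambda>x. f x \<bullet> c) S"
  using Ck_on_linear_comp[OF assms(1) bounded_linear_inner_left assms(2)] .

lemma linear_euclidean_expand:
  fixes L :: "'a::euclidean_space \<Rightarrow> 'b::real_vector"
  assumes "linear L"
  shows "L x = (\<Sum>b\<in>Basis. (x \<bullet> b) *\<^sub>R L b)"
proof -
  have "L x = L (\<Sum>b\<in>Basis. (x \<bullet> b) *\<^sub>R b)" by (simp add: euclidean_representation)
  then show ?thesis by (simp add: linear_sum[OF assms] linear_scale[OF assms])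
qed

text \<open>Linearity and a finite basis reduce the joint dependence on \<open>x\<close> to sums of
  products. This makes the directionwise definition of \<open>Ck_on\<close> usable in chain rules,
  where the direction itself moves with the point.\<close>

lemma Ck_on_apply:
  fixes A :: "'a::real_normed_vector \<Rightarrow> 'b::euclidean_space \<Rightarrow> 'c::real_normed_vector"
  assumes "open S" "\<And>x. x \<in> S \<Longrightarrow> linear (A x)"
    and "\<And>b. Ck_on k (\<lambda>x. A x b) S" "Ck_on k y S"
  shows "Ck_on k (\<lambda>x. A x (y x)) S"
proof (rule Ck_on_cong[OF assms(1)])
  show "Ck_on k (\<lambda>x. \<Sum>b\<in>Basis. (y x \<bullet> b) *\<^sub>R A x b) S"
    by (intro Ck_on_sum Ck_on_scaleR assms Ck_on_inner_left)
  show "(\<Sum>b\<in>Basis. (y x \<bullet> b) *\<^sub>R A x b) = A x (y x)" if "x \<in> S" for x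
    using linear_euclidean_expand[OF assms(2)[OF that], of "y x"] by simp
qed

lemma Ck_on_compose:
  fixes f :: "'a::real_normed_vector \<Rightarrow> 'b::euclidean_space"
    and g :: "'b \<Rightarrow> 'c::real_normed_vector"
  assumes "open S" "Ck_on k g T" "Ck_on k f S" "f ` S \<subseteq> T"
  shows "Ck_on k (\<lambda>x. g (f x)) S"
  using assms(2,3)
proof (induction k arbitrary: g)
  case 0
  then show ?case using continuous_on_compose2[of T g S f] assms(4) by auto
next
  case (Suc k)
  have T: "f x \<in> T" if "x \<in> S" for x using assms(4) that by auto
  have g: "(g has_derivative frechet_derivative g (at (f x))) (at (f x))" if "x \<in> S" for x
    using Ck_on_has_derivative[OF Suc.prems(1)] T[OF that] by simp
  have f: "(f has_derivative frechet_derivative f (at x)) (at x)" if "x \<in> S" for x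
    using Ck_on_has_derivative[OF Suc.prems(2)] that by simp
  have gk: "Ck_on k (\<lambda>y. frechet_derivative g (at y) b) T" for b using Suc.prems by simp
  have fk: "Ck_on k (\<lambda>x. frechet_derivative f (at x) v) S" for v using Suc.prems by simp
  have D: "Ck_on k (\<lambda>x. frechet_derivative g (at (f x)) (frechet_derivative f (at x) v)) S" for v
    by (rule Ck_on_apply[OF assms(1) _ Suc.IH[OF gk Ck_on_Suc_imp[OF Suc.prems(2)]] fk])
      (use g in \<open>auto intro: has_derivative_linear\<close>)
  show ?case
    by (rule Ck_on_SucI[OF assms(1) has_derivative_compose[OF f g] D])
qed

text \<open>The inner map may take values in a space without \<open>Basis\<close>: its derivative is
  constant, so no moving direction has to be expanded. It serves for linear maps into the model
  space of a manifold.\<close>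

lemma Ck_on_precompose_linear:
  assumes "open S" "bounded_linear L" "Ck_on k f T" "L ` S \<subseteq> T"
  shows "Ck_on k (\<lambda>x. f (L x)) S"
  using assms(3)
proof (induction k arbitrary: f)
  case 0
  then show ?case using continuous_on_compose2[of T f S L] assms(2,4) linear_continuous_on by auto
next
  case (Suc k)
  have "(f has_derivative frechet_derivative f (at (L x))) (at (L x))" if "x \<in> S" for x
    using Ck_on_has_derivative[OF Suc.prems] assms(4) that by auto
  from has_derivative_compose[OF bounded_linear_imp_has_derivative[OF assms(2)] this]
  show ?case
    by (rule Ck_on_SucI[OF assms(1)]) (use Suc in auto)
qed

text \<open>Where \<open>f\<close> vanishes, the product rule asks only for continuity of
  \<open>g\<close>: the remainder \<open>f y *\<^sub>R (g y - g x)\<close> is O(|y - x|) times o(1).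
  The factor \<open>g\<close> will be an inverse operator not yet known to be
  differentiable.\<close>

lemma has_derivative_scaleR_zero:
  fixes f :: "'a::real_normed_vector \<Rightarrow> real" and g :: "'a \<Rightarrow> 'b::real_normed_vector"
  assumes f: "(f has_derivative f') (at x)" and "f x = 0" and g: "isCont g x"
  shows "((\<lambda>y. f y *\<^sub>R g y) has_derivative (\<lambda>h. f' h *\<^sub>R g x)) (at x)"
proof -
  have bl: "bounded_linear f'" using f by (rule has_derivative_bounded_linear)
  obtain K where K: "K > 0" "\<And>h. norm (f' h) \<le> norm h * K"
    using bounded_linear.pos_bounded[OF bl] by blast
  have "((\<lambda>y. f y *\<^sub>R g x) has_derivative (\<lambda>h. f' h *\<^sub>R g x)) (at x)"
    by (rule derivative_eq_intros f refl)+ simp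
  moreover have "((\<lambda>y. f y *\<^sub>R (g y - g x)) has_derivative (\<lambda>h. 0)) (at x)"
    unfolding has_derivative_at_alt
  proof (intro conjI allI impI)
    fix e :: real assume e: "e > 0"
    obtain d1 where d1: "d1 > 0" "\<And>y. norm (y - x) < d1 \<Longrightarrow> norm (f y - f x - f' (y - x)) \<le> 1 * norm (y - x)"
      using f unfolding has_derivative_at_alt by (meson zero_less_one)
    have "e / (K + 1) > 0" using e K by simp
    then obtain d2 where d2: "d2 > 0" "\<And>y. norm (y - x) < d2 \<Longrightarrow> norm (g y - g x) < e / (K + 1)"
      using g unfolding continuous_at_eps_delta dist_norm by meson
    have "norm (f y *\<^sub>R (g y - g x) - f x *\<^sub>R (g x - g x) - 0) \<le> e * norm (y - x)"
      if y: "norm (y - x) < min d1 d2" for y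
    proof -
      have "\<bar>f y\<bar> \<le> norm (f y - f x - f' (y - x)) + norm (f' (y - x))"
        using assms(2) by simp
      also have "\<dots> \<le> (K + 1) * norm (y - x)"
        using d1(2)[of y] K(2)[of "y - x"] y by (simp add: algebra_simps)
      finally have "\<bar>f y\<bar> * norm (g y - g x) \<le> ((K + 1) * norm (y - x)) * (e / (K + 1))"
        using d2(2)[of y] y K e by (intro mult_mono) auto
      then show ?thesis using K by (simp add: mult.commute)
    qed
    then show "\<exists>d>0. \<forall>y. norm (y - x) < d \<longrightarrow>
       norm (f y *\<^sub>R (g y - g x) - f x *\<^sub>R (g x - g x) - 0) \<le> e * norm (y - x)"
      using d1 d2 by (intro exI[of _ "min d1 d2"]) auto
  qed simp
  ultimately have "((\<lambda>y. f y *\<^sub>R g x + f y *\<^sub>R (g y - g x)) has_derivative (\<lambda>h. f' h *\<^sub>R g x + 0)) (at x)"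
    by (rule has_derivative_add)
  then show ?thesis by (simp add: algebra_simps)
qed

text \<open>The sum of the norms over \<open>Basis\<close> replaces the operator norm in most
  estimates below: \<open>Ck_on\<close> controls derivatives one direction at a time, and finitely
  many directions suffice.\<close>

lemma norm_linear_le_sum_Basis:
  fixes L :: "'a::euclidean_space \<Rightarrow> 'b::real_normed_vector"
  assumes "linear L"
  shows "norm (L y) \<le> (\<Sum>b\<in>Basis. norm (L b)) * norm y"
proof -
  have "norm (L y) = norm (\<Sum>b\<in>Basis. (y \<bullet> b) *\<^sub>R L b)"
    using linear_euclidean_expand[OF assms, of y] by simp
  also have "\<dots> \<le> (\<Sum>b\<in>Basis. norm (L b) * norm y)"
  proof (rule sum_norm_le)
    fix b :: 'a assume "b \<in> Basis"
    then have "norm (L b) * \<bar>y \<bullet> b\<bar> \<le> norm (L b) * norm y"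
      by (intro mult_left_mono Basis_le_norm) auto
    then show "norm ((y \<bullet> b) *\<^sub>R L b) \<le> norm (L b) * norm y" by (simp add: mult.commute)
  qed
  finally show ?thesis by (simp add: sum_distrib_right)
qed

text \<open>Near \<open>x0\<close> the operators \<open>A x\<close> keep half of the lower bound
  \<open>c\<close> of \<open>A x0\<close>. It is applied to the difference of the solutions of
  \<open>A x y = v\<close> and \<open>A x0 z = v\<close>, which \<open>A x\<close> maps to
  \<open>A x0 z - A x z\<close>.\<close>

lemma isCont_linear_inverse:
  fixes A :: "'z::real_normed_vector \<Rightarrow> 'c::euclidean_space \<Rightarrow> 'c"
  assumes "open S" "x0 \<in> S" and lin: "\<And>x. x \<in> S \<Longrightarrow> linear (A x)"
    and inj: "\<And>x. x \<in> S \<Longrightarrow> inj (A x)" and cont: "\<And>b. continuous_on S (\<lambda>x. A x b)"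
  shows "isCont (\<lambda>x. inv (A x) v) x0"
proof -
  have surj: "A x (inv (A x) w) = w" if "x \<in> S" for x w
    using linear_injective_imp_surjective[OF lin[OF that] inj[OF that]] by (simp add: surj_f_inv_f)
  obtain c where c: "c > 0" "\<And>y. c * norm y \<le> norm (A x0 y)"
    using linear_inj_bounded_below_pos[OF lin[OF assms(2)] inj[OF assms(2)]] by blast
  have cA: "((\<lambda>x. A x b) \<longlongrightarrow> A x0 b) (at x0)" for b
    using cont[of b] assms(1,2) by (simp add: continuous_on_eq_continuous_at isCont_def)
  have "((\<lambda>x. \<Sum>b\<in>Basis. norm (A x b - A x0 b)) \<longlongrightarrow> (\<Sum>b\<in>Basis. norm (A x0 b - A x0 b))) (at x0)"
    by (intro tendsto_intros cA)
  then have "\<forall>\<^sub>F x in at x0. (\<Sum>b\<in>Basis. norm (A x b - A x0 b)) < c/2"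
    using c by (intro order_tendstoD) auto
  moreover have "\<forall>\<^sub>F x in at x0. x \<in> S" using assms(1,2) by (rule eventually_at_in_open')
  ultimately have ev: "\<forall>\<^sub>F x in at x0. norm (inv (A x) v - inv (A x0) v)
      \<le> (2/c) * norm (A x (inv (A x0) v) - A x0 (inv (A x0) v))"
  proof eventually_elim
    case (elim x)
    let ?y = "inv (A x) v" and ?z = "inv (A x0) v"
    have "linear (\<lambda>y. A x y - A x0 y)" using lin elim assms(2) by (intro linear_compose_sub) auto
    from norm_linear_le_sum_Basis[OF this, of "?y - ?z"]
    have "norm (A x (?y - ?z) - A x0 (?y - ?z)) \<le> (c/2) * norm (?y - ?z)"
      using elim by (meson less_imp_le mult_right_mono norm_ge_zero order_trans)
    then have "(c/2) * norm (?y - ?z) \<le> norm (A x (?y - ?z))"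
      using c(2)[of "?y - ?z"] norm_triangle_ineq2[of "A x0 (?y - ?z)" "A x (?y - ?z)"]
      by (simp add: norm_minus_commute field_simps)
    also have "A x (?y - ?z) = A x0 ?z - A x ?z"
      unfolding linear_diff[OF lin[OF elim(2)]] surj[OF elim(2)] surj[OF assms(2)] ..
    finally show ?case using c(1) by (simp add: field_simps norm_minus_commute)
  qed
  have "((\<lambda>x. (2/c) * norm (A x (inv (A x0) v) - A x0 (inv (A x0) v))) \<longlongrightarrow>
      (2/c) * norm (A x0 (inv (A x0) v) - A x0 (inv (A x0) v))) (at x0)"
    by (intro tendsto_intros cA)
  then have "((\<lambda>x. inv (A x) v - inv (A x0) v) \<longlongrightarrow> 0) (at x0)"
    by (intro Lim_null_comparison[OF ev]) simp
  then show ?thesis by (simp add: isCont_def LIM_zero_iff)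
qed

text \<open>Write \<open>inv (A x) v = ?y0 + inv (A x) (A x0 ?y0 - A x ?y0)\<close>. The inner
  difference vanishes at \<open>x0\<close>, so in coordinates each term is a differentiable scalar
  vanishing at \<open>x0\<close> times a continuous vector.\<close>

lemma has_derivative_linear_inverse:
  fixes A :: "'z::real_normed_vector \<Rightarrow> 'c::euclidean_space \<Rightarrow> 'c"
  assumes "open S" "x0 \<in> S" and lin: "\<And>x. x \<in> S \<Longrightarrow> linear (A x)"
    and inj: "\<And>x. x \<in> S \<Longrightarrow> inj (A x)" and A: "\<And>b. Ck_on (Suc 0) (\<lambda>x. A x b) S"
  shows "((\<lambda>x. inv (A x) v) has_derivative
     (\<lambda>h. - inv (A x0) (frechet_derivative (\<lambda>x. A x (inv (A x0) v)) (at x0) h))) (at x0)"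
proof -
  let ?y0 = "inv (A x0) v"
  let ?D = "frechet_derivative (\<lambda>x. A x ?y0) (at x0)"
  have bij: "bij (A x)" if "x \<in> S" for x
    using linear_injective_imp_surjective[OF lin[OF that] inj[OF that]] inj[OF that] by (simp add: bij_def)
  have surj: "A x (inv (A x) w) = w" if "x \<in> S" for x w
    using bij[OF that] by (simp add: bij_is_surj surj_f_inv_f)
  have left: "inv (A x) (A x w) = w" if "x \<in> S" for x w
    using inj[OF that] by simp
  have ilin: "linear (inv (A x))" if "x \<in> S" for x
    by (rule inj_linear_imp_inv_linear[OF lin[OF that] inj[OF that]])
  define w where "w x = A x0 ?y0 - A x ?y0" for x
  have wd: "(w has_derivative (\<lambda>h. - ?D h)) (at x0)"
    unfolding w_def
    using has_derivative_diff[OF has_derivative_const Ck_on_has_derivative[OF A _ assms(2)]] by simp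
  have "((\<lambda>x. (w x \<bullet> b) *\<^sub>R inv (A x) b) has_derivative (\<lambda>h. (- ?D h \<bullet> b) *\<^sub>R inv (A x0) b)) (at x0)" for b
  proof (rule has_derivative_scaleR_zero)
    show "((\<lambda>x. w x \<bullet> b) has_derivative (\<lambda>h. - ?D h \<bullet> b)) (at x0)"
      by (rule has_derivative_inner_left[OF wd])
    show "w x0 \<bullet> b = 0" by (simp add: w_def)
    show "isCont (\<lambda>x. inv (A x) b) x0"
      using Ck_on_imp_continuous_on[OF A] by (intro isCont_linear_inverse[OF assms(1-4)])
  qed
  then have "((\<lambda>x. \<Sum>b\<in>Basis. (w x \<bullet> b) *\<^sub>R inv (A x) b) has_derivative
      (\<lambda>h. \<Sum>b\<in>Basis. (- ?D h \<bullet> b) *\<^sub>R inv (A x0) b)) (at x0)"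
    by (intro has_derivative_sum)
  also have "(\<lambda>h. \<Sum>b\<in>Basis. (- ?D h \<bullet> b) *\<^sub>R inv (A x0) b) = (\<lambda>h. - inv (A x0) (?D h))"
    unfolding linear_euclidean_expand[OF ilin[OF assms(2)], symmetric] linear_neg[OF ilin[OF assms(2)]] ..
  finally have "((\<lambda>x. ?y0 + (\<Sum>b\<in>Basis. (w x \<bullet> b) *\<^sub>R inv (A x) b)) has_derivative
      (\<lambda>h. 0 + - inv (A x0) (?D h))) (at x0)"
    by (intro has_derivative_add has_derivative_const)
  then have *: "((\<lambda>x. ?y0 + (\<Sum>b\<in>Basis. (w x \<bullet> b) *\<^sub>R inv (A x) b)) has_derivative
      (\<lambda>h. - inv (A x0) (?D h))) (at x0)" by simp
  show ?thesis
  proof (rule has_derivative_transform_within_open[OF * assms(1,2)])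
    fix x assume x: "x \<in> S"
    have "(\<Sum>b\<in>Basis. (w x \<bullet> b) *\<^sub>R inv (A x) b) = inv (A x) (w x)"
      by (rule linear_euclidean_expand[OF ilin[OF x], symmetric])
    also have "\<dots> = inv (A x) v - ?y0"
      by (simp add: w_def surj[OF assms(2)] left[OF x] linear_diff[OF ilin[OF x]])
    finally show "?y0 + (\<Sum>b\<in>Basis. (w x \<bullet> b) *\<^sub>R inv (A x) b) = inv (A x) v" by simp
  qed
qed

text \<open>The derivative of the inverse is expressed by the inverse itself and the derivative of
  \<open>A\<close>, so the regularity of the inverse climbs one order per induction step.\<close>

lemma Ck_on_linear_inverse:
  fixes A :: "'z::real_normed_vector \<Rightarrow> 'c::euclidean_space \<Rightarrow> 'c"
  assumes "open S" and lin: "\<And>x. x \<in> S \<Longrightarrow> linear (A x)"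
    and inj: "\<And>x. x \<in> S \<Longrightarrow> inj (A x)" and A: "\<And>b. Ck_on k (\<lambda>x. A x b) S"
  shows "Ck_on k (\<lambda>x. inv (A x) v) S"
  using A
proof (induction k arbitrary: v)
  case 0
  then show ?case
    using isCont_linear_inverse[OF assms(1) _ lin inj] by (auto intro!: continuous_at_imp_continuous_on)
next
  case (Suc k)
  have A1: "Ck_on (Suc 0) (\<lambda>x. A x b) S" for b using Suc.prems Ck_on_mono by (metis Suc_le_mono le0)
  have Ak: "Ck_on k (\<lambda>x. A x b) S" for b using Suc.prems Ck_on_Suc_imp by blast
  note IH = Suc.IH[OF Ak]
  have ilin: "linear (inv (A x))" if "x \<in> S" for x
    by (rule inj_linear_imp_inv_linear[OF lin[OF that] inj[OF that]])
  have DA: "linear (\<lambda>y. frechet_derivative (\<lambda>z. A z y) (at x) h)" if x: "x \<in> S" for x h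
  proof -
    have d: "((\<lambda>z. A z y) has_derivative frechet_derivative (\<lambda>z. A z y) (at x)) (at x)" for y
      using Ck_on_has_derivative[OF A1 _ x] by simp
    have "((\<lambda>z. A z (a + b)) has_derivative (\<lambda>h. frechet_derivative (\<lambda>z. A z a) (at x) h
         + frechet_derivative (\<lambda>z. A z b) (at x) h)) (at x)" for a b
      by (rule has_derivative_transform_within_open[OF has_derivative_add[OF d d] assms(1) x])
        (simp add: lin linear_add)
    moreover have "((\<lambda>z. A z (r *\<^sub>R a)) has_derivative (\<lambda>h. r *\<^sub>R frechet_derivative (\<lambda>z. A z a) (at x) h)) (at x)" for a r
      by (rule has_derivative_transform_within_open[OF has_derivative_scaleR_right[OF d] assms(1) x])
        (simp add: lin linear_scale)
    ultimately show ?thesis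
      by (intro linearI)
        (use frechet_derivative_at[symmetric] in \<open>blast dest: fun_cong\<close>)+
  qed
  have "Ck_on k (\<lambda>x. - inv (A x) (frechet_derivative (\<lambda>z. A z (inv (A x) v)) (at x) h)) S" for h
  proof (rule Ck_on_minus[OF assms(1)], rule Ck_on_apply[OF assms(1) ilin IH])
    show "Ck_on k (\<lambda>x. frechet_derivative (\<lambda>z. A z (inv (A x) v)) (at x) h) S"
      by (rule Ck_on_apply[where A = "\<lambda>x y. frechet_derivative (\<lambda>z. A z y) (at x) h", OF assms(1) DA _ IH])
        (use Suc.prems in auto)
  qed auto
  then show ?case
    using has_derivative_linear_inverse[OF assms(1) _ lin inj A1] by (intro Ck_on_SucI[OF assms(1)]) auto
qed

text \<open>Bootstrapping from the C^1 case: the derivative of \<open>G\<close> at \<open>y\<close>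
  is the inverse of the differential of \<open>F\<close> at \<open>G y\<close>, so if
  \<open>G\<close> is of class C^i with i < k, then so is its derivative.\<close>

lemma Ck_on_inverse_function:
  fixes F :: "'c::euclidean_space \<Rightarrow> 'c"
  assumes "open U" "p \<in> U" "Ck_on k F U" "0 < k" "inj (frechet_derivative F (at p))"
  obtains U' V G where "open U'" "p \<in> U'" "U' \<subseteq> U" "open V" "homeomorphism U' V F G" "Ck_on k G V"
    "\<And>y. y \<in> V \<Longrightarrow> bij (frechet_derivative F (at (G y)))"
    "\<And>y. y \<in> V \<Longrightarrow> (G has_derivative inv (frechet_derivative F (at (G y)))) (at y)"
proof -
  define D where "D x = Blinfun (frechet_derivative F (at x))" for x
  have der: "(F has_derivative frechet_derivative F (at x)) (at x)" if "x \<in> U" for x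
    using Ck_on_has_derivative assms(3,4) that by blast
  have D: "blinfun_apply (D x) = frechet_derivative F (at x)" if "x \<in> U" for x
    unfolding D_def using has_derivative_bounded_linear[OF der[OF that]] by (rule bounded_linear_Blinfun_apply)
  obtain j where j: "k = Suc j" using assms(4) gr0_conv_Suc by blast
  have contD: "continuous_on U (\<lambda>x. frechet_derivative F (at x) v)" for v
    using assms(3) unfolding j by (auto intro: Ck_on_imp_continuous_on)
  have "continuous_on U D"
    by (rule continuous_on_blinfun_componentwise)
      (use contD D in \<open>auto intro: continuous_on_cong[THEN iffD1, rotated 2]\<close>)
  moreover
  have lp: "linear (frechet_derivative F (at p))" using der[OF assms(2)] by (rule has_derivative_linear)
  obtain B where B: "linear B" "B \<circ> frechet_derivative F (at p) = id"
    using linear_injective_left_inverse[OF lp assms(5)] by blast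
  have "Blinfun B o\<^sub>L D p = id_blinfun"
    using B(2)
    by (intro blinfun_eqI)
      (simp add: D[OF assms(2)] bounded_linear_Blinfun_apply[OF linear_conv_bounded_linear[THEN iffD1, OF B(1)]]
        fun_eq_iff)
  ultimately have cD: "continuous_on U D" and iD: "Blinfun B o\<^sub>L D p = id_blinfun" by auto
  obtain U' V G G' where *: "open U'" "U' \<subseteq> U" "p \<in> U'" "open V" "homeomorphism U' V F G"
    "\<And>y. y \<in> V \<Longrightarrow> (G has_derivative (G' y)) (at y)"
    "\<And>y. y \<in> V \<Longrightarrow> G' y = inv (blinfun_apply (D (G y)))"
    "\<And>y. y \<in> V \<Longrightarrow> bij (blinfun_apply (D (G y)))"
    by (rule inverse_function_theorem[of U F D p "Blinfun B", OF assms(1) _ cD assms(2) iD])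
      (auto simp: D der)
  have GV: "G y \<in> U" if "y \<in> V" for y using * that unfolding homeomorphism_def by auto
  have bij: "bij (frechet_derivative F (at (G y)))" if "y \<in> V" for y
    using *(8)[OF that] D[OF GV[OF that]] by simp
  have dG: "(G has_derivative inv (frechet_derivative F (at (G y)))) (at y)" if "y \<in> V" for y
    using *(6,7)[OF that] D[OF GV[OF that]] by simp
  have "Ck_on i G V" if "i \<le> k" for i
    using that
  proof (induction i)
    case 0
    then show ?case using *(5) by (simp add: homeomorphism_def)
  next
    case (Suc i)
    have "Ck_on i (\<lambda>y. frechet_derivative F (at (G y)) b) V" for b
      by (rule Ck_on_compose[where g = "\<lambda>x. frechet_derivative F (at x) b" and T = U])
        (use Suc GV *(4) assms(3) in \<open>auto simp: j intro: Ck_on_mono[of j]\<close>)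
    then have Di: "Ck_on i (\<lambda>y. inv (frechet_derivative F (at (G y))) v) V" for v
      using bij der[OF GV] by (intro Ck_on_linear_inverse *(4)) (auto intro: has_derivative_linear bij_is_inj)
    show ?case by (rule Ck_on_SucI[OF *(4) dG Di])
  qed
  then show ?thesis using that * bij dG by blast
qed

section \<open>Hausdorff null sets\<close>

text \<open>No mesh condition \<open>diam C\<^sub>j \<le> \<delta>\<close> is needed: for \<open>s > 0\<close> a small sum forces small diameters.\<close>

definition hausdorff_null :: "real \<Rightarrow> 'a::metric_space set \<Rightarrow> bool" where
  "hausdorff_null s B \<longleftrightarrow> (\<forall>e>0. \<exists>C :: nat \<Rightarrow> 'a set. B \<subseteq> (\<Union>j. C j) \<and> (\<forall>j. bounded (C j)) \<and>
     (\<Sum>j. ennreal (diameter (C j) powr s)) \<le> ennreal e)"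

lemma ennreal_le_suminf: "f j \<le> (\<Sum>j. f j :: ennreal)"
  using sum_le_suminf[OF summableI[of f], of "{j}"] by simp

lemma hausdorff_null_imp_outer_measure_zero:
  assumes "hausdorff_null s B" "0 < s"
  shows "hausdorff_outer_measure s B = 0"
proof -
  have pre: "hausdorff_pre s \<delta> B = 0" if \<delta>: "0 < \<delta>" for \<delta>
  proof -
    have "hausdorff_pre s \<delta> B \<le> 0 + ennreal e" if e: "0 < e" for e
    proof -
      have "0 < min e (\<delta> powr s)" using e \<delta> by simp
      then obtain C :: "nat \<Rightarrow> 'a set" where C: "B \<subseteq> (\<Union>j. C j)" "\<And>j. bounded (C j)"
        "(\<Sum>j. ennreal (diameter (C j) powr s)) \<le> ennreal (min e (\<delta> powr s))"
        using assms(1) unfolding hausdorff_null_def by blast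
      have "diameter (C j) \<le> \<delta>" for j
      proof -
        have "ennreal (diameter (C j) powr s) \<le> (\<Sum>j. ennreal (diameter (C j) powr s))"
          by (rule ennreal_le_suminf)
        also note C(3)
        finally have "diameter (C j) powr s \<le> \<delta> powr s"
          using e ennreal_le_iff[of "min e (\<delta> powr s)" "diameter (C j) powr s"] by auto
        then show ?thesis
          using powr_less_mono2[OF assms(2) less_imp_le[OF \<delta>], of "diameter (C j)"] by linarith
      qed
      then have "hausdorff_pre s \<delta> B \<le> (\<Sum>j. ennreal (diameter (C j) powr s))"
        unfolding hausdorff_pre_def using C(1,2) by (intro Inf_lower CollectI exI[of _ C]) blast
      also have "\<dots> \<le> ennreal e" using C(3) by (rule order_trans) (rule ennreal_leI, simp)
      finally show ?thesis by (simp only: add_0)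
    qed
    then have "hausdorff_pre s \<delta> B \<le> 0" by (rule ennreal_le_epsilon)
    then show ?thesis by simp
  qed
  have "((\<lambda>\<delta>. hausdorff_pre s \<delta> B) \<longlongrightarrow> 0) (at_right 0)"
  proof (rule tendsto_eventually)
    show "\<forall>\<^sub>F \<delta> in at_right 0. hausdorff_pre s \<delta> B = 0"
      using eventually_at_right_less[of "0::real"] by eventually_elim (rule pre)
  qed
  from tendsto_Lim[OF trivial_limit_at_right_real this] show ?thesis
    using assms(2) by (simp add: hausdorff_outer_measure_def)
qed

lemma hausdorff_null_subset: "hausdorff_null s B \<Longrightarrow> A \<subseteq> B \<Longrightarrow> hausdorff_null s A"
  unfolding hausdorff_null_def by (meson order_trans)

lemma hausdorff_null_finite_cover:
  assumes "0 < s" and "\<And>e. 0 < e \<Longrightarrow> \<exists>F \<rho>. finite F \<and> B \<subseteq> \<Union>F \<and>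
      (\<forall>C\<in>F. bounded C \<and> diameter C \<le> \<rho>) \<and> 0 \<le> \<rho> \<and> real (card F) * \<rho> powr s \<le> e"
  shows "hausdorff_null s B"
  unfolding hausdorff_null_def
proof (intro allI impI)
  fix e :: real assume "0 < e"
  then obtain F \<rho> where F: "finite F" "B \<subseteq> \<Union>F" "\<And>C. C \<in> F \<Longrightarrow> bounded C"
    "\<And>C. C \<in> F \<Longrightarrow> diameter C \<le> \<rho>" "0 \<le> \<rho>" "real (card F) * \<rho> powr s \<le> e"
    using assms(2) by meson
  obtain g where g: "bij_betw g {0..<card F} F"
    using ex_bij_betw_nat_finite[OF F(1)] by blast
  define C where "C j = (if j < card F then g j else {})" for j
  have gF: "g j \<in> F" if "j < card F" for j using bij_betwE[OF g] that by auto
  have "B \<subseteq> (\<Union>j. C j)"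
  proof
    fix x assume "x \<in> B"
    then obtain A where "A \<in> F" "x \<in> A" using F(2) by auto
    then have "A \<in> g ` {0..<card F}" using bij_betw_imp_surj_on[OF g] by simp
    then obtain j where "j < card F" "g j = A" by auto
    with \<open>x \<in> A\<close> show "x \<in> (\<Union>j. C j)" by (auto simp: C_def)
  qed
  moreover have "bounded (C j)" for j using gF F(3) by (auto simp: C_def)
  moreover have "(\<Sum>j. ennreal (diameter (C j) powr s)) \<le> ennreal e"
  proof -
    have "(\<Sum>j. ennreal (diameter (C j) powr s)) = (\<Sum>j<card F. ennreal (diameter (C j) powr s))"
      by (rule suminf_finite) (auto simp: C_def)
    also have "\<dots> \<le> (\<Sum>j<card F. ennreal (\<rho> powr s))"
      using gF F(3-5) assms(1)
      by (intro sum_mono ennreal_leI powr_mono2) (auto simp: C_def diameter_ge_0)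
    also have "\<dots> = ennreal (real (card F) * \<rho> powr s)"
      by (simp add: ennreal_mult ennreal_of_nat_eq_real_of_nat)
    also have "\<dots> \<le> ennreal e" using F(6) by (rule ennreal_leI)
    finally show ?thesis .
  qed
  ultimately show "\<exists>C. B \<subseteq> (\<Union>j. C j) \<and> (\<forall>j. bounded (C j)) \<and>
     (\<Sum>j. ennreal (diameter (C j) powr s)) \<le> ennreal e" by blast
qed

lemma hausdorff_null_empty [simp]: "hausdorff_null s {}"
  unfolding hausdorff_null_def by (auto intro!: exI[of _ "\<lambda>_. {}"])

lemma hausdorff_null_UN_nat:
  fixes A :: "nat \<Rightarrow> 'a::metric_space set"
  assumes "\<And>i. hausdorff_null s (A i)"
  shows "hausdorff_null s (\<Union>i. A i)"
  unfolding hausdorff_null_def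
proof (intro allI impI)
  fix e :: real assume e: "0 < e"
  have "\<forall>i. \<exists>C :: nat \<Rightarrow> 'a set. A i \<subseteq> (\<Union>j. C j) \<and> (\<forall>j. bounded (C j)) \<and>
     (\<Sum>j. ennreal (diameter (C j) powr s)) \<le> ennreal (e * (1/2) ^ Suc i)"
  proof
    fix i :: nat
    have "0 < e * (1/2) ^ Suc i" using e by simp
    with assms[of i] show "\<exists>C :: nat \<Rightarrow> 'a set. A i \<subseteq> (\<Union>j. C j) \<and> (\<forall>j. bounded (C j)) \<and>
       (\<Sum>j. ennreal (diameter (C j) powr s)) \<le> ennreal (e * (1/2) ^ Suc i)"
      unfolding hausdorff_null_def by blast
  qed
  from choice[OF this] obtain C :: "nat \<Rightarrow> nat \<Rightarrow> 'a set"
    where C: "\<And>i. A i \<subseteq> (\<Union>j. C i j)" "\<And>i j. bounded (C i j)"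
    "\<And>i. (\<Sum>j. ennreal (diameter (C i j) powr s)) \<le> ennreal (e * (1/2) ^ Suc i)"
    by blast
  define K where "K n = case_prod C (prod_decode n)" for n
  have "(\<Union>i. A i) \<subseteq> (\<Union>n. K n)"
  proof
    fix x assume "x \<in> (\<Union>i. A i)"
    then obtain i j where "x \<in> C i j" using C(1) by blast
    then have "x \<in> K (prod_encode (i, j))" by (simp add: K_def)
    then show "x \<in> (\<Union>n. K n)" by blast
  qed
  moreover have "bounded (K n)" for n using C(2) by (simp add: K_def split_beta)
  moreover have "(\<Sum>n. ennreal (diameter (K n) powr s)) \<le> ennreal e"
  proof -
    have "(\<Sum>n. ennreal (diameter (K n) powr s)) = (\<Sum>i. \<Sum>j. ennreal (diameter (C i j) powr s))"
      using suminf_ennreal_2dimen[of "\<lambda>i. \<Sum>j. ennreal (diameter (C i j) powr s)"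
          "\<lambda>x. ennreal (diameter (C (fst x) (snd x)) powr s)"]
      by (simp only: K_def split_beta fst_conv snd_conv)
    also have "\<dots> \<le> (\<Sum>i. ennreal (e * (1/2) ^ Suc i))"
      by (intro suminf_le C(3) summableI)
    also have "\<dots> = ennreal (e * 1)"
      by (rule suminf_ennreal_eq[OF _ sums_mult[OF power_half_series, of e]]) (use e in simp)
    finally show ?thesis by (simp only: mult_1_right)
  qed
  ultimately show "\<exists>C. (\<Union>i. A i) \<subseteq> (\<Union>j. C j) \<and> (\<forall>j. bounded (C j)) \<and>
     (\<Sum>j. ennreal (diameter (C j) powr s)) \<le> ennreal e" by blast
qed

lemma hausdorff_null_UN:
  assumes "countable I" "\<And>i. i \<in> I \<Longrightarrow> hausdorff_null s (A i)"
  shows "hausdorff_null s (\<Union>i\<in>I. A i)"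
proof (cases "I = {}")
  case False
  then have "(\<Union>i\<in>I. A i) = (\<Union>n. A (from_nat_into I n))"
    using range_from_nat_into[OF False assms(1)] by (metis image_image)
  moreover have "hausdorff_null s (\<Union>n. A (from_nat_into I n))"
    by (intro hausdorff_null_UN_nat assms(2) from_nat_into[OF False])
  ultimately show ?thesis by simp
qed simp

lemma hausdorff_null_Un:
  "hausdorff_null s A \<Longrightarrow> hausdorff_null s B \<Longrightarrow> hausdorff_null s (A \<union> B)"
  using hausdorff_null_UN[of "{A, B}" s id] by auto

text \<open>The localisation takes place in the source, not in the target: by the Lindelof property
  countably many of the neighbourhoods cover \<open>D\<close>. Later arguments may therefore shrink
  to a small ball.\<close>

lemma hausdorff_null_locally:
  fixes D :: "'c::second_countable_topology set"
  assumes "\<And>p. p \<in> D \<Longrightarrow> \<exists>N. open N \<and> p \<in> N \<and> hausdorff_null s (\<phi> ` (D \<inter> N))"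
  shows "hausdorff_null s (\<phi> ` D)"
proof -
  obtain N where N: "\<And>p. p \<in> D \<Longrightarrow> open (N p)" "\<And>p. p \<in> D \<Longrightarrow> p \<in> N p"
    "\<And>p. p \<in> D \<Longrightarrow> hausdorff_null s (\<phi> ` (D \<inter> N p))"
    using assms by metis
  obtain G where G: "G \<subseteq> N ` D" "countable G" "\<Union>G = \<Union>(N ` D)"
    using Lindelof[of "N ` D"] N(1) by auto
  have "hausdorff_null s (\<Union>M\<in>G. \<phi> ` (D \<inter> M))"
    using G N(3) by (intro hausdorff_null_UN) auto
  moreover have "\<phi> ` D \<subseteq> (\<Union>M\<in>G. \<phi> ` (D \<inter> M))"
    using G(3) N(2) by blast
  ultimately show ?thesis by (rule hausdorff_null_subset)
qed

text \<open>The differences of points of \<open>S\<close> are almost orthogonal to \<open>W\<close>, so a grid of mesh \<open>\<eta>\<close> in the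
  coordinates of the orthogonal complement of \<open>W\<close> separates points up to distance \<open>O(\<eta>)\<close>.\<close>

lemma grid_cover:
  fixes S :: "'b::euclidean_space set" and \<eta> R :: real
  assumes W: "subspace W" "d \<le> dim W" and "0 < \<eta>" "0 \<le> R"
    and R: "\<And>p p'. p \<in> S \<Longrightarrow> p' \<in> S \<Longrightarrow> norm (p - p') \<le> R"
    and S: "\<And>p p' w. p \<in> S \<Longrightarrow> p' \<in> S \<Longrightarrow> w \<in> W \<Longrightarrow>
       \<bar>w \<bullet> (p - p')\<bar> \<le> (\<eta> + norm (p - p') / 2) * norm w"
  shows "\<exists>F. finite F \<and> real (card F) \<le> (2 * R / \<eta> + 2) ^ (DIM('b) - d) \<and> S \<subseteq> \<Union>F \<and>
    (\<forall>C\<in>F. bounded C \<and> diameter C \<le> (2 + 2 * DIM('b)) * \<eta>)"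
proof (cases "S = {}")
  case True
  then show ?thesis using assms by (intro exI[of _ "{}"]) auto
next
  case False
  then obtain p0 where p0: "p0 \<in> S" by blast
  define W' where "W' = {y \<in> UNIV. \<forall>x\<in>W. orthogonal x y}"
  have "dim W' + dim W = DIM('b)"
    unfolding W'_def using dim_subspace_orthogonal_to_vectors[OF W(1) subspace_UNIV] by simp
  moreover have sub: "subspace W'" unfolding W'_def by (simp add: subspace_orthogonal_to_vectors)
  obtain B where B: "B \<subseteq> W'" "pairwise orthogonal B" "\<And>x. x \<in> B \<Longrightarrow> norm x = 1" "independent B"
    "card B = dim W'" "span B = W'"
    using orthonormal_basis_subspace[OF sub] by metis
  ultimately have cB: "card B \<le> DIM('b) - d" "card B \<le> DIM('b)" using W(2) by auto
  have fB: "finite B" using B(4) independent_bound by blast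
  \<comment> \<open>Split \<open>v = w + z\<close> with \<open>w\<close> in \<open>W\<close>. The
    hypothesis gives \<open>norm w \<le> \<eta> + norm v / 2\<close>, and \<open>z\<close> has at
    most \<open>DIM('b)\<close> coordinates, each at most \<eta>. Absorbing
    \<open>norm v / 2\<close> on the left doubles the rest, whence the factor
    \<open>2 + 2 * DIM('b)\<close>.\<close>
  have close: "norm v \<le> (2 + 2 * DIM('b)) * \<eta>"
    if v: "v = p - p'" "p \<in> S" "p' \<in> S" and vB: "\<And>b. b \<in> B \<Longrightarrow> \<bar>v \<bullet> b\<bar> \<le> \<eta>" for v p p'
  proof -
    obtain w z where wz: "w \<in> span W" "\<And>x. x \<in> span W \<Longrightarrow> orthogonal z x" "v = w + z"
      using orthogonal_subspace_decomp_exists[of W v] by metis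
    have wW: "w \<in> W" using wz(1) W(1) by (metis span_eq_iff)
    have zw: "z \<bullet> w = 0" using wz(2)[OF wz(1)] by (simp add: orthogonal_def)
    have "norm w * norm w = w \<bullet> v"
      using wz(3) zw by (simp add: inner_add_right inner_commute flip: power2_norm_eq_inner power2_eq_square)
    also have "\<dots> \<le> (\<eta> + norm v / 2) * norm w" using S[OF v(2,3) wW] v(1) by simp
    finally have nw: "norm w \<le> \<eta> + norm v / 2"
      using assms(3) by (cases "w = 0") auto
    have "z \<in> W'" using wz(2) span_superset[of W]
      by (auto simp: W'_def orthogonal_commute)
    have "z = (\<Sum>b\<in>B. (z \<bullet> b) *\<^sub>R b)"
      using orthonormal_basis_expand[OF B(2,3) _ fB] \<open>z \<in> W'\<close> B(6) by simp
    then have "norm z \<le> (\<Sum>b\<in>B. norm ((z \<bullet> b) *\<^sub>R b))" by (metis norm_sum)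
    also have "\<dots> \<le> (\<Sum>b\<in>B. \<eta>)"
    proof (rule sum_mono)
      fix b assume b: "b \<in> B"
      have "b \<bullet> w = 0" using B(1) b wW by (auto simp: W'_def orthogonal_def inner_commute)
      then show "norm ((z \<bullet> b) *\<^sub>R b) \<le> \<eta>"
        using vB[OF b] B(3)[OF b] wz(3) by (simp add: inner_add_right inner_commute)
    qed
    also have "\<dots> \<le> DIM('b) * \<eta>" using cB(2) assms(3) by simp
    finally have "norm z \<le> DIM('b) * \<eta>" .
    moreover have "norm v \<le> norm w + norm z" using wz(3) norm_triangle_ineq by simp
    ultimately have "norm v \<le> \<eta> + norm v / 2 + DIM('b) * \<eta>"
      using nw by linarith
    then show ?thesis by (simp add: algebra_simps)
  qed
  \<comment> \<open>Cells are the sets of points with the same integer vector \<open>g p\<close>.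
    Each entry takes at most \<open>2 * R / \<eta> + 2\<close> values; the summand 2 covers rounding
    at the lower end and the counting of both ends.\<close>
  define g where "g p = (\<lambda>b\<in>B. \<lfloor>((p - p0) \<bullet> b) / \<eta>\<rfloor>)" for p
  define Q where "Q = PiE B (\<lambda>_. {\<lfloor>- (R / \<eta>)\<rfloor>..\<lfloor>R / \<eta>\<rfloor>})"
  have fQ: "finite Q" unfolding Q_def by (rule finite_PiE[OF fB]) auto
  have gQ: "g p \<in> Q" if "p \<in> S" for p
  proof -
    have "- R \<le> (p - p0) \<bullet> b \<and> (p - p0) \<bullet> b \<le> R" if "b \<in> B" for b
      using Cauchy_Schwarz_ineq2[of "p - p0" b] R[OF \<open>p \<in> S\<close> p0] B(3)[OF that] by auto
    then have "- (R / \<eta>) \<le> ((p - p0) \<bullet> b) / \<eta>" "((p - p0) \<bullet> b) / \<eta> \<le> R / \<eta>" if "b \<in> B" for b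
      using assms(3) that by (auto simp: field_simps)
    then show ?thesis by (auto simp: Q_def g_def intro!: floor_mono)
  qed
  let ?F = "(\<lambda>y. {p \<in> S. g p = y}) ` Q"
  have "real (card ?F) \<le> real (card Q)" using card_image_le[OF fQ] by simp
  also have "\<dots> = real (card {\<lfloor>- (R / \<eta>)\<rfloor>..\<lfloor>R / \<eta>\<rfloor>}) ^ card B"
    by (simp add: Q_def card_PiE[OF fB])
  also have "\<dots> \<le> (2 * R / \<eta> + 2) ^ card B"
  proof (rule power_mono)
    have "0 \<le> R / \<eta>" using assms(3,4) by simp
    then have "\<lfloor>- (R / \<eta>)\<rfloor> \<le> \<lfloor>R / \<eta>\<rfloor>" by (intro floor_mono) simp
    then show "real (card {\<lfloor>- (R / \<eta>)\<rfloor>..\<lfloor>R / \<eta>\<rfloor>}) \<le> 2 * R / \<eta> + 2" by simp linarith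
  qed simp
  also have "\<dots> \<le> (2 * R / \<eta> + 2) ^ (DIM('b) - d)"
    using assms(3,4) cB by (intro power_increasing) auto
  finally have "real (card ?F) \<le> (2 * R / \<eta> + 2) ^ (DIM('b) - d)" .
  moreover have "S \<subseteq> \<Union>?F" using gQ by auto
  moreover have "bounded {p \<in> S. g p = y} \<and> diameter {p \<in> S. g p = y} \<le> (2 + 2 * DIM('b)) * \<eta>" for y
  proof
    have *: "dist p p' \<le> (2 + 2 * DIM('b)) * \<eta>"
      if "p \<in> {p \<in> S. g p = y}" "p' \<in> {p \<in> S. g p = y}" for p p'
      unfolding dist_norm
    proof (rule close[OF refl])
      fix b assume b: "b \<in> B"
      have "\<lfloor>((p - p0) \<bullet> b) / \<eta>\<rfloor> = \<lfloor>((p' - p0) \<bullet> b) / \<eta>\<rfloor>"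
        using that b by (auto simp: g_def dest: fun_cong[of _ _ b])
      then have "\<bar>((p - p0) \<bullet> b) / \<eta> - ((p' - p0) \<bullet> b) / \<eta>\<bar> \<le> 1" by linarith
      then have "\<bar>((p - p') \<bullet> b) / \<eta>\<bar> \<le> 1"
        by (simp add: inner_diff_left diff_divide_distrib)
      then show "\<bar>(p - p') \<bullet> b\<bar> \<le> \<eta>" using assms(3) by simp
    qed (use that in auto)
    show "diameter {p \<in> S. g p = y} \<le> (2 + 2 * DIM('b)) * \<eta>"
      by (rule diameter_le) (use * assms(3) in \<open>auto simp: dist_norm\<close>)
    show "bounded {p \<in> S. g p = y}"
      using R by (auto simp: bounded_two_points dist_norm)
  qed
  ultimately show ?thesis using fQ by (intro exI[of _ ?F]) auto
qed

lemma small_powr: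
  fixes a b e :: real
  assumes "0 < a" "0 < b" "0 < e"
  obtains x where "0 < x" "x < b" "x powr a \<le> e"
proof
  let ?x = "min (b / 2) (e powr (1 / a))"
  show "0 < ?x" "?x < b" using assms by auto
  have "?x powr a \<le> (e powr (1 / a)) powr a" using assms by (intro powr_mono2) auto
  then show "?x powr a \<le> e" using assms by (simp add: powr_powr)
qed

text \<open>\<open>D\<close> falls into \<open>O(\<epsilon>\<^sup>-\<^sup>n)\<close> pieces of diameter \<open>\<epsilon>\<close>, and the image of each piece into
  \<open>O((\<epsilon> / \<eta>)\<^sup>m\<^sup>-\<^sup>d)\<close> pieces of diameter \<open>O(\<eta>)\<close>.\<close>

lemma hausdorff_null_two_scales:
  fixes D :: "'c::euclidean_space set" and \<phi> :: "'c \<Rightarrow> 'b::euclidean_space"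
  assumes \<phi>: "\<And>p p'. norm (\<phi> p - \<phi> p') \<le> norm (p - p')" and D: "bounded D" and "0 < s"
    and V: "subspace V" "DIM('c) \<le> dim V + n"
    and DV: "\<And>p p' w. p \<in> D \<Longrightarrow> p' \<in> D \<Longrightarrow> w \<in> V \<Longrightarrow> \<bar>w \<bullet> (p - p')\<bar> \<le> norm (p - p') / 2 * norm w"
    and scales: "\<And>e. 0 < e \<Longrightarrow> \<exists>\<epsilon> \<eta>. 0 < \<eta> \<and> \<eta> \<le> \<epsilon> \<and> \<epsilon> \<le> 1 \<and> (\<epsilon> / \<eta>) ^ (DIM('b) - d) * \<eta> powr s \<le> e * \<epsilon> ^ n \<and>
      (\<forall>S\<subseteq>D. (\<forall>p\<in>S. \<forall>p'\<in>S. norm (p - p') \<le> \<epsilon>) \<longrightarrow> (\<exists>W. subspace W \<and> d \<le> dim W \<and>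
        (\<forall>p\<in>S. \<forall>p'\<in>S. \<forall>w\<in>W. \<bar>w \<bullet> (\<phi> p - \<phi> p')\<bar> \<le> (\<eta> + norm (\<phi> p - \<phi> p') / 2) * norm w)))"
  shows "hausdorff_null s (\<phi> ` D)"
proof (rule hausdorff_null_finite_cover[OF \<open>0 < s\<close>])
  fix e :: real assume e: "0 < e"
  obtain R0 where R0: "\<And>p. p \<in> D \<Longrightarrow> norm p \<le> R0" using D by (auto simp: bounded_iff)
  define R where "R = 2 * \<bar>R0\<bar>"
  have R: "0 \<le> R" "norm (p - p') \<le> R" if "p \<in> D" "p' \<in> D" for p p'
    using R0[OF that(1)] R0[OF that(2)] norm_triangle_ineq4[of p p'] by (auto simp: R_def)
  have R0: "0 \<le> R" by (simp add: R_def)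
  define A :: real where "A = 2 + 2 * DIM('c)"
  define B :: real where "B = 2 + 2 * DIM('b)"
  have A: "0 < A" and B: "0 < B" by (auto simp: A_def B_def)
  \<comment> \<open>All constants at once: the first grid contributes
    \<open>(2 * R * A + 2) ^ n\<close>; the second a power of 4, because
    \<open>\<eta> \<le> \<epsilon>\<close> gives
    \<open>2 * \<epsilon> / \<eta> + 2 \<le> 4 * (\<epsilon> / \<eta>)\<close>; the final diameters
    \<open>B * \<eta>\<close> contribute \<open>B powr s\<close>.\<close>
  define K where "K = (2 * R * A + 2) ^ n * 4 ^ (DIM('b) - d) * B powr s"
  have K: "0 < K" unfolding K_def using R0 A B
    by (intro mult_pos_pos zero_less_power) (auto intro: add_nonneg_pos)
  obtain \<epsilon> \<eta> where \<eta>: "0 < \<eta>" "\<eta> \<le> \<epsilon>" "\<epsilon> \<le> 1"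
    and le: "(\<epsilon> / \<eta>) ^ (DIM('b) - d) * \<eta> powr s \<le> e / K * \<epsilon> ^ n"
    and flat: "\<And>S. S \<subseteq> D \<Longrightarrow> (\<And>p p'. p \<in> S \<Longrightarrow> p' \<in> S \<Longrightarrow> norm (p - p') \<le> \<epsilon>) \<Longrightarrow> \<exists>W. subspace W \<and> d \<le> dim W \<and>
        (\<forall>p\<in>S. \<forall>p'\<in>S. \<forall>w\<in>W. \<bar>w \<bullet> (\<phi> p - \<phi> p')\<bar> \<le> (\<eta> + norm (\<phi> p - \<phi> p') / 2) * norm w)"
    using scales[of "e / K"] e K by (metis divide_pos_pos)
  have \<epsilon>: "0 < \<epsilon>" "0 < \<epsilon> / A" using \<eta> A by auto
  \<comment> \<open>The mesh is \<open>\<epsilon> / A\<close> because a grid returns sets of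
    diameter up to \<open>A\<close> times its mesh, and diameter \<epsilon> is wanted.\<close>
  have "\<exists>F. finite F \<and> real (card F) \<le> (2 * R / (\<epsilon> / A) + 2) ^ (DIM('c) - dim V) \<and> D \<subseteq> \<Union>F \<and>
    (\<forall>C\<in>F. bounded C \<and> diameter C \<le> (2 + 2 * DIM('c)) * (\<epsilon> / A))"
  proof (rule grid_cover[OF V(1) order_refl \<epsilon>(2) R0 R(2)])
    show "\<bar>w \<bullet> (p - p')\<bar> \<le> (\<epsilon> / A + norm (p - p') / 2) * norm w"
      if "p \<in> D" "p' \<in> D" "w \<in> V" for p p' w
      by (rule order_trans[OF DV[OF that]], rule mult_right_mono) (use \<epsilon>(2) in auto)
  qed
  then obtain F where F: "finite F" "real (card F) \<le> (2 * R / (\<epsilon> / A) + 2) ^ (DIM('c) - dim V)" "D \<subseteq> \<Union>F"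
    "\<And>C. C \<in> F \<Longrightarrow> bounded C" "\<And>C. C \<in> F \<Longrightarrow> diameter C \<le> \<epsilon>"
    using A unfolding A_def[symmetric] by auto
  have "\<exists>G. finite G \<and> real (card G) \<le> (2 * \<epsilon> / \<eta> + 2) ^ (DIM('b) - d) \<and> \<phi> ` (D \<inter> C) \<subseteq> \<Union>G \<and>
    (\<forall>E\<in>G. bounded E \<and> diameter E \<le> (2 + 2 * DIM('b)) * \<eta>)" if C: "C \<in> F" for C
  proof -
    have close: "norm (p - p') \<le> \<epsilon>" if "p \<in> D \<inter> C" "p' \<in> D \<inter> C" for p p'
      using diameter_bounded_bound[OF F(4)[OF C], of p p'] F(5)[OF C] that by (simp add: dist_norm)
    obtain W where W: "subspace W" "d \<le> dim W"
      "\<And>p p' w. p \<in> D \<inter> C \<Longrightarrow> p' \<in> D \<inter> C \<Longrightarrow> w \<in> W \<Longrightarrow>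
         \<bar>w \<bullet> (\<phi> p - \<phi> p')\<bar> \<le> (\<eta> + norm (\<phi> p - \<phi> p') / 2) * norm w"
      using flat[of "D \<inter> C"] close by blast
    show ?thesis
      by (rule grid_cover[OF W(1,2) \<eta>(1) less_imp_le[OF \<epsilon>(1)]])
        (use W(3) close \<phi> in \<open>blast intro: order_trans\<close>)+
  qed
  then have "\<forall>C\<in>F. \<exists>G. finite G \<and> real (card G) \<le> (2 * \<epsilon> / \<eta> + 2) ^ (DIM('b) - d) \<and>
    \<phi> ` (D \<inter> C) \<subseteq> \<Union>G \<and> (\<forall>E\<in>G. bounded E \<and> diameter E \<le> B * \<eta>)"
    unfolding B_def[symmetric] by blast
  from bchoice[OF this] obtain G where G: "\<And>C. C \<in> F \<Longrightarrow> finite (G C)"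
    "\<And>C. C \<in> F \<Longrightarrow> real (card (G C)) \<le> (2 * \<epsilon> / \<eta> + 2) ^ (DIM('b) - d)"
    "\<And>C. C \<in> F \<Longrightarrow> \<phi> ` (D \<inter> C) \<subseteq> \<Union>(G C)"
    "\<And>C E. C \<in> F \<Longrightarrow> E \<in> G C \<Longrightarrow> bounded E" "\<And>C E. C \<in> F \<Longrightarrow> E \<in> G C \<Longrightarrow> diameter E \<le> B * \<eta>"
    by blast
  let ?H = "\<Union>C\<in>F. G C"
  have "real (card ?H) \<le> (\<Sum>C\<in>F. real (card (G C)))"
    using card_UN_le[OF F(1), of G] by (simp flip: of_nat_sum)
  also have "\<dots> \<le> real (card F) * (2 * \<epsilon> / \<eta> + 2) ^ (DIM('b) - d)"
    using sum_mono[of F "\<lambda>C. real (card (G C))", OF G(2)] by simp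
  also have "\<dots> \<le> ((2 * R * A + 2) / \<epsilon>) ^ n * (4 * (\<epsilon> / \<eta>)) ^ (DIM('b) - d)"
  proof (intro mult_mono power_mono)
    have "2 * R / (\<epsilon> / A) + 2 \<le> (2 * R * A + 2) / \<epsilon>" using \<eta> \<epsilon> A by (simp add: field_simps)
    then have "(2 * R / (\<epsilon> / A) + 2) ^ (DIM('c) - dim V) \<le> ((2 * R * A + 2) / \<epsilon>) ^ (DIM('c) - dim V)"
      using R0 \<epsilon> A by (intro power_mono) (auto intro!: add_nonneg_nonneg)
    also have "\<dots> \<le> ((2 * R * A + 2) / \<epsilon>) ^ n"
    proof (rule power_increasing)
      have "0 \<le> 2 * R * A" using R0 A by simp
      then show "1 \<le> (2 * R * A + 2) / \<epsilon>" using \<epsilon>(1) \<eta>(3) by (simp add: field_simps)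
    qed (use V(2) in auto)
    finally show "real (card F) \<le> ((2 * R * A + 2) / \<epsilon>) ^ n" using F(2) by simp
    show "2 * \<epsilon> / \<eta> + 2 \<le> 4 * (\<epsilon> / \<eta>)" using \<eta> by (simp add: field_simps)
  qed (use R0 A \<epsilon> \<eta> in auto)
  finally have card: "real (card ?H) \<le> ((2 * R * A + 2) / \<epsilon>) ^ n * (4 * (\<epsilon> / \<eta>)) ^ (DIM('b) - d)" .
  have "real (card ?H) * (B * \<eta>) powr s
      \<le> ((2 * R * A + 2) / \<epsilon>) ^ n * (4 * (\<epsilon> / \<eta>)) ^ (DIM('b) - d) * (B * \<eta>) powr s"
    by (rule mult_right_mono[OF card]) simp
  also have "\<dots> = K * ((\<epsilon> / \<eta>) ^ (DIM('b) - d) * \<eta> powr s) / \<epsilon> ^ n"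
    unfolding K_def using B \<eta>(1) by (simp add: powr_mult power_divide power_mult_distrib mult_ac)
  also have "\<dots> \<le> K * (e / K * \<epsilon> ^ n) / \<epsilon> ^ n"
    using le K \<epsilon>(1) by (intro divide_right_mono mult_left_mono) auto
  also have "\<dots> = e" using K \<epsilon>(1) by simp
  finally have total: "real (card ?H) * (B * \<eta>) powr s \<le> e" .
  show "\<exists>F \<rho>. finite F \<and> \<phi> ` D \<subseteq> \<Union>F \<and> (\<forall>C\<in>F. bounded C \<and> diameter C \<le> \<rho>) \<and> 0 \<le> \<rho> \<and>
      real (card F) * \<rho> powr s \<le> e"
  proof (intro exI[of _ ?H] exI[of _ "B * \<eta>"] conjI total)
    show "finite ?H" using F(1) G(1) by blast
    show "\<phi> ` D \<subseteq> \<Union>?H" using F(3) G(3) by blast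
    show "\<forall>C\<in>?H. bounded C \<and> diameter C \<le> B * \<eta>" using G(4,5) by blast
    show "0 \<le> B * \<eta>" using B \<eta> by simp
  qed
qed

text \<open>One scale suffices when \<open>s\<close> exceeds the dimension: for
  \<open>\<eta> = \<epsilon>\<close> and \<open>W = {0}\<close> the second subdivision costs only a
  bounded factor, and \<open>x powr (s - n)\<close> can be made small.\<close>

lemma hausdorff_null_dim_less:
  fixes D :: "'c::euclidean_space set" and \<phi> :: "'c \<Rightarrow> 'b::euclidean_space"
  assumes "\<And>p p'. norm (\<phi> p - \<phi> p') \<le> norm (p - p')" and "bounded D"
    and "subspace V" "DIM('c) \<le> dim V + n"
    and "\<And>p p' w. p \<in> D \<Longrightarrow> p' \<in> D \<Longrightarrow> w \<in> V \<Longrightarrow> \<bar>w \<bullet> (p - p')\<bar> \<le> norm (p - p') / 2 * norm w"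
    and s: "real n < s"
  shows "hausdorff_null s (\<phi> ` D)"
proof (rule hausdorff_null_two_scales[where d = 0, OF assms(1,2) _ assms(3-5)])
  show "0 < s" using s by linarith
  fix e :: real assume e: "0 < e"
  then obtain x where x: "0 < x" "x < 1" "x powr (s - n) \<le> e"
    using small_powr[of "s - n" 1 e] s by auto
  have "x powr s = x powr (s - n) * x ^ n"
    using x(1) by (simp flip: powr_realpow powr_add)
  also have "\<dots> \<le> e * x ^ n" using x by (intro mult_right_mono) auto
  finally have "(x / x) ^ (DIM('b) - 0) * x powr s \<le> e * x ^ n" using x by simp
  then show "\<exists>\<epsilon> \<eta>. 0 < \<eta> \<and> \<eta> \<le> \<epsilon> \<and> \<epsilon> \<le> 1 \<and> (\<epsilon> / \<eta>) ^ (DIM('b) - 0) * \<eta> powr s \<le> e * \<epsilon> ^ n \<and>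
      (\<forall>S\<subseteq>D. (\<forall>p\<in>S. \<forall>p'\<in>S. norm (p - p') \<le> \<epsilon>) \<longrightarrow> (\<exists>W. subspace W \<and> 0 \<le> dim W \<and>
        (\<forall>p\<in>S. \<forall>p'\<in>S. \<forall>w\<in>W. \<bar>w \<bullet> (\<phi> p - \<phi> p')\<bar> \<le> (\<eta> + norm (\<phi> p - \<phi> p') / 2) * norm w)))"
    using x by (intro exI[of _ x] conjI allI impI exI[of _ "{0}"]) auto
qed

section \<open>Transversal zero sets\<close>

lemma linearization_bound:
  fixes P :: "'c::euclidean_space \<Rightarrow> 'b::real_normed_vector"
  assumes "convex B" and D: "\<And>q. q \<in> B \<Longrightarrow> (P has_derivative D q) (at q)"
    and close: "\<And>q. q \<in> B \<Longrightarrow> (\<Sum>b\<in>Basis. norm (D q b - D p0 b)) \<le> \<tau>"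
    and "p0 \<in> B" "p \<in> B" "p' \<in> B"
  shows "norm (P p - P p' - D p0 (p - p')) \<le> \<tau> * norm (p - p')"
proof -
  have "norm (P p - P p' - D p0 (p - p')) \<le> norm (p - p') * \<tau>"
  proof (rule differentiable_bound_linearization[OF _ _ _ assms(4)])
    show "p' + t *\<^sub>R (p - p') \<in> B" if "t \<in> {0..1}" for t
    proof -
      have "p' + t *\<^sub>R (p - p') = (1 - t) *\<^sub>R p' + t *\<^sub>R p" by (simp add: algebra_simps)
      then show ?thesis using convexD_alt[OF assms(1,6,5)] that by simp
    qed
    show "(P has_derivative D q) (at q within B)" if "q \<in> B" for q
      using D[OF that] by (rule has_derivative_at_withinI)
    show "onorm (D q - D p0) \<le> \<tau>" if q: "q \<in> B" for q
    proof (rule onorm_le)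
      fix x
      have "linear (\<lambda>x. D q x - D p0 x)"
        using D[OF q] D[OF assms(4)] by (intro linear_compose_sub has_derivative_linear)
      from norm_linear_le_sum_Basis[OF this, of x]
      show "norm ((D q - D p0) x) \<le> \<tau> * norm x"
        using close[OF q] by simp (meson mult_right_mono norm_ge_zero order_trans)
    qed
  qed
  then show ?thesis by (simp add: mult.commute)
qed

lemma Ck_on_deriv_close:
  fixes P :: "'c::euclidean_space \<Rightarrow> 'b::real_normed_vector"
  assumes "open U" "p \<in> U" "Ck_on (Suc 0) P U" "0 < e"
  obtains r where "0 < r" "ball p r \<subseteq> U"
    "\<And>q. q \<in> ball p r \<Longrightarrow> (\<Sum>b\<in>Basis. norm (frechet_derivative P (at q) b - frechet_derivative P (at p) b)) < e"
proof -
  have c: "isCont (\<lambda>q. frechet_derivative P (at q) b) p" for b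
    using assms(1-3) by (simp add: continuous_on_eq_continuous_at)
  have "isCont (\<lambda>q. \<Sum>b\<in>Basis. norm (frechet_derivative P (at q) b - frechet_derivative P (at p) b)) p"
    by (intro continuous_intros c)
  then obtain r1 where r1: "0 < r1" "\<And>q. dist q p < r1 \<Longrightarrow>
     dist (\<Sum>b\<in>Basis. norm (frechet_derivative P (at q) b - frechet_derivative P (at p) b))
          (\<Sum>b\<in>Basis. norm (frechet_derivative P (at p) b - frechet_derivative P (at p) b)) < e"
    using assms(4) unfolding continuous_at_eps_delta by meson
  obtain r2 where r2: "0 < r2" "ball p r2 \<subseteq> U" using assms(1,2) openE by blast
  show ?thesis
  proof (rule that[of "min r1 r2"])
    fix q assume "q \<in> ball p (min r1 r2)"
    then show "(\<Sum>b\<in>Basis. norm (frechet_derivative P (at q) b - frechet_derivative P (at p) b)) < e"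
      using r1(2)[of q] by (simp add: dist_commute dist_real_def)
  qed (use r1 r2 in auto)
qed

text \<open>\<open>V\<close> is the range of the adjoint of the differential at \<open>p0\<close>,
  the orthogonal complement of its kernel; \<open>inj\<close> says that this adjoint is injective,
  with lower bound \<open>m\<close>. If \<open>P\<close> vanishes at \<open>p\<close> and
  \<open>p'\<close>, linearization bounds the differential on \<open>p - p'\<close> by
  \<open>m / 2 * norm (p - p')\<close>, and pairing with \<open>c\<close>, where
  \<open>w = A c\<close> and \<open>m * norm c \<le> norm w\<close>, leaves the factor 1/2.\<close>

lemma zero_set_transversal_subspace:
  fixes P :: "'c::euclidean_space \<Rightarrow> 'a::euclidean_space"
  assumes "open U" "p0 \<in> U" "Ck_on (Suc 0) P U"
    and inj: "\<And>c. (\<And>v. c \<bullet> frechet_derivative P (at p0) v = 0) \<Longrightarrow> c = 0"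
  obtains r V where "0 < r" "ball p0 r \<subseteq> U" "subspace V" "dim V = DIM('a)"
    "\<And>p p' w. \<lbrakk>p \<in> ball p0 r; p' \<in> ball p0 r; P p = 0; P p' = 0; w \<in> V\<rbrakk> \<Longrightarrow>
       \<bar>w \<bullet> (p - p')\<bar> \<le> norm (p - p') / 2 * norm w"
proof -
  define D where "D q = frechet_derivative P (at q)" for q
  have der: "(P has_derivative D q) (at q)" if "q \<in> U" for q
    unfolding D_def using Ck_on_has_derivative[OF assms(3) _ that] by simp
  have lin: "linear (D p0)" using der[OF assms(2)] by (rule has_derivative_linear)
  define A where "A = adjoint (D p0)"
  have A: "linear A" "A c \<bullet> v = c \<bullet> D p0 v" for c v
    unfolding A_def using adjoint_linear[OF lin] adjoint_works[OF lin] by (auto simp: inner_commute)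
  have "inj A"
    unfolding linear_injective_0[OF A(1)] using A(2) inj unfolding D_def by (metis inner_zero_left)
  then obtain m where m: "0 < m" "\<And>c. m * norm c \<le> norm (A c)"
    using linear_inj_bounded_below_pos[OF A(1)] by blast
  obtain r where r: "0 < r" "ball p0 r \<subseteq> U"
    "\<And>q. q \<in> ball p0 r \<Longrightarrow> (\<Sum>b\<in>Basis. norm (D q b - D p0 b)) < m / 2"
    unfolding D_def by (rule Ck_on_deriv_close[OF assms(1-3), of "m / 2"]) (use m(1) in auto)
  show ?thesis
  proof (rule that[OF r(1,2)])
    show "subspace (range A)" using linear_subspace_image[OF A(1)] by simp
    show "dim (range A) = DIM('a)" using dim_image_eq[OF A(1), of UNIV] \<open>inj A\<close> by simp
    fix p p' w
    assume p: "p \<in> ball p0 r" "p' \<in> ball p0 r" "P p = 0" "P p' = 0" and "w \<in> range A"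
    then obtain c where c: "w = A c" by auto
    have "norm (P p - P p' - D p0 (p - p')) \<le> m / 2 * norm (p - p')"
      using r p(1,2) by (intro linearization_bound[of "ball p0 r"] der) (auto intro: less_imp_le)
    then have *: "norm (D p0 (p - p')) \<le> m / 2 * norm (p - p')" using p(3,4) by simp
    have "\<bar>w \<bullet> (p - p')\<bar> \<le> norm c * norm (D p0 (p - p'))"
      unfolding c A(2) by (rule Cauchy_Schwarz_ineq2)
    also have "\<dots> \<le> norm c * (m / 2 * norm (p - p'))" by (rule mult_left_mono[OF *]) simp
    also have "\<dots> = (m * norm c) * (norm (p - p') / 2)" by simp
    also have "\<dots> \<le> norm w * (norm (p - p') / 2)"
      unfolding c by (rule mult_right_mono[OF m(2)]) simp
    finally show "\<bar>w \<bullet> (p - p')\<bar> \<le> norm (p - p') / 2 * norm w" by (simp add: mult.commute)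
  qed
qed

lemma norm_fst_snd_le: "norm (fst p) \<le> norm p" "norm (snd p) \<le> norm p"
  by (cases p, simp add: norm_fst_le norm_snd_le)+

lemma snd_dist_le: "norm (snd p - snd p') \<le> norm (p - p')"
  using norm_fst_snd_le(2)[of "p - p'"] by simp

lemma Ck_on_Pair:
  assumes "open S" "Ck_on k f S" "Ck_on k g S"
  shows "Ck_on k (\<lambda>x. (f x, g x)) S"
  using assms(2,3)
proof (induction k arbitrary: f g)
  case 0
  then show ?case by (simp add: continuous_on_Pair)
next
  case (Suc k)
  show ?case
    by (rule Ck_on_SucI[OF assms(1) has_derivative_Pair[OF Ck_on_has_derivative[OF Suc.prems(1)]
          Ck_on_has_derivative[OF Suc.prems(2)]]])
      (use Suc in auto)
qed

section \<open>Envelopes of hypersurfaces\<close>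

definition deriv_fst :: "(real \<times> 'b::real_normed_vector \<Rightarrow> real) \<Rightarrow> real \<times> 'b \<Rightarrow> real" where
  "deriv_fst f p = frechet_derivative f (at p) (1, 0)"

lemma Ck_on_deriv_fst: "Ck_on (Suc k) f S \<Longrightarrow> Ck_on k (deriv_fst f) S"
  unfolding deriv_fst_def [abs_def] by simp

lemma Ck_on_deriv_fst_funpow: "Ck_on k f S \<Longrightarrow> j \<le> k \<Longrightarrow> Ck_on (k - j) ((deriv_fst ^^ j) f) S"
proof (induction j)
  case (Suc j)
  then have "Ck_on (Suc (k - Suc j)) ((deriv_fst ^^ j) f) S" by (simp add: Suc_diff_Suc del: Ck_on.simps)
  then show ?case by (simp add: Ck_on_deriv_fst del: Ck_on.simps)
qed simp

lemma DERIV_deriv_fst: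
  assumes "Ck_on k f S" "0 < k" "(t, \<pi>) \<in> S"
  shows "DERIV (\<lambda>\<tau>. f (\<tau>, \<pi>)) t :> deriv_fst f (t, \<pi>)"
proof -
  have f: "(f has_derivative frechet_derivative f (at (t, \<pi>))) (at (t, \<pi>))"
    using Ck_on_has_derivative[OF assms] .
  have "((\<lambda>\<tau>. (\<tau>, \<pi>)) has_derivative (\<lambda>h. (h, 0))) (at t)"
    by (auto intro!: derivative_eq_intros)
  from has_derivative_compose[OF this f]
  have "((\<lambda>\<tau>. f (\<tau>, \<pi>)) has_derivative (\<lambda>h. frechet_derivative f (at (t, \<pi>)) (h, 0))) (at t)" .
  moreover have "frechet_derivative f (at (t, \<pi>)) (h, 0) = deriv_fst f (t, \<pi>) * h" for h
    using linear_scale[OF has_derivative_linear[OF f], of h "(1, 0)"] by (simp add: deriv_fst_def)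
  ultimately show ?thesis by (simp add: has_field_derivative_def)
qed

text \<open>The remainder is stated with the k-th derivative itself rather than one of order k + 1.
  As that derivative also vanishes at the flat points, its continuity will supply a small
  \<open>\<delta>\<close>; the factorial is simply dropped.\<close>

lemma flat_taylor_bound:
  fixes f :: "real \<times> 'b::real_normed_vector \<Rightarrow> real"
  assumes f: "Ck_on k f S" "0 < k" and seg: "\<And>\<tau>. min u t \<le> \<tau> \<Longrightarrow> \<tau> \<le> max u t \<Longrightarrow> (\<tau>, \<pi>) \<in> S"
    and flat: "\<And>j. j < k \<Longrightarrow> (deriv_fst ^^ j) f (t, \<pi>) = 0"
    and le: "\<And>\<tau>. min u t \<le> \<tau> \<Longrightarrow> \<tau> \<le> max u t \<Longrightarrow> \<bar>(deriv_fst ^^ k) f (\<tau>, \<pi>)\<bar> \<le> \<delta>"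
  shows "\<bar>f (u, \<pi>)\<bar> \<le> \<delta> * \<bar>u - t\<bar> ^ k"
proof (cases "u = t")
  case True
  then show ?thesis using flat[of 0] f(2) by (simp add: zero_power)
next
  case False
  have "\<exists>\<tau>. (if u < t then u < \<tau> \<and> \<tau> < t else t < \<tau> \<and> \<tau> < u) \<and>
     f (u, \<pi>) = (\<Sum>m<k. (deriv_fst ^^ m) f (t, \<pi>) / fact m * (u - t) ^ m) + (deriv_fst ^^ k) f (\<tau>, \<pi>) / fact k * (u - t) ^ k"
  proof (rule Taylor[where f = "\<lambda>\<tau>. f (\<tau>, \<pi>)" and diff = "\<lambda>m \<tau>. (deriv_fst ^^ m) f (\<tau>, \<pi>)"
        and a = "min u t" and b = "max u t"])
    show "\<forall>m \<tau>. m < k \<and> min u t \<le> \<tau> \<and> \<tau> \<le> max u t \<longrightarrow>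
       DERIV (\<lambda>\<tau>. (deriv_fst ^^ m) f (\<tau>, \<pi>)) \<tau> :> (deriv_fst ^^ Suc m) f (\<tau>, \<pi>)"
    proof (intro allI impI)
      fix m \<tau> assume m: "m < k \<and> min u t \<le> \<tau> \<and> \<tau> \<le> max u t"
      then have "(\<tau>, \<pi>) \<in> S" by (intro seg) auto
      then show "DERIV (\<lambda>\<tau>. (deriv_fst ^^ m) f (\<tau>, \<pi>)) \<tau> :> (deriv_fst ^^ Suc m) f (\<tau>, \<pi>)"
        using DERIV_deriv_fst[OF Ck_on_deriv_fst_funpow[OF f(1), of m]] m by simp
    qed
  qed (use f False in auto)
  then obtain \<tau> where \<tau>: "if u < t then u < \<tau> \<and> \<tau> < t else t < \<tau> \<and> \<tau> < u"
    "f (u, \<pi>) = (\<Sum>m<k. (deriv_fst ^^ m) f (t, \<pi>) / fact m * (u - t) ^ m) + (deriv_fst ^^ k) f (\<tau>, \<pi>) / fact k * (u - t) ^ k"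
    by blast
  have d: "\<bar>(deriv_fst ^^ k) f (\<tau>, \<pi>)\<bar> \<le> \<delta>" using \<tau>(1) by (intro le) (auto split: if_splits)
  have "f (u, \<pi>) = (deriv_fst ^^ k) f (\<tau>, \<pi>) / fact k * (u - t) ^ k" using \<tau>(2) flat by simp
  then have "\<bar>f (u, \<pi>)\<bar> = \<bar>(deriv_fst ^^ k) f (\<tau>, \<pi>)\<bar> / fact k * \<bar>u - t\<bar> ^ k"
    by (simp add: abs_mult power_abs)
  also have "\<dots> \<le> \<delta> * \<bar>u - t\<bar> ^ k"
  proof (rule mult_right_mono)
    have "\<bar>(deriv_fst ^^ k) f (\<tau>, \<pi>)\<bar> / fact k \<le> \<bar>(deriv_fst ^^ k) f (\<tau>, \<pi>)\<bar> / 1"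
      by (intro divide_left_mono) auto
    then show "\<bar>(deriv_fst ^^ k) f (\<tau>, \<pi>)\<bar> / fact k \<le> \<delta>" using d by simp
  qed simp
  finally show ?thesis .
qed

text \<open>The origin of the critical exponent: with
  \<open>\<eta> = \<delta> * \<epsilon> ^ k\<close>, (\<epsilon> / \<eta>)^(m - 1) \<eta>^s is at
  most \<epsilon>^(m - 1) \<eta>^(1/k) = \<delta>^(1/k) \<epsilon>^m. The \<epsilon>^m pays for the
  number of pieces, and the free factor \<delta>^(1/k) makes equality in the bound on
  \<open>s\<close> admissible.\<close>

lemma flat_scale_estimate:
  fixes \<epsilon> \<delta> s e :: real and m k :: nat
  assumes "0 < \<epsilon>" "\<epsilon> \<le> 1" "0 < \<delta>" "\<delta> \<le> 1" "0 < k" "0 < m"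
    and "s \<ge> real m - 1 + 1 / real k" "\<delta> powr (1 / real k) \<le> e"
  shows "(\<epsilon> / (\<delta> * \<epsilon> ^ k)) ^ (m - 1) * (\<delta> * \<epsilon> ^ k) powr s \<le> e * \<epsilon> ^ m"
proof -
  let ?\<eta> = "\<delta> * \<epsilon> ^ k"
  have cancel: "(\<epsilon> / y) ^ (m - 1) * (y ^ (m - 1) * (e * \<epsilon>)) = e * (\<epsilon> ^ (m - 1) * \<epsilon>)" if "0 < y" for y
    using that by (simp add: power_divide)
  have \<eta>: "0 < ?\<eta>" "?\<eta> \<le> 1" using assms by (auto intro!: mult_le_one power_le_one)
  have "?\<eta> powr s \<le> ?\<eta> powr (real (m - 1) + 1 / real k)"
    using \<eta> assms(6,7) by (intro powr_mono') (auto simp: of_nat_diff)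
  also have "\<dots> = ?\<eta> ^ (m - 1) * (\<delta> powr (1 / real k) * (\<epsilon> ^ k) powr (1 / real k))"
    unfolding powr_add powr_realpow[OF \<eta>(1)] using assms(1,3) by (simp add: powr_mult)
  also have "(\<epsilon> ^ k) powr (1 / real k) = \<epsilon>"
    using assms(1,5) by (simp add: powr_powr flip: powr_realpow)
  also have "?\<eta> ^ (m - 1) * (\<delta> powr (1 / real k) * \<epsilon>) \<le> ?\<eta> ^ (m - 1) * (e * \<epsilon>)"
    using assms \<eta> by (intro mult_left_mono mult_right_mono) auto
  finally have "(\<epsilon> / ?\<eta>) ^ (m - 1) * ?\<eta> powr s \<le> (\<epsilon> / ?\<eta>) ^ (m - 1) * (?\<eta> ^ (m - 1) * (e * \<epsilon>))"
    using assms \<eta> by (intro mult_left_mono) auto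
  also have "\<dots> = e * (\<epsilon> ^ (m - 1) * \<epsilon>)"
    using cancel[OF \<eta>(1)] .
  also have "\<epsilon> ^ (m - 1) * \<epsilon> = \<epsilon> ^ m" using assms(6) by (metis power_minus_mult)
  finally show ?thesis .
qed

text \<open>Since \<open>nd\<close> is imposed where \<open>deriv_fst q p = 0\<close>, the nonzero
  derivative there comes from a parameter direction: at each point of the envelope the slice at
  fixed t is a regular hypersurface.\<close>

theorem hausdorff_null_envelope:
  fixes q :: "real \<times> 'b::euclidean_space \<Rightarrow> real"
  assumes U: "open U" and q: "Ck_on k q U" and k: "0 < k" and s: "s \<ge> real DIM('b) - 1 + 1 / real k"
    and nd: "\<And>p. p \<in> U \<Longrightarrow> q p = 0 \<Longrightarrow> deriv_fst q p = 0 \<Longrightarrow> \<exists>v. frechet_derivative q (at p) v \<noteq> 0"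
  shows "hausdorff_null s (snd ` {p \<in> U. q p = 0 \<and> deriv_fst q p = 0})"
proof -
  let ?m = "DIM('b)"
  have m: "0 < ?m" by simp
  have "0 < 1 / real k" using k by simp
  moreover have "real (?m - 1) = real ?m - 1" using m by (simp add: of_nat_diff)
  ultimately have s': "real (?m - 1) < s" "0 < s" using s by linarith+
  have q1: "Ck_on (Suc 0) q U" using Ck_on_mono[OF q] k by (simp add: Suc_leI del: Ck_on.simps)
  have snd: "norm (snd p - snd p') \<le> norm (p - p')" for p p' :: "real \<times> 'b"
    by (rule snd_dist_le)
  define Fl where "Fl = {p \<in> U. \<forall>j\<le>k. (deriv_fst ^^ j) q p = 0}"
  \<comment> \<open>The index j is the order of the first nonvanishing derivative in t; it starts at
    2 because orders 0 and 1 vanish on the envelope. Only the consecutive orders j - 1 and j are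
    recorded, which is what transversality needs.\<close>
  define E where "E j = {p \<in> U. q p = 0 \<and> deriv_fst q p = 0 \<and> (deriv_fst ^^ (j - 1)) q p = 0 \<and> (deriv_fst ^^ j) q p \<noteq> 0}" for j
  have split: "{p \<in> U. q p = 0 \<and> deriv_fst q p = 0} \<subseteq> Fl \<union> (\<Union>j\<in>{2..k}. E j)"
  proof
    fix p assume p: "p \<in> {p \<in> U. q p = 0 \<and> deriv_fst q p = 0}"
    show "p \<in> Fl \<union> (\<Union>j\<in>{2..k}. E j)"
    proof (cases "p \<in> Fl")
      case False
      then obtain j0 where j0: "j0 \<le> k" "(deriv_fst ^^ j0) q p \<noteq> 0" using p by (auto simp: Fl_def)
      define j where "j = (LEAST j. (deriv_fst ^^ j) q p \<noteq> 0)"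
      have j: "(deriv_fst ^^ j) q p \<noteq> 0" "j \<le> j0" "\<And>i. i < j \<Longrightarrow> (deriv_fst ^^ i) q p = 0"
        unfolding j_def using j0(2) LeastI[of "\<lambda>j. (deriv_fst ^^ j) q p \<noteq> 0" j0] Least_le[of "\<lambda>j. (deriv_fst ^^ j) q p \<noteq> 0" j0]
          not_less_Least by auto
      have "j \<noteq> 0" "j \<noteq> 1" using j(1) p by (auto intro: ccontr)
      then have "2 \<le> j" by linarith
      then have "p \<in> E j" using j p by (simp add: E_def)
      then show ?thesis using \<open>2 \<le> j\<close> j(2) j0(1) by auto
    qed simp
  qed
  have "hausdorff_null s (snd ` E j)" if j: "2 \<le> j" "j \<le> k" for j
  proof (rule hausdorff_null_locally)
    fix p assume p: "p \<in> E j"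
    then have pU: "p \<in> U" by (simp add: E_def)
    define g where "g = (deriv_fst ^^ (j - 1)) q"
    have g: "Ck_on (Suc 0) g U"
      using Ck_on_mono[OF Ck_on_deriv_fst_funpow[OF q, of "j - 1"], of "Suc 0"] j by (simp add: g_def del: Ck_on.simps)
    have dg: "deriv_fst g = (deriv_fst ^^ j) q" using j by (simp add: g_def flip: funpow.simps(2)[unfolded comp_def, THEN fun_cong])
    \<comment> \<open>The zero set of \<open>Q\<close> has codimension two: in direction
      \<open>(1, 0)\<close> the first component has derivative \<open>(deriv_fst ^^ j) q p\<close>,
      which is nonzero, and the second has derivative 0, while \<open>nd\<close> provides a
      direction for the second. So \<open>E j\<close> behaves like a set of dimension m - 1 < s. The
      bound \<open>j \<le> k\<close> keeps \<open>g\<close> of class C^1.\<close>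
    define Q where "Q x = (g x, q x)" for x
    have Q: "Ck_on (Suc 0) Q U" unfolding Q_def [abs_def] by (rule Ck_on_Pair[OF U g q1])
    have DQ: "frechet_derivative Q (at p) v = (frechet_derivative g (at p) v, frechet_derivative q (at p) v)" for v
      unfolding Q_def [abs_def]
      using fun_cong[OF frechet_derivative_at[OF has_derivative_Pair[OF
            Ck_on_has_derivative[OF g _ pU] Ck_on_has_derivative[OF q1 _ pU]]], of v] by simp
    obtain r V where r: "0 < r" "ball p r \<subseteq> U" "subspace V" "dim V = DIM(real \<times> real)"
      "\<And>x x' w. \<lbrakk>x \<in> ball p r; x' \<in> ball p r; Q x = 0; Q x' = 0; w \<in> V\<rbrakk> \<Longrightarrow>
         \<bar>w \<bullet> (x - x')\<bar> \<le> norm (x - x') / 2 * norm w"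
    proof (rule zero_set_transversal_subspace[OF U pU Q])
      fix c :: "real \<times> real"
      assume c: "\<And>v. c \<bullet> frechet_derivative Q (at p) v = 0"
      have "fst c * deriv_fst g p + snd c * deriv_fst q p = 0"
        using c[of "(1, 0)"] by (simp add: DQ inner_prod_def deriv_fst_def)
      then have c1: "fst c = 0" using p by (simp add: E_def dg)
      obtain v where "frechet_derivative q (at p) v \<noteq> 0" using nd[OF pU] p by (auto simp: E_def)
      then have "snd c = 0" using c[of v] c1 by (simp add: DQ inner_prod_def)
      with c1 show "c = 0" by (simp add: prod_eq_iff)
    qed blast
    have "hausdorff_null s (snd ` (E j \<inter> ball p r))"
    proof (rule hausdorff_null_dim_less[OF snd _ r(3) _ _ s'(1)])
      show "DIM(real \<times> 'b) \<le> dim V + (?m - 1)" using r(4) m by simp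
      show "bounded (E j \<inter> ball p r)" by (simp add: bounded_Int)
    qed (use r(5) in \<open>auto simp: E_def Q_def g_def zero_prod_def\<close>)
    then show "\<exists>N. open N \<and> p \<in> N \<and> hausdorff_null s (snd ` (E j \<inter> N))"
      using r(1) by (intro exI[of _ "ball p r"]) auto
  qed
  moreover have "hausdorff_null s (snd ` Fl)"
  proof (rule hausdorff_null_locally)
    fix p assume p: "p \<in> Fl"
    then have pU: "p \<in> U" and "q p = 0" "deriv_fst q p = 0"
      using k by (auto simp: Fl_def dest: spec[of _ 0] spec[of _ 1])
    then obtain v0 where v0: "frechet_derivative q (at p) v0 \<noteq> 0" using nd by blast
    define D where "D x = frechet_derivative q (at x)" for x
    have der: "(q has_derivative D x) (at x)" if "x \<in> U" for x
      unfolding D_def using Ck_on_has_derivative[OF q k that] .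
    have lin: "linear (D p)" using der[OF pU] by (rule has_derivative_linear)
    \<comment> \<open>The gradient of \<open>q\<close> at \<open>p\<close> in the parameter
      variables. It is the common approximate normal of the hypersurfaces at all nearby values of
      t.\<close>
    define a where "a = (\<Sum>b\<in>Basis. D p (0, b) *\<^sub>R b)"
    have a: "D p (0, v) = a \<bullet> v" for v
    proof -
      have "linear (\<lambda>v. D p (0, v))" using linear_compose[of "\<lambda>v. (0, v)", OF linearI lin] by (simp add: comp_def)
      from linear_euclidean_expand[OF this, of v] show ?thesis
        by (simp add: a_def inner_sum_left inner_commute[of v] mult.commute)
    qed
    have "a \<noteq> 0"
    proof
      assume "a = 0"
      then have "D p (t, v) = 0" for t v
        using linear_add[OF lin, of "t *\<^sub>R (1, 0)" "(0, v)"] linear_scale[OF lin, of t "(1, 0)"] a[of v] \<open>deriv_fst q p = 0\<close>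
        by (simp add: D_def deriv_fst_def)
      then show False using v0 by (cases v0) (simp add: D_def)
    qed
    then have na: "0 < norm a" by simp
    obtain r1 V where r1: "0 < r1" "ball p r1 \<subseteq> U" "subspace V" "dim V = DIM(real)"
      "\<And>x x' w. \<lbrakk>x \<in> ball p r1; x' \<in> ball p r1; q x = 0; q x' = 0; w \<in> V\<rbrakk> \<Longrightarrow>
         \<bar>w \<bullet> (x - x')\<bar> \<le> norm (x - x') / 2 * norm w"
    proof (rule zero_set_transversal_subspace[OF U pU q1])
      fix c :: real assume "\<And>v. c \<bullet> frechet_derivative q (at p) v = 0"
      then show "c = 0" using v0 by (metis inner_real_def mult_eq_0_iff)
    qed blast
    obtain r2 where r2: "0 < r2" "ball p r2 \<subseteq> U"
      "\<And>x. x \<in> ball p r2 \<Longrightarrow> (\<Sum>b\<in>Basis. norm (D x b - D p b)) < norm a / 2"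
      unfolding D_def by (rule Ck_on_deriv_close[OF U pU q1, of "norm a / 2"]) (use na in auto)
    \<comment> \<open>Below, the first coordinate of one point of \<open>ball p r\<close> is
      combined with the parameter of another. Such a pair may leave \<open>ball p r\<close> but
      stays in \<open>cball p (2 * r)\<close>, which the divisor 3 fits into both balls.\<close>
    define r where "r = min r1 r2 / 3"
    have r: "0 < r" "cball p (2 * r) \<subseteq> U" "cball p (2 * r) \<subseteq> ball p r1" "cball p (2 * r) \<subseteq> ball p r2"
      using r1(1,2) r2(1) by (auto simp: r_def)
    have box: "(t, \<pi>) \<in> cball p (2 * r)" if "\<bar>t - fst p\<bar> \<le> r" "norm (\<pi> - snd p) \<le> r" for t \<pi>
    proof -
      have "norm ((t, \<pi>) - p) \<le> norm (t - fst p) + norm (\<pi> - snd p)"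
        using norm_Pair_le[of "t - fst p" "\<pi> - snd p"] by (simp add: minus_prod_def)
      then show ?thesis using that by (simp add: dist_norm norm_minus_commute)
    qed
    have near: "\<bar>fst x - fst p\<bar> \<le> r" "norm (snd x - snd p) \<le> r" if "x \<in> ball p r" for x
      using norm_fst_snd_le(1)[of "x - p"] norm_fst_snd_le(2)[of "x - p"] that by (auto simp: dist_norm norm_minus_commute)
    let ?D = "Fl \<inter> ball p r"
    have "continuous_on (cball p (2 * r)) ((deriv_fst ^^ k) q)"
      using Ck_on_imp_continuous_on[OF Ck_on_deriv_fst_funpow[OF q order_refl]] r(2) continuous_on_subset by blast
    then have unif: "uniformly_continuous_on (cball p (2 * r)) ((deriv_fst ^^ k) q)"
      by (rule compact_uniformly_continuous) simp
    have "hausdorff_null s (snd ` ?D)"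
    proof (rule hausdorff_null_two_scales[where d = 1, OF snd _ s'(2) r1(3)])
      show "bounded ?D" by (simp add: bounded_Int)
      show "DIM(real \<times> 'b) \<le> dim V + ?m" using r1(4) by simp
      show "\<bar>w \<bullet> (x - x')\<bar> \<le> norm (x - x') / 2 * norm w" if x: "x \<in> ?D" "x' \<in> ?D" "w \<in> V" for x x' w
      proof (rule r1(5))
        show "q x = 0" "q x' = 0" using x k by (auto simp: Fl_def dest: spec[of _ 0])
        show "x \<in> ball p r1" "x' \<in> ball p r1" using x r(1,3) by (auto simp: subset_eq)
      qed (rule x(3))
      fix e :: real assume "0 < e"
      then obtain \<delta> :: real where \<delta>: "0 < \<delta>" "\<delta> < 1" "\<delta> powr (1 / real k) \<le> e"
        using small_powr[of "1 / real k" 1 e] k by auto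
      have "0 < \<delta> * norm a / 2" using \<delta> na by simp
      then obtain d where d: "0 < d" "\<And>x x'. \<lbrakk>x \<in> cball p (2 * r); x' \<in> cball p (2 * r); dist x' x < d\<rbrakk> \<Longrightarrow>
         dist ((deriv_fst ^^ k) q x') ((deriv_fst ^^ k) q x) < \<delta> * norm a / 2"
        using unif unfolding uniformly_continuous_on_def by meson
      define \<epsilon> where "\<epsilon> = min (d / 2) 1"
      have \<epsilon>: "0 < \<epsilon>" "\<epsilon> \<le> 1" "\<epsilon> < d" using d(1) by (auto simp: \<epsilon>_def)
      define \<eta> where "\<eta> = \<delta> * \<epsilon> ^ k"
      have "\<eta> \<le> 1 * \<epsilon> ^ 1"
        unfolding \<eta>_def using \<delta> \<epsilon> k by (intro mult_mono power_decreasing) auto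
      then have \<eta>: "0 < \<eta>" "\<eta> \<le> \<epsilon>" using \<delta> \<epsilon> by (auto simp: \<eta>_def)
      have "(\<epsilon> / \<eta>) ^ (?m - 1) * \<eta> powr s \<le> e * \<epsilon> ^ ?m"
        unfolding \<eta>_def using \<delta> \<epsilon> k s by (intro flat_scale_estimate) auto
      moreover have "\<exists>W. subspace W \<and> 1 \<le> dim W \<and> (\<forall>x\<in>S. \<forall>x'\<in>S. \<forall>w\<in>W.
          \<bar>w \<bullet> (snd x - snd x')\<bar> \<le> (\<eta> + norm (snd x - snd x') / 2) * norm w)"
        if S: "S \<subseteq> ?D" "\<forall>x\<in>S. \<forall>x'\<in>S. norm (x - x') \<le> \<epsilon>" for S
      proof (intro exI[of _ "span {a}"] conjI ballI)
        show "1 \<le> dim (span {a})" using \<open>a \<noteq> 0\<close> by (simp add: dim_insert)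
        fix x x' w assume x: "x \<in> S" and x': "x' \<in> S" and "w \<in> span {a}"
        then obtain c where w: "w = c *\<^sub>R a" by (auto simp: span_singleton)
        \<comment> \<open>Both points are moved to the slice t = u, with their parameters kept.
          Taylor leaves \<open>\<bar>q\<bar> \<le> \<delta> * norm a / 2 * \<epsilon> ^ k\<close> at
          each, so the two errors add up to \<open>\<eta> * norm a\<close>. Inside one slice the
          linearization of \<open>q\<close> involves only \<open>a\<close>, and no term in t spoils
          the estimate.\<close>
        define u where "u = fst x"
        have small: "\<bar>q (u, snd y)\<bar> \<le> \<delta> * norm a / 2 * \<epsilon> ^ k" "(u, snd y) \<in> cball p (2 * r)" if y: "y \<in> S" for y
        proof -
          have yD: "y \<in> Fl" "y \<in> ball p r" "x \<in> ball p r" using y x S(1) by auto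
          have ut: "\<bar>u - fst y\<bar> \<le> \<epsilon>"
            using S(2) x y norm_fst_snd_le(1)[of "x - y"] by (force simp: u_def)
          have in_box: "(\<tau>, snd y) \<in> cball p (2 * r)" if "min u (fst y) \<le> \<tau>" "\<tau> \<le> max u (fst y)" for \<tau>
            using near[OF yD(2)] near[OF yD(3)] that by (intro box) (auto simp: u_def)
          show "(u, snd y) \<in> cball p (2 * r)" by (rule in_box) auto
          show "\<bar>q (u, snd y)\<bar> \<le> \<delta> * norm a / 2 * \<epsilon> ^ k"
          proof (rule order_trans[OF flat_taylor_bound[OF q k]])
            show "(\<tau>, snd y) \<in> U" if "min u (fst y) \<le> \<tau>" "\<tau> \<le> max u (fst y)" for \<tau>
              using in_box[OF that] r(2) by blast
            show "(deriv_fst ^^ j) q (fst y, snd y) = 0" if "j < k" for j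
              using yD(1) that by (simp add: Fl_def)
            show "\<bar>(deriv_fst ^^ k) q (\<tau>, snd y)\<bar> \<le> \<delta> * norm a / 2"
              if \<tau>: "min u (fst y) \<le> \<tau>" "\<tau> \<le> max u (fst y)" for \<tau>
            proof -
              have "dist (\<tau>, snd y) y = \<bar>\<tau> - fst y\<bar>"
                by (cases y) (simp add: dist_Pair_Pair dist_real_def)
              also have "\<dots> < d" using \<tau> ut \<epsilon>(3) by linarith
              finally have "dist ((deriv_fst ^^ k) q (\<tau>, snd y)) ((deriv_fst ^^ k) q y) < \<delta> * norm a / 2"
                using yD(2) r(1) by (intro d(2) in_box[OF \<tau>]) auto
              then show ?thesis using yD(1) by (simp add: Fl_def)
            qed
            show "\<delta> * norm a / 2 * \<bar>u - fst y\<bar> ^ k \<le> \<delta> * norm a / 2 * \<epsilon> ^ k"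
              using ut \<delta>(1) by (intro mult_left_mono power_mono) auto
          qed
        qed
        have "\<bar>a \<bullet> (snd x - snd x')\<bar> \<le> (\<eta> + norm (snd x - snd x') / 2) * norm a"
        proof -
          let ?z = "(u, snd x)" and ?z' = "(u, snd x')"
          have "norm (q ?z - q ?z' - D p (?z - ?z')) \<le> norm a / 2 * norm (?z - ?z')"
            using small(2)[OF x] small(2)[OF x'] r(4) r2 subset_trans[OF r(4) r2(2)]
            by (intro linearization_bound[of "ball p r2"] der) (auto intro: less_imp_le)
          moreover have "D p (?z - ?z') = a \<bullet> (snd x - snd x')" "norm (?z - ?z') = norm (snd x - snd x')"
            using a by (auto simp: norm_Pair)
          ultimately have "\<bar>q ?z - q ?z' - a \<bullet> (snd x - snd x')\<bar> \<le> norm a / 2 * norm (snd x - snd x')"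
            by (simp only: real_norm_def)
          moreover have "\<bar>z\<bar> \<le> \<bar>y\<bar> + \<bar>y'\<bar> + b" if "\<bar>y - y' - z\<bar> \<le> b" for b y y' z :: real
            using that by linarith
          ultimately have "\<bar>a \<bullet> (snd x - snd x')\<bar> \<le> \<bar>q ?z\<bar> + \<bar>q ?z'\<bar> + norm a / 2 * norm (snd x - snd x')"
            by blast
          also have "\<dots> \<le> (\<eta> + norm (snd x - snd x') / 2) * norm a"
            using small(1)[OF x] small(1)[OF x'] by (simp add: \<eta>_def algebra_simps)
          finally show ?thesis .
        qed
        then have "\<bar>c\<bar> * \<bar>a \<bullet> (snd x - snd x')\<bar> \<le> \<bar>c\<bar> * ((\<eta> + norm (snd x - snd x') / 2) * norm a)"
          by (rule mult_left_mono) simp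
        then show "\<bar>w \<bullet> (snd x - snd x')\<bar> \<le> (\<eta> + norm (snd x - snd x') / 2) * norm w"
          by (simp add: w abs_mult mult_ac)
      qed simp
      ultimately show "\<exists>\<epsilon> \<eta>. 0 < \<eta> \<and> \<eta> \<le> \<epsilon> \<and> \<epsilon> \<le> 1 \<and> (\<epsilon> / \<eta>) ^ (?m - 1) * \<eta> powr s \<le> e * \<epsilon> ^ ?m \<and>
        (\<forall>S\<subseteq>?D. (\<forall>x\<in>S. \<forall>x'\<in>S. norm (x - x') \<le> \<epsilon>) \<longrightarrow> (\<exists>W. subspace W \<and> 1 \<le> dim W \<and>
          (\<forall>x\<in>S. \<forall>x'\<in>S. \<forall>w\<in>W. \<bar>w \<bullet> (snd x - snd x')\<bar> \<le> (\<eta> + norm (snd x - snd x') / 2) * norm w)))"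
        using \<eta> \<epsilon>(2) by blast
    qed
    then show "\<exists>N. open N \<and> p \<in> N \<and> hausdorff_null s (snd ` (Fl \<inter> N))"
      using r(1) by (intro exI[of _ "ball p r"]) auto
  qed
  moreover have "hausdorff_null s (\<Union>j\<in>{2..k}. snd ` E j)"
    using calculation(1) by (intro hausdorff_null_UN) auto
  ultimately have "hausdorff_null s (snd ` Fl \<union> (\<Union>j\<in>{2..k}. snd ` E j))"
    by (intro hausdorff_null_Un)
  then show ?thesis by (rule hausdorff_null_subset) (use split in blast)
qed

section \<open>Degenerate zeros\<close>

text \<open>If \<open>c\<close> annihilates the partial differential in x, the adjoint of the full
  differential sends \<open>c\<close> to a vector (0, w), so \<open>w\<close> acts on parameters
  alone. \<open>W\<close> consists of these \<open>w\<close>: to first order, zeros near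
  \<open>p\<close> do not spread in the directions of \<open>W\<close> after projection. The
  constant \<open>\<mu>\<close> is half the lower bound of the adjoint at \<open>p0\<close>, hence
  uniform in \<open>p\<close>.\<close>

lemma cokernel_subspace:
  fixes P :: "'a::euclidean_space \<times> 'b::euclidean_space \<Rightarrow> 'a"
  assumes "open U" "p0 \<in> U" "Ck_on (Suc 0) P U"
    and tr: "\<And>c. (\<And>v. c \<bullet> frechet_derivative P (at p0) v = 0) \<Longrightarrow> c = 0"
  obtains r \<mu> where "0 < r" "ball p0 r \<subseteq> U" "0 < \<mu>"
    "\<And>p N. \<lbrakk>p \<in> ball p0 r; subspace N; \<And>c v. c \<in> N \<Longrightarrow> c \<bullet> frechet_derivative P (at p) (v, 0) = 0\<rbrakk> \<Longrightarrow>
      \<exists>W. subspace W \<and> dim W = dim N \<and>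
        (\<forall>w\<in>W. \<exists>c. \<mu> * norm c \<le> norm w \<and> (\<forall>v. w \<bullet> snd v = c \<bullet> frechet_derivative P (at p) v))"
proof -
  define D where "D q = frechet_derivative P (at q)" for q
  have lin: "linear (D q)" if "q \<in> U" for q
    unfolding D_def using Ck_on_has_derivative[OF assms(3) _ that] by (auto intro: has_derivative_linear)
  define A where "A q = adjoint (D q)" for q
  have A: "linear (A q)" "\<And>c v. A q c \<bullet> v = c \<bullet> D q v" if "q \<in> U" for q
    unfolding A_def using adjoint_linear[OF lin[OF that]] adjoint_works[OF lin[OF that]]
    by (auto simp: inner_commute)
  have "inj (A p0)"
    unfolding linear_injective_0[OF A(1)[OF assms(2)]] using A(2)[OF assms(2)] tr
    unfolding D_def by (metis inner_zero_left)
  then obtain m where m: "0 < m" "\<And>c. m * norm c \<le> norm (A p0 c)"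
    using linear_inj_bounded_below_pos[OF A(1)[OF assms(2)]] by blast
  obtain r where r: "0 < r" "ball p0 r \<subseteq> U"
    "\<And>q. q \<in> ball p0 r \<Longrightarrow> (\<Sum>b\<in>Basis. norm (D q b - D p0 b)) < m / 2"
    unfolding D_def by (rule Ck_on_deriv_close[OF assms(1-3), of "m / 2"]) (use m(1) in auto)
  \<comment> \<open>Testing with the single vector \<open>?v = A p0 c\<close> means that only the
    differentials, not their adjoints, have to be compared: \<open>c \<bullet> D p ?v\<close>
    differs from the square of \<open>norm ?v\<close> by at most
    \<open>m / 2 * norm c * norm ?v\<close>.\<close>
  have below: "m / 2 * norm c \<le> norm (A p c)" if p: "p \<in> ball p0 r" for p c
  proof -
    have pU: "p \<in> U" using p r(2) by blast
    let ?v = "A p0 c"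
    have "norm (D p ?v - D p0 ?v) \<le> (\<Sum>b\<in>Basis. norm (D p b - D p0 b)) * norm ?v"
      using norm_linear_le_sum_Basis[OF linear_compose_sub[OF lin[OF pU] lin[OF assms(2)]]] .
    also have "\<dots> \<le> m / 2 * norm ?v" using r(3)[OF p] by (intro mult_right_mono) auto
    finally have "norm c * norm (D p ?v - D p0 ?v) \<le> norm c * (m / 2 * norm ?v)"
      by (rule mult_left_mono) simp
    then have "\<bar>c \<bullet> (D p ?v - D p0 ?v)\<bar> \<le> (m / 2 * norm c) * norm ?v"
      using Cauchy_Schwarz_ineq2[of c "D p ?v - D p0 ?v"] by (simp add: mult_ac)
    moreover have "c \<bullet> D p0 ?v = norm ?v * norm ?v"
      using A(2)[OF assms(2), of c ?v] by (simp add: dot_square_norm power2_eq_square)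
    moreover have "c \<bullet> D p ?v \<le> norm (A p c) * norm ?v"
      using Cauchy_Schwarz_ineq2[of "A p c" ?v] A(2)[OF pU, of c ?v] by simp
    moreover have "z \<le> y + b" if "\<bar>y' - z\<bar> \<le> b" "y' \<le> y" for b y y' z :: real
      using that by linarith
    ultimately have "norm ?v * norm ?v \<le> norm (A p c) * norm ?v + (m / 2 * norm c) * norm ?v"
      unfolding inner_diff_right by metis
    then have "norm ?v * norm ?v \<le> (norm (A p c) + m / 2 * norm c) * norm ?v"
      by (simp only: distrib_right)
    then have "norm ?v \<le> norm (A p c) + m / 2 * norm c"
      using m by (cases "?v = 0") auto
    then show ?thesis using m(2)[of c] by linarith
  qed
  show ?thesis
  proof (rule that[OF r(1,2), of "m / 2"])
    show "0 < m / 2" using m by simp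
    fix p N assume p: "p \<in> ball p0 r" and N: "subspace N"
      and coker: "\<And>c v. c \<in> N \<Longrightarrow> c \<bullet> frechet_derivative P (at p) (v, 0) = 0"
    have pU: "p \<in> U" using p r(2) by blast
    define B where "B c = snd (A p c)" for c
    have B: "linear B"
      using linear_compose[OF A(1)[OF pU] linear_snd] by (simp add: B_def [abs_def] comp_def)
    have A0: "A p c = (0, B c)" if "c \<in> N" for c
    proof -
      have "fst (A p c) \<bullet> v = 0" for v
        using A(2)[OF pU, of c "(v, 0)"] coker[OF that, of v] by (simp add: D_def inner_prod_def)
      then have "fst (A p c) = 0" by (metis inner_eq_zero_iff)
      then show ?thesis by (simp add: B_def prod_eq_iff)
    qed
    have Bc: "m / 2 * norm c \<le> norm (B c)" if "c \<in> N" for c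
      using below[OF p, of c] A0[OF that] by (simp add: norm_Pair)
    have "inj_on B N"
      unfolding linear_inj_on_iff_eq_0[OF B N] using Bc m by (auto simp: mult_le_0_iff dest!: Bc)
    then have "dim (B ` N) = dim N"
      using N by (intro dim_image_eq[OF B]) (simp add: span_eq_iff[THEN iffD2])
    moreover have "w \<bullet> snd v = c \<bullet> D p v" if "c \<in> N" "w = B c" for w c v
      using A(2)[OF pU, of c v] A0[OF that(1)] that(2) by (simp add: inner_prod_def)
    ultimately show "\<exists>W. subspace W \<and> dim W = dim N \<and> (\<forall>w\<in>W. \<exists>c. m / 2 * norm c \<le> norm w \<and>
        (\<forall>v. w \<bullet> snd v = c \<bullet> frechet_derivative P (at p) v))"
      using linear_subspace_image[OF B N] Bc unfolding D_def
      by (intro exI[of _ "B ` N"] conjI) blast+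
  qed
qed

text \<open>On a piece of diameter \<epsilon> with base point y, the differential at y is at most
  \<open>\<tau> * \<epsilon>\<close> on differences of zeros, and its pairing with \<open>c\<close>
  equals \<open>w \<bullet> (snd x - snd x')\<close>. Hence
  \<open>\<tau> * \<epsilon> \<le> \<mu> * \<eta>\<close> gives flatness \<eta>. The modulus \<tau>
  is left to \<open>scales\<close> because it is o(1) in class C^1 but O(\<epsilon>) in class
  C^2.\<close>

lemma hausdorff_null_corank:
  fixes P :: "'a::euclidean_space \<times> 'b::euclidean_space \<Rightarrow> 'a"
  assumes U: "open U" and P: "Ck_on (Suc 0) P U" and s: "0 < s"
    and D: "\<And>p. p \<in> D \<Longrightarrow> p \<in> U" "\<And>p. p \<in> D \<Longrightarrow> P p = 0"
    and tr: "\<And>p c. p \<in> D \<Longrightarrow> (\<And>v. c \<bullet> frechet_derivative P (at p) v = 0) \<Longrightarrow> c = 0"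
    and coker: "\<And>p. p \<in> D \<Longrightarrow> \<exists>N. subspace N \<and> d \<le> dim N \<and>
       (\<forall>c\<in>N. \<forall>v. c \<bullet> frechet_derivative P (at p) (v, 0) = 0)"
    and scales: "\<And>p r \<mu>. \<lbrakk>p \<in> D; 0 < r; 0 < \<mu>; ball p r \<subseteq> U; d \<le> DIM('b)\<rbrakk> \<Longrightarrow> \<exists>\<rho>. 0 < \<rho> \<and> \<rho> \<le> r \<and>
       (\<forall>e>0. \<exists>\<epsilon> \<eta> \<tau>. 0 < \<eta> \<and> \<eta> \<le> \<epsilon> \<and> \<epsilon> \<le> 1 \<and> (\<epsilon> / \<eta>) ^ (DIM('b) - d) * \<eta> powr s \<le> e * \<epsilon> ^ DIM('b) \<and>
         0 \<le> \<tau> \<and> \<tau> * \<epsilon> \<le> \<mu> * \<eta> \<and> (\<forall>p0\<in>ball p \<rho>. \<forall>q\<in>ball p \<rho>. norm (q - p0) \<le> \<epsilon> \<longrightarrow>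
           (\<Sum>b\<in>Basis. norm (frechet_derivative P (at q) b - frechet_derivative P (at p0) b)) \<le> \<tau>))"
  shows "hausdorff_null s (snd ` D)"
proof (rule hausdorff_null_locally)
  fix p assume p: "p \<in> D"
  have pU: "p \<in> U" using D(1)[OF p] .
  obtain r1 V where r1: "0 < r1" "ball p r1 \<subseteq> U" "subspace V" "dim V = DIM('a)"
    "\<And>x x' w. \<lbrakk>x \<in> ball p r1; x' \<in> ball p r1; P x = 0; P x' = 0; w \<in> V\<rbrakk> \<Longrightarrow>
       \<bar>w \<bullet> (x - x')\<bar> \<le> norm (x - x') / 2 * norm w"
    using zero_set_transversal_subspace[OF U pU P tr[OF p]] by metis
  obtain r2 \<mu> where r2: "0 < r2" "ball p r2 \<subseteq> U" "0 < \<mu>"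
    "\<And>x N. \<lbrakk>x \<in> ball p r2; subspace N; \<And>c v. c \<in> N \<Longrightarrow> c \<bullet> frechet_derivative P (at x) (v, 0) = 0\<rbrakk> \<Longrightarrow>
      \<exists>W. subspace W \<and> dim W = dim N \<and>
        (\<forall>w\<in>W. \<exists>c. \<mu> * norm c \<le> norm w \<and> (\<forall>v. w \<bullet> snd v = c \<bullet> frechet_derivative P (at x) v))"
    using cokernel_subspace[OF U pU P tr[OF p]] by metis
  have W: "\<exists>W. subspace W \<and> d \<le> dim W \<and>
        (\<forall>w\<in>W. \<exists>c. \<mu> * norm c \<le> norm w \<and> (\<forall>v. w \<bullet> snd v = c \<bullet> frechet_derivative P (at x) v))"
    if x: "x \<in> D" "x \<in> ball p r2" for x
  proof -
    obtain N where N: "subspace N" "d \<le> dim N" "\<And>c v. c \<in> N \<Longrightarrow> c \<bullet> frechet_derivative P (at x) (v, 0) = 0"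
      using coker[OF x(1)] by blast
    show ?thesis using r2(4)[OF x(2) N(1,3)] N(2) by auto
  qed
  \<comment> \<open>The existence of a point of \<open>D\<close> forces
    \<open>d \<le> DIM('b)\<close>. This is handed on to \<open>scales\<close>, where
    \<open>DIM('b) - d\<close> is a truncated subtraction.\<close>
  obtain W0 :: "'b set" where "d \<le> dim W0" using W[OF p] r2(1) by auto
  then have d: "d \<le> DIM('b)" using dim_subset_UNIV[of W0] by simp
  obtain \<rho> where \<rho>: "0 < \<rho>" "\<rho> \<le> min r1 r2" and sc: "\<And>e. 0 < e \<Longrightarrow> \<exists>\<epsilon> \<eta> \<tau>. 0 < \<eta> \<and> \<eta> \<le> \<epsilon> \<and> \<epsilon> \<le> 1 \<and>
         (\<epsilon> / \<eta>) ^ (DIM('b) - d) * \<eta> powr s \<le> e * \<epsilon> ^ DIM('b) \<and>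
         0 \<le> \<tau> \<and> \<tau> * \<epsilon> \<le> \<mu> * \<eta> \<and> (\<forall>p0\<in>ball p \<rho>. \<forall>q\<in>ball p \<rho>. norm (q - p0) \<le> \<epsilon> \<longrightarrow>
           (\<Sum>b\<in>Basis. norm (frechet_derivative P (at q) b - frechet_derivative P (at p0) b)) \<le> \<tau>)"
    using scales[OF p, of "min r1 r2" \<mu>] r1(1,2) r2(1,3) d by (auto simp: subset_eq)
  let ?D = "D \<inter> ball p \<rho>"
  have "hausdorff_null s (snd ` ?D)"
  proof (rule hausdorff_null_two_scales[where d = d, OF snd_dist_le _ s r1(3)])
    show "bounded ?D" by (simp add: bounded_Int)
    show "DIM('a \<times> 'b) \<le> dim V + DIM('b)" using r1(4) by simp
    show "\<bar>w \<bullet> (x - x')\<bar> \<le> norm (x - x') / 2 * norm w" if "x \<in> ?D" "x' \<in> ?D" "w \<in> V" for x x' w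
      using that \<rho>(2) D(2) by (intro r1(5)) auto
    fix e :: real assume "0 < e"
    from sc[OF this] obtain \<epsilon> \<eta> \<tau> where \<epsilon>: "0 < \<eta>" "\<eta> \<le> \<epsilon>" "\<epsilon> \<le> 1"
      "(\<epsilon> / \<eta>) ^ (DIM('b) - d) * \<eta> powr s \<le> e * \<epsilon> ^ DIM('b)" "0 \<le> \<tau>" "\<tau> * \<epsilon> \<le> \<mu> * \<eta>"
      and \<tau>: "\<And>p0 q. \<lbrakk>p0 \<in> ball p \<rho>; q \<in> ball p \<rho>; norm (q - p0) \<le> \<epsilon>\<rbrakk> \<Longrightarrow>
           (\<Sum>b\<in>Basis. norm (frechet_derivative P (at q) b - frechet_derivative P (at p0) b)) \<le> \<tau>"
      by blast
    have "\<exists>W. subspace W \<and> d \<le> dim W \<and> (\<forall>x\<in>S. \<forall>x'\<in>S. \<forall>w\<in>W.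
        \<bar>w \<bullet> (snd x - snd x')\<bar> \<le> (\<eta> + norm (snd x - snd x') / 2) * norm w)"
      if S: "S \<subseteq> ?D" "\<forall>x\<in>S. \<forall>x'\<in>S. norm (x - x') \<le> \<epsilon>" for S
    proof (cases "S = {}")
      case True
      then show ?thesis using d by (intro exI[of _ UNIV]) auto
    next
      case False
      then obtain y where y: "y \<in> S" by blast
      then have yD: "y \<in> D" "y \<in> ball p \<rho>" using S by auto
      then obtain W where W: "subspace W" "d \<le> dim W"
        "\<And>w. w \<in> W \<Longrightarrow> \<exists>c. \<mu> * norm c \<le> norm w \<and> (\<forall>v. w \<bullet> snd v = c \<bullet> frechet_derivative P (at y) v)"
        using W[of y] \<rho>(2) by auto
      have "\<bar>w \<bullet> (snd x - snd x')\<bar> \<le> (\<eta> + norm (snd x - snd x') / 2) * norm w"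
        if x: "x \<in> S" "x' \<in> S" and w: "w \<in> W" for x x' w
      proof -
        obtain c where c: "\<mu> * norm c \<le> norm w" "\<And>v. w \<bullet> snd v = c \<bullet> frechet_derivative P (at y) v"
          using W(3)[OF w] by blast
        have "norm (P x - P x' - frechet_derivative P (at y) (x - x')) \<le> \<tau> * norm (x - x')"
        proof (rule linearization_bound[of "ball p \<rho> \<inter> cball y \<epsilon>"])
          show "convex (ball p \<rho> \<inter> cball y \<epsilon>)" by (intro convex_Int convex_ball convex_cball)
          show "(P has_derivative frechet_derivative P (at q)) (at q)" if "q \<in> ball p \<rho> \<inter> cball y \<epsilon>" for q
            using that \<rho>(2) r1(2) by (intro Ck_on_has_derivative[OF P]) (auto simp: subset_eq)
          show "(\<Sum>b\<in>Basis. norm (frechet_derivative P (at q) b - frechet_derivative P (at y) b)) \<le> \<tau>"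
            if "q \<in> ball p \<rho> \<inter> cball y \<epsilon>" for q
            using that yD(2) by (intro \<tau>) (auto simp: dist_norm norm_minus_commute)
        qed (use S x y yD \<epsilon> in \<open>auto simp: dist_norm\<close>)
        then have "norm (frechet_derivative P (at y) (x - x')) \<le> \<tau> * norm (x - x')"
          using D(2) S(1) x by (auto simp: subset_eq)
        also have "\<dots> \<le> \<tau> * \<epsilon>" using S(2) x \<epsilon>(5) by (intro mult_left_mono) auto
        also note \<epsilon>(6)
        finally have "norm c * norm (frechet_derivative P (at y) (x - x')) \<le> norm c * (\<mu> * \<eta>)"
          by (rule mult_left_mono) simp
        moreover have "\<bar>w \<bullet> (snd x - snd x')\<bar> \<le> norm c * norm (frechet_derivative P (at y) (x - x'))"
          using c(2)[of "x - x'"] Cauchy_Schwarz_ineq2[of c "frechet_derivative P (at y) (x - x')"] by simp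
        moreover have "norm c * (\<mu> * \<eta>) \<le> norm w * \<eta>"
          using mult_right_mono[OF c(1), of \<eta>] \<epsilon>(1) by (simp add: mult_ac)
        ultimately have "\<bar>w \<bullet> (snd x - snd x')\<bar> \<le> \<eta> * norm w" by (simp add: mult.commute)
        also have "\<dots> \<le> (\<eta> + norm (snd x - snd x') / 2) * norm w"
          by (rule mult_right_mono) auto
        finally show ?thesis .
      qed
      then show ?thesis using W(1,2) by blast
    qed
    with \<epsilon> show "\<exists>\<epsilon> \<eta>. 0 < \<eta> \<and> \<eta> \<le> \<epsilon> \<and> \<epsilon> \<le> 1 \<and> (\<epsilon> / \<eta>) ^ (DIM('b) - d) * \<eta> powr s \<le> e * \<epsilon> ^ DIM('b) \<and>
      (\<forall>S\<subseteq>?D. (\<forall>x\<in>S. \<forall>x'\<in>S. norm (x - x') \<le> \<epsilon>) \<longrightarrow> (\<exists>W. subspace W \<and> d \<le> dim W \<and>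
        (\<forall>x\<in>S. \<forall>x'\<in>S. \<forall>w\<in>W. \<bar>w \<bullet> (snd x - snd x')\<bar> \<le> (\<eta> + norm (snd x - snd x') / 2) * norm w)))"
      by blast
  qed
  then show "\<exists>N. open N \<and> p \<in> N \<and> hausdorff_null s (snd ` (D \<inter> N))"
    using \<rho>(1) by (intro exI[of _ "ball p \<rho>"]) auto
qed

section \<open>Lipschitz and uniform bounds for derivatives\<close>

lemma Ck_on_locally_Lipschitz:
  fixes f :: "'c::euclidean_space \<Rightarrow> 'b::real_normed_vector"
  assumes "open U" "p \<in> U" "Ck_on (Suc 0) f U"
  obtains r L where "0 < r" "0 \<le> L"
    "\<And>x y. x \<in> ball p r \<Longrightarrow> y \<in> ball p r \<Longrightarrow> norm (f x - f y) \<le> L * norm (x - y)"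
proof -
  obtain r where r: "0 < r" "ball p r \<subseteq> U"
    "\<And>q. q \<in> ball p r \<Longrightarrow> (\<Sum>b\<in>Basis. norm (frechet_derivative f (at q) b - frechet_derivative f (at p) b)) < 1"
    using Ck_on_deriv_close[OF assms, of 1] by auto
  let ?D = "frechet_derivative f (at p)"
  have lin: "linear ?D"
    using Ck_on_has_derivative[OF assms(3) _ assms(2)] by (auto intro: has_derivative_linear)
  let ?L = "(\<Sum>b\<in>Basis. norm (?D b)) + 1"
  have "norm (f x - f y) \<le> ?L * norm (x - y)" if "x \<in> ball p r" "y \<in> ball p r" for x y
  proof -
    have "norm (f x - f y - ?D (x - y)) \<le> 1 * norm (x - y)"
      using r that by (intro linearization_bound[of "ball p r"] Ck_on_has_derivative[OF assms(3)])
        (auto intro: less_imp_le)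
    moreover have "norm (f x - f y) \<le> norm (f x - f y - ?D (x - y)) + norm (?D (x - y))"
      by (metis diff_add_cancel norm_triangle_ineq)
    ultimately show ?thesis
      using norm_linear_le_sum_Basis[OF lin, of "x - y"] by (simp add: distrib_right)
  qed
  then show ?thesis using that[OF r(1), of ?L] by (simp add: sum_nonneg)
qed

lemma Ck_on_deriv_locally_Lipschitz:
  fixes P :: "'c::euclidean_space \<Rightarrow> 'b::real_normed_vector"
  assumes "open U" "p \<in> U" "Ck_on (Suc (Suc 0)) P U"
  obtains r L where "0 < r" "0 \<le> L"
    "\<And>x y. x \<in> ball p r \<Longrightarrow> y \<in> ball p r \<Longrightarrow>
      (\<Sum>b\<in>Basis. norm (frechet_derivative P (at x) b - frechet_derivative P (at y) b)) \<le> L * norm (x - y)"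
proof -
  have "\<exists>r L. 0 < r \<and> 0 \<le> L \<and> (\<forall>x\<in>ball p r. \<forall>y\<in>ball p r.
      norm (frechet_derivative P (at x) b - frechet_derivative P (at y) b) \<le> L * norm (x - y))" for b
  proof -
    have "Ck_on (Suc 0) (\<lambda>x. frechet_derivative P (at x) b) U"
      using assms(3) by (subst (asm) Ck_on.simps(2)) blast
    from Ck_on_locally_Lipschitz[OF assms(1,2) this] show ?thesis by metis
  qed
  then obtain r L where rL: "\<And>b. 0 < r b" "\<And>b. 0 \<le> L b" "\<And>b x y. x \<in> ball p (r b) \<Longrightarrow> y \<in> ball p (r b) \<Longrightarrow>
      norm (frechet_derivative P (at x) b - frechet_derivative P (at y) b) \<le> L b * norm (x - y)"
    by metis
  let ?r = "Min (r ` Basis)"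
  show ?thesis
  proof (rule that[of ?r "\<Sum>b\<in>Basis. L b"])
    show "0 < ?r" using rL(1) by simp
    show "0 \<le> (\<Sum>b\<in>Basis. L b)" using rL(2) by (intro sum_nonneg) auto
    fix x y assume xy: "x \<in> ball p ?r" "y \<in> ball p ?r"
    have "?r \<le> r b" if "b \<in> Basis" for b using that by (intro Min_le) auto
    then show "(\<Sum>b\<in>Basis. norm (frechet_derivative P (at x) b - frechet_derivative P (at y) b))
        \<le> (\<Sum>b\<in>Basis. L b) * norm (x - y)"
      unfolding sum_distrib_right using xy by (intro sum_mono rL(3)) force+
  qed
qed

lemma Ck_on_deriv_uniform:
  fixes P :: "'c::euclidean_space \<Rightarrow> 'b::real_normed_vector"
  assumes "compact K" "K \<subseteq> U" "Ck_on (Suc 0) P U" "0 < \<tau>"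
  obtains d where "0 < d" "\<And>x y. x \<in> K \<Longrightarrow> y \<in> K \<Longrightarrow> norm (x - y) < d \<Longrightarrow>
      (\<Sum>b\<in>Basis. norm (frechet_derivative P (at x) b - frechet_derivative P (at y) b)) \<le> \<tau>"
proof -
  define g where "g z = (\<Sum>b\<in>Basis. norm (frechet_derivative P (at (fst z)) b - frechet_derivative P (at (snd z)) b))" for z
  have c: "continuous_on K (\<lambda>x. frechet_derivative P (at x) b)" for b
  proof (rule continuous_on_subset[OF _ assms(2)])
    show "continuous_on U (\<lambda>x. frechet_derivative P (at x) b)" using assms(3) by simp
  qed
  have "continuous_on (K \<times> K) g"
    unfolding g_def by (intro continuous_intros continuous_on_compose2[OF c]) auto
  then have "uniformly_continuous_on (K \<times> K) g"
    using assms(1) by (intro compact_uniformly_continuous compact_Times)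
  then obtain d where d: "0 < d" "\<And>z z'. z \<in> K \<times> K \<Longrightarrow> z' \<in> K \<times> K \<Longrightarrow> dist z' z < d \<Longrightarrow> dist (g z') (g z) < \<tau>"
    using assms(4) unfolding uniformly_continuous_on_def by meson
  show ?thesis
  proof (rule that[OF d(1)])
    fix x y assume "x \<in> K" "y \<in> K" "norm (x - y) < d"
    then have "dist (g (x, y)) (g (y, y)) < \<tau>" by (intro d(2)) (auto simp: dist_Pair_Pair dist_norm)
    then show "(\<Sum>b\<in>Basis. norm (frechet_derivative P (at x) b - frechet_derivative P (at y) b)) \<le> \<tau>"
      by (simp add: g_def dist_real_def)
  qed
qed

section \<open>Singular operators: corank one against corank two\<close>

lemma surj_if_no_cokernel:
  fixes L :: "'a::euclidean_space \<Rightarrow> 'b::euclidean_space"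
  assumes "linear L" "\<And>c. (\<And>v. c \<bullet> L v = 0) \<Longrightarrow> c = 0"
  shows "surj L"
proof -
  have "inj (adjoint L)"
    unfolding linear_injective_0[OF adjoint_linear[OF assms(1)]]
    using adjoint_works[OF assms(1)] assms(2) by (metis inner_zero_right inner_commute)
  then show ?thesis using assms(1) by simp
qed

text \<open>Take \<open>u\<close> in the kernel of \<open>M\<close> and border with
  \<open>c0\<close> itself. By \<open>no\<close> the bordered operator is still singular, so some
  nonzero \<open>c\<close> annihilates it. Evaluation at \<open>u\<close> shows that
  \<open>c\<close> is orthogonal to \<open>c0\<close>; then the border drops out and
  \<open>c\<close> annihilates \<open>M\<close> as well.\<close>

lemma two_dim_cokernel:
  fixes M :: "'a::euclidean_space \<Rightarrow> 'a"
  assumes M: "linear M" and c0: "c0 \<noteq> 0" "\<And>v. c0 \<bullet> M v = 0"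
    and no: "\<And>u c. \<not> inj (\<lambda>v. M v + (u \<bullet> v) *\<^sub>R c)"
  shows "2 \<le> dim {c. \<forall>v. c \<bullet> M v = 0}"
proof -
  let ?N = "{c. \<forall>v. c \<bullet> M v = 0}"
  have "\<not> surj M"
  proof
    assume "surj M"
    then obtain v where "M v = c0" by (metis surjD)
    then show False using c0(1) c0(2)[of v] by simp
  qed
  then have "\<not> inj M" using linear_injective_imp_surjective[OF M] by blast
  then obtain u where u: "M u = 0" "u \<noteq> 0" unfolding linear_injective_0[OF M] by blast
  define M' where "M' v = M v + (u \<bullet> v) *\<^sub>R c0" for v
  have M': "linear M'"
    unfolding M'_def [abs_def] using M
    by (intro linear_compose_add) (auto intro!: linearI simp: inner_add_right scaleR_add_left)
  have "\<not> surj M'"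
    using linear_surjective_imp_injective[OF M'] no[of u c0] by (auto simp: M'_def [abs_def])
  then obtain c where c: "\<And>v. c \<bullet> M' v = 0" "c \<noteq> 0" using surj_if_no_cokernel[OF M'] by blast
  have "c \<bullet> c0 = 0" using c(1)[of u] u by (simp add: M'_def)
  then have cN: "c \<in> ?N" using c(1) by (simp add: M'_def inner_add_right)
  have "c \<notin> span {c0}"
    using \<open>c \<bullet> c0 = 0\<close> c(2) c0(1) by (auto simp: span_singleton)
  then have "independent {c, c0}" using c0(1) by (intro independent_insertI independent_empty) auto
  moreover have "{c, c0} \<subseteq> ?N" using cN c0(2) by blast
  moreover have "c \<noteq> c0" using \<open>c \<notin> span {c0}\<close> span_base[of c0 "{c0}"] by auto
  then have "card {c, c0} = 2" by simp
  ultimately show ?thesis using independent_card_le_dim[of "{c, c0}" ?N] by simp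
qed

text \<open>With \<open>\<eta> = K * \<epsilon>\<^sup>2\<close> the left-hand side is of order
  \<epsilon>^(2 s - m + 2), which beats \<epsilon>^m by the positive power 2 (s - (m - 1)). The
  exponent \<open>a\<close> collects the powers of \<open>K\<close>, to be absorbed in the choice of
  \<epsilon>.\<close>

lemma scale_estimate_square:
  fixes s e K :: real and m :: nat
  assumes "real m - 1 < s" "2 \<le> m" "0 < e" "1 \<le> K"
  obtains \<epsilon> where "0 < \<epsilon>" "K * \<epsilon> \<le> 1" "(\<epsilon> / (K * \<epsilon>\<^sup>2)) ^ (m - 2) * (K * \<epsilon>\<^sup>2) powr s \<le> e * \<epsilon> ^ m"
proof -
  define a where "a = s + 2 - real m"
  obtain \<epsilon> where \<epsilon>: "0 < \<epsilon>" "\<epsilon> < 1 / K" "\<epsilon> powr (2 * (s - (real m - 1))) \<le> e / K powr a"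
    using small_powr[of "2 * (s - (real m - 1))" "1 / K" "e / K powr a"] assms by auto
  have K\<epsilon>: "0 < K * \<epsilon>" using \<epsilon>(1) assms(4) by simp
  have "\<epsilon> / (K * \<epsilon>\<^sup>2) = inverse (K * \<epsilon>)"
    using \<epsilon>(1) assms(4) by (simp add: power2_eq_square field_simps)
  then have "(\<epsilon> / (K * \<epsilon>\<^sup>2)) ^ (m - 2) = inverse ((K * \<epsilon>) powr real (m - 2))"
    by (simp only: power_inverse powr_realpow[OF K\<epsilon>])
  also have "\<dots> = (K * \<epsilon>) powr (- (real m - 2))"
    using assms(2) by (simp add: of_nat_diff flip: powr_minus)
  finally have "(\<epsilon> / (K * \<epsilon>\<^sup>2)) ^ (m - 2) = (K * \<epsilon>) powr (- (real m - 2))" .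
  moreover have "(K * \<epsilon>\<^sup>2) powr s = K powr s * \<epsilon> powr (2 * s)"
    using \<epsilon>(1) assms(4) by (simp add: powr_mult powr_powr flip: powr_numeral)
  ultimately have "(\<epsilon> / (K * \<epsilon>\<^sup>2)) ^ (m - 2) * (K * \<epsilon>\<^sup>2) powr s
      = (K powr (- (real m - 2)) * K powr s) * (\<epsilon> powr (- (real m - 2)) * \<epsilon> powr (2 * s))"
    using \<epsilon>(1) assms(4) by (simp add: powr_mult)
  also have "\<dots> = K powr a * (\<epsilon> powr (2 * (s - (real m - 1))) * \<epsilon> powr real m)"
    by (simp add: a_def algebra_simps flip: powr_add)
  also have "\<dots> \<le> K powr a * (e / K powr a * \<epsilon> powr real m)"
    using \<epsilon>(3) by (intro mult_left_mono mult_right_mono) auto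
  also have "\<dots> = e * \<epsilon> ^ m" using \<epsilon>(1) assms(4) by (simp add: powr_realpow)
  finally show ?thesis using that[of \<epsilon>] \<epsilon>(1,2) assms(4) by (simp add: field_simps)
qed

text \<open>The bordered map \<open>(x, \<pi>) \<mapsto> (P (x, \<pi>) + (u \<bullet> x) c, \<pi>)\<close> is a local diffeomorphism. Its inverse sends
  \<open>(t c, \<pi>)\<close> to a point \<open>(x, \<pi>)\<close> with \<open>P (x, \<pi>) = (t - u \<bullet> x) c\<close>, and \<open>q (t, \<pi>) = t - u \<bullet> x\<close> is the
  reduced equation.\<close>

lemma hausdorff_null_corank_one:
  fixes P :: "'a::euclidean_space \<times> 'b::euclidean_space \<Rightarrow> 'a"
  assumes U: "open U" and P: "Ck_on k P U" and k: "0 < k" and s: "s \<ge> real DIM('b) - 1 + 1 / real k"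
    and tr: "\<And>p c. p \<in> U \<Longrightarrow> P p = 0 \<Longrightarrow> (\<And>v. c \<bullet> frechet_derivative P (at p) v = 0) \<Longrightarrow> c = 0"
    and p0: "p0 \<in> U" "inj (\<lambda>v. frechet_derivative P (at p0) (v, 0) + (u \<bullet> v) *\<^sub>R c)"
  shows "\<exists>N. open N \<and> p0 \<in> N \<and> hausdorff_null s (snd ` ({p \<in> U. P p = 0 \<and>
    (\<exists>c. c \<noteq> 0 \<and> (\<forall>v. c \<bullet> frechet_derivative P (at p) (v, 0) = 0))} \<inter> N))"
proof -
  define D where "D p = frechet_derivative P (at p)" for p
  have der: "(P has_derivative D p) (at p)" if "p \<in> U" for p
    unfolding D_def using Ck_on_has_derivative[OF P k that] .
  have lin: "linear (D p)" if "p \<in> U" for p using der[OF that] by (rule has_derivative_linear)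
  define T where "T p = (P p + (u \<bullet> fst p) *\<^sub>R c, snd p)" for p
  have "Ck_on k (\<lambda>p. u \<bullet> fst p) U"
    by (intro Ck_on_bounded_linear[OF U] bounded_linear_compose[OF bounded_linear_inner_right bounded_linear_fst])
  then have T: "Ck_on k T U"
    unfolding T_def [abs_def]
    by (intro Ck_on_Pair Ck_on_add Ck_on_scaleR Ck_on_const U P Ck_on_bounded_linear[OF U bounded_linear_snd])
  have dT: "frechet_derivative T (at p) v = (D p v + (u \<bullet> fst v) *\<^sub>R c, snd v)" if p: "p \<in> U" for p v
  proof -
    have "(T has_derivative (\<lambda>v. (D p v + (u \<bullet> fst v) *\<^sub>R c, snd v))) (at p)"
      unfolding T_def [abs_def] by (auto intro!: derivative_eq_intros der[OF p])
    from fun_cong[OF frechet_derivative_at[OF this]] show ?thesis by simp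
  qed
  have "inj (frechet_derivative T (at p0))"
  proof -
    have l: "linear (frechet_derivative T (at p0))"
      using Ck_on_has_derivative[OF T k p0(1)] by (rule has_derivative_linear)
    show ?thesis
      unfolding linear_injective_0[OF l]
    proof (intro allI impI)
      fix v assume "frechet_derivative T (at p0) v = 0"
      then have v: "D p0 (fst v, 0) + (u \<bullet> fst v) *\<^sub>R c = 0" "snd v = 0"
        unfolding dT[OF p0(1)] by (cases v; simp add: zero_prod_def)+
      have "D p0 (0, 0) + (u \<bullet> 0) *\<^sub>R c = 0"
        using linear_0[OF lin[OF p0(1)]] by (simp add: zero_prod_def)
      with v(1) have "fst v = 0" using injD[OF p0(2)] unfolding D_def by metis
      then show "v = 0" using v(2) by (simp add: prod_eq_iff)
    qed
  qed
  then obtain U' V G where inv: "open U'" "p0 \<in> U'" "U' \<subseteq> U" "open V" "homeomorphism U' V T G" "Ck_on k G V"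
    "\<And>y. y \<in> V \<Longrightarrow> bij (frechet_derivative T (at (G y)))"
    "\<And>y. y \<in> V \<Longrightarrow> (G has_derivative inv (frechet_derivative T (at (G y)))) (at y)"
    using Ck_on_inverse_function[OF U p0(1) T k] by metis
  define j where "j y = (fst y *\<^sub>R c, snd y)" for y :: "real \<times> 'b"
  have j: "bounded_linear j"
    unfolding j_def [abs_def]
    by (intro bounded_linear_Pair bounded_linear_snd bounded_linear_compose[OF bounded_linear_scaleR_left bounded_linear_fst])
  define S where "S = j -` V"
  have S: "open S"
    unfolding S_def using inv(4) linear_continuous_on[OF j] by (intro open_vimage)
  define q where "q y = fst y - u \<bullet> fst (G (j y))" for y
  have "Ck_on k (\<lambda>y. G (j y)) S"
    by (rule Ck_on_precompose_linear[OF S j inv(6)]) (auto simp: S_def)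
  then have "Ck_on k (\<lambda>y. u \<bullet> fst (G (j y))) S"
    by (rule Ck_on_linear_comp[OF S bounded_linear_compose[OF bounded_linear_inner_right bounded_linear_fst]])
  then have q: "Ck_on k q S"
    unfolding q_def [abs_def] by (rule Ck_on_diff[OF S Ck_on_bounded_linear[OF S bounded_linear_fst]])
  have GU: "G (j y) \<in> U'" "G (j y) \<in> U" "T (G (j y)) = j y" if "y \<in> S" for y
    using that inv(3,5) unfolding S_def homeomorphism_def by auto
  have PG: "P (G (j y)) = q y *\<^sub>R c" if "y \<in> S" for y
    using GU(3)[OF that] by (simp add: T_def j_def q_def algebra_simps)
  \<comment> \<open>Such a \<open>v\<close> is mapped by the differential of \<open>T\<close> to
    \<open>j (\<gamma> + u \<bullet> fst v, snd v)\<close>, so the inverse recovers \<open>v\<close>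
    and \<gamma> is left over. The formula is used twice: \<gamma> = 1 gives the nondegeneracy of
    \<open>q\<close>, and \<gamma> = 0 with \<open>v\<close> in the kernel of the partial
    differential gives the vanishing of \<open>deriv_fst q\<close>.\<close>
  have dq: "frechet_derivative q (at y) (\<gamma> + u \<bullet> fst v, snd v) = \<gamma>"
    if y: "y \<in> S" and v: "D (G (j y)) v = \<gamma> *\<^sub>R c" for y v \<gamma>
  proof -
    have yV: "j y \<in> V" using y by (simp add: S_def)
    let ?I = "inv (frechet_derivative T (at (G (j y))))"
    have "((\<lambda>y. G (j y)) has_derivative (\<lambda>h. ?I (j h))) (at y)"
      by (rule has_derivative_compose[OF bounded_linear_imp_has_derivative[OF j] inv(8)[OF yV]])
    then have "((\<lambda>y. u \<bullet> fst (G (j y))) has_derivative (\<lambda>h. u \<bullet> fst (?I (j h)))) (at y)"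
      by (rule bounded_linear.has_derivative[OF bounded_linear_compose[OF bounded_linear_inner_right bounded_linear_fst]])
    then have "(q has_derivative (\<lambda>h. fst h - u \<bullet> fst (?I (j h)))) (at y)"
      unfolding q_def [abs_def]
      by (rule has_derivative_diff[OF bounded_linear_imp_has_derivative[OF bounded_linear_fst]])
    from fun_cong[OF frechet_derivative_at[OF this], of "(\<gamma> + u \<bullet> fst v, snd v)"]
    have "frechet_derivative q (at y) (\<gamma> + u \<bullet> fst v, snd v) =
        \<gamma> + u \<bullet> fst v - u \<bullet> fst (?I (j (\<gamma> + u \<bullet> fst v, snd v)))" unfolding fst_conv by (rule sym)
    also have "j (\<gamma> + u \<bullet> fst v, snd v) = frechet_derivative T (at (G (j y))) v"
      using dT[OF GU(2)[OF y], of v] v by (simp add: j_def[of "(_, _)"] scaleR_add_left)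
    also have "?I \<dots> = v" by (rule inv_f_f[OF bij_is_inj[OF inv(7)[OF yV]]])
    finally show ?thesis by simp
  qed
  have "hausdorff_null s (snd ` {y \<in> S. q y = 0 \<and> deriv_fst q y = 0})"
  proof (rule hausdorff_null_envelope[OF S q k s])
    fix y assume y: "y \<in> S" "q y = 0"
    have "surj (D (G (j y)))"
      using tr[OF GU(2)[OF y(1)]] PG[OF y(1)] y(2) unfolding D_def [symmetric]
      by (intro surj_if_no_cokernel lin GU(2)[OF y(1)]) auto
    then obtain v where "D (G (j y)) v = 1 *\<^sub>R c" by (metis surjD)
    from dq[OF y(1) this] show "\<exists>v. frechet_derivative q (at y) v \<noteq> 0" by (metis zero_neq_one)
  qed
  moreover have "snd ` ({p \<in> U. P p = 0 \<and> (\<exists>c. c \<noteq> 0 \<and> (\<forall>v. c \<bullet> D p (v, 0) = 0))} \<inter> U')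
      \<subseteq> snd ` {y \<in> S. q y = 0 \<and> deriv_fst q y = 0}"
  proof (rule image_subsetI)
    fix p assume "p \<in> {p \<in> U. P p = 0 \<and> (\<exists>c. c \<noteq> 0 \<and> (\<forall>v. c \<bullet> D p (v, 0) = 0))} \<inter> U'"
    then obtain c' where p: "p \<in> U" "P p = 0" "p \<in> U'" and c': "c' \<noteq> 0" "\<And>v. c' \<bullet> D p (v, 0) = 0"
      by blast
    define y where "y = (u \<bullet> fst p, snd p)"
    have jy: "j y = T p" by (simp add: j_def y_def T_def p(2))
    have yS: "y \<in> S" and Gy: "G (j y) = p"
      using p(3) inv(5) by (auto simp: S_def jy homeomorphism_def)
    have q0: "q y = 0" by (simp add: q_def Gy) (simp add: y_def)
    have lin0: "linear (\<lambda>v. D p (v, 0))"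
      using linear_compose[of "\<lambda>v. (v, 0)", OF linearI lin[OF p(1)]] by (simp add: comp_def)
    have "\<not> surj (\<lambda>v. D p (v, 0))"
    proof
      assume "surj (\<lambda>v. D p (v, 0))"
      from surjD[OF this, of c'] obtain v where "D p (v, 0) = c'" by auto
      then show False using c'(1) c'(2)[of v] by simp
    qed
    then have "\<not> inj (\<lambda>v. D p (v, 0))" using linear_injective_imp_surjective[OF lin0] by blast
    then obtain v where v: "D p (v, 0) = 0" "v \<noteq> 0" unfolding linear_injective_0[OF lin0] by auto
    \<comment> \<open>Otherwise the border would not see \<open>v\<close>, and \<open>(v, 0)\<close>
      would lie in the kernel of the invertible differential of \<open>T\<close>. The vanishing
      derivative found below is in direction \<open>(u \<bullet> v, 0)\<close>, so this factor must
      be cancelled.\<close>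
    have uv: "u \<bullet> v \<noteq> 0"
    proof
      assume "u \<bullet> v = 0"
      then have "frechet_derivative T (at p) (v, 0) = 0"
        unfolding dT[OF p(1)] using v(1) by (simp add: zero_prod_def)
      moreover have "inj (frechet_derivative T (at p))"
        using inv(7)[of "j y"] yS unfolding Gy S_def by (auto intro: bij_is_inj)
      moreover have l: "linear (frechet_derivative T (at p))"
        using Ck_on_has_derivative[OF T k p(1)] by (rule has_derivative_linear)
      ultimately have "(v, 0 :: 'b) = 0" unfolding linear_injective_0[OF l] by blast
      then show False using v(2) by (simp add: zero_prod_def)
    qed
    have "frechet_derivative q (at y) (u \<bullet> v, 0) = 0"
      using dq[OF yS, of "(v, 0)" 0] v(1) by (simp add: Gy)
    moreover have "linear (frechet_derivative q (at y))"
      using Ck_on_has_derivative[OF q k yS] by (rule has_derivative_linear)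
    then have "frechet_derivative q (at y) ((u \<bullet> v) *\<^sub>R (1, 0)) = (u \<bullet> v) *\<^sub>R frechet_derivative q (at y) (1, 0)"
      by (rule linear_scale)
    ultimately have "deriv_fst q y = 0" using uv by (simp add: deriv_fst_def)
    moreover have "snd p = snd y" by (simp add: y_def)
    ultimately show "snd p \<in> snd ` {y \<in> S. q y = 0 \<and> deriv_fst q y = 0}" using yS q0 by blast
  qed
  ultimately have "hausdorff_null s (snd ` ({p \<in> U. P p = 0 \<and> (\<exists>c. c \<noteq> 0 \<and> (\<forall>v. c \<bullet> D p (v, 0) = 0))} \<inter> U'))"
    by (rule hausdorff_null_subset)
  then show ?thesis using inv(1,2) unfolding D_def by blast
qed

theorem hausdorff_null_degenerate_parameters:
  fixes P :: "'a::euclidean_space \<times> 'b::euclidean_space \<Rightarrow> 'a"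
  assumes U: "open U" and P: "Ck_on k P U" and k: "0 < k" and s: "s \<ge> real DIM('b) - 1 + 1 / real k"
    and tr: "\<And>p c. p \<in> U \<Longrightarrow> P p = 0 \<Longrightarrow> (\<And>v. c \<bullet> frechet_derivative P (at p) v = 0) \<Longrightarrow> c = 0"
  shows "hausdorff_null s (snd ` {p \<in> U. P p = 0 \<and>
    (\<exists>c. c \<noteq> 0 \<and> (\<forall>v. c \<bullet> frechet_derivative P (at p) (v, 0) = 0))})"
proof -
  let ?m = "DIM('b)"
  define D where "D = {p \<in> U. P p = 0 \<and> (\<exists>c. c \<noteq> 0 \<and> (\<forall>v. c \<bullet> frechet_derivative P (at p) (v, 0) = 0))}"
  define N where "N p = {c. \<forall>v. c \<bullet> frechet_derivative P (at p) (v, 0) = 0}" for p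
  have N: "subspace (N p)" for p
    unfolding N_def by (auto intro!: subspaceI simp: inner_add_left)
  have "0 < 1 / real k" using k by simp
  moreover have "1 \<le> real ?m" by simp
  ultimately have s': "real ?m - 1 < s" "0 < s" using s by linarith+
  have P1: "Ck_on (Suc 0) P U" using Ck_on_mono[OF P] k by (simp add: Suc_leI del: Ck_on.simps)
  have "hausdorff_null s (snd ` D)"
  proof (cases "k = 1")
    case True
    show ?thesis
    proof (rule hausdorff_null_corank[where d = 1, OF U P1 s'(2)])
      show "p \<in> U" "P p = 0" if "p \<in> D" for p using that by (auto simp: D_def)
      show "c = 0" if "p \<in> D" "\<And>v. c \<bullet> frechet_derivative P (at p) v = 0" for p c
        using tr[OF _ _ that(2)] that(1) by (simp add: D_def)
      show "\<exists>N. subspace N \<and> 1 \<le> dim N \<and> (\<forall>c\<in>N. \<forall>v. c \<bullet> frechet_derivative P (at p) (v, 0) = 0)"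
        if "p \<in> D" for p
      proof (intro exI[of _ "N p"] conjI N)
        have "\<not> N p \<subseteq> {0}" using that by (auto simp: D_def N_def)
        then have "dim (N p) \<noteq> 0" by simp
        then show "1 \<le> dim (N p)" by linarith
      qed (simp add: N_def)
      fix p r and \<mu> :: real assume p: "p \<in> D" "0 < r" "0 < \<mu>" "ball p r \<subseteq> U"
      \<comment> \<open>Halving the radius puts a compact ball inside \<open>U\<close>, on which the
        derivative is uniformly continuous.\<close>
      have K: "cball p (r / 2) \<subseteq> U" "ball p (r / 2) \<subseteq> cball p (r / 2)" using p(2,4) by (auto simp: subset_eq)
      have sc: "\<exists>\<epsilon> \<eta> \<tau>. 0 < \<eta> \<and> \<eta> \<le> \<epsilon> \<and> \<epsilon> \<le> 1 \<and> (\<epsilon> / \<eta>) ^ (?m - 1) * \<eta> powr s \<le> e * \<epsilon> ^ ?m \<and>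
         0 \<le> \<tau> \<and> \<tau> * \<epsilon> \<le> \<mu> * \<eta> \<and> (\<forall>p0\<in>ball p (r/2). \<forall>q\<in>ball p (r/2). norm (q - p0) \<le> \<epsilon> \<longrightarrow>
           (\<Sum>b\<in>Basis. norm (frechet_derivative P (at q) b - frechet_derivative P (at p0) b)) \<le> \<tau>)"
        if e: "0 < e" for e
      proof -
        obtain \<delta> :: real where \<delta>: "0 < \<delta>" "\<delta> < 1" "\<delta> powr (1 / real k) \<le> e"
          by (rule small_powr[of "1 / real k" 1 e]) (use k e in simp_all)
        have "0 < \<delta> * \<mu>" using \<delta>(1) p(3) by simp
        then obtain d where d: "0 < d" "\<And>x y. x \<in> cball p (r/2) \<Longrightarrow> y \<in> cball p (r/2) \<Longrightarrow> norm (x - y) < d \<Longrightarrow>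
          (\<Sum>b\<in>Basis. norm (frechet_derivative P (at x) b - frechet_derivative P (at y) b)) \<le> \<delta> * \<mu>"
          by (rule Ck_on_deriv_uniform[OF compact_cball K(1) P1]) blast
        define \<epsilon> where "\<epsilon> = min (d / 2) 1"
        have \<epsilon>: "0 < \<epsilon>" "\<epsilon> \<le> 1" "\<epsilon> < d" using d(1) by (auto simp: \<epsilon>_def)
        have est: "(\<epsilon> / (\<delta> * \<epsilon> ^ k)) ^ (?m - 1) * (\<delta> * \<epsilon> ^ k) powr s \<le> e * \<epsilon> ^ ?m"
          using \<delta> \<epsilon> k s by (intro flat_scale_estimate) auto
        have \<delta>\<epsilon>: "\<delta> * \<epsilon> \<le> \<epsilon>" using \<delta> \<epsilon> by simp
        \<comment> \<open>The choice \<open>\<tau> = \<delta> * \<mu>\<close> turns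
          \<open>\<tau> * \<epsilon> \<le> \<mu> * \<eta>\<close> into an equality for
          \<open>\<eta> = \<delta> * \<epsilon>\<close>, which is
          \<open>\<delta> * \<epsilon> ^ k\<close> because k = 1.\<close>
        show ?thesis
        proof (rule exI[of _ \<epsilon>], rule exI[of _ "\<delta> * \<epsilon>"], rule exI[of _ "\<delta> * \<mu>"], intro conjI ballI impI)
          show "0 < \<delta> * \<epsilon>" "0 \<le> \<delta> * \<mu>" using \<delta>(1) \<epsilon>(1) p(3) by simp_all
          show "\<delta> * \<mu> * \<epsilon> \<le> \<mu> * (\<delta> * \<epsilon>)" by simp
          fix p0 q assume "p0 \<in> ball p (r/2)" "q \<in> ball p (r/2)" "norm (q - p0) \<le> \<epsilon>"
          then show "(\<Sum>b\<in>Basis. norm (frechet_derivative P (at q) b - frechet_derivative P (at p0) b)) \<le> \<delta> * \<mu>"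
            using K(2) \<epsilon>(3) by (intro d(2)) auto
        qed (use \<delta>\<epsilon> est \<epsilon>(2) True in simp_all)
      qed
      show "\<exists>\<rho>>0. \<rho> \<le> r \<and> (\<forall>e>0. \<exists>\<epsilon> \<eta> \<tau>. 0 < \<eta> \<and> \<eta> \<le> \<epsilon> \<and> \<epsilon> \<le> 1 \<and>
         (\<epsilon> / \<eta>) ^ (?m - 1) * \<eta> powr s \<le> e * \<epsilon> ^ ?m \<and>
         0 \<le> \<tau> \<and> \<tau> * \<epsilon> \<le> \<mu> * \<eta> \<and> (\<forall>p0\<in>ball p \<rho>. \<forall>q\<in>ball p \<rho>. norm (q - p0) \<le> \<epsilon> \<longrightarrow>
           (\<Sum>b\<in>Basis. norm (frechet_derivative P (at q) b - frechet_derivative P (at p0) b)) \<le> \<tau>))"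
        by (intro exI[of _ "r/2"] conjI allI impI sc) (use p(2) in simp_all)
    qed
  next
    case False
    then have k2: "Suc (Suc 0) \<le> k" using k by simp
    have P2: "Ck_on (Suc (Suc 0)) P U" using Ck_on_mono[OF P k2] .
    \<comment> \<open>Corank one is encoded as repairability by one rank-one border, exactly the
      hypothesis of the one-variable reduction; failure for all borders yields a cokernel of
      dimension at least two.\<close>
    define D1 where "D1 = {p \<in> D. \<exists>u c. inj (\<lambda>v. frechet_derivative P (at p) (v, 0) + (u \<bullet> v) *\<^sub>R c)}"
    have "hausdorff_null s (snd ` D1)"
    proof (rule hausdorff_null_locally)
      fix p assume "p \<in> D1"
      then have "p \<in> U" "\<exists>u c. inj (\<lambda>v. frechet_derivative P (at p) (v, 0) + (u \<bullet> v) *\<^sub>R c)"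
        unfolding D1_def D_def by blast+
      then obtain u c where "inj (\<lambda>v. frechet_derivative P (at p) (v, 0) + (u \<bullet> v) *\<^sub>R c)" by blast
      then have "\<exists>N. open N \<and> p \<in> N \<and> hausdorff_null s (snd ` (D \<inter> N))"
        unfolding D_def by (rule hausdorff_null_corank_one[OF U P k s _ \<open>p \<in> U\<close>, rotated]) (rule tr)
      then obtain N where "open N" "p \<in> N" "hausdorff_null s (snd ` (D \<inter> N))" by blast
      moreover have "snd ` (D1 \<inter> N) \<subseteq> snd ` (D \<inter> N)" unfolding D1_def by blast
      ultimately show "\<exists>N. open N \<and> p \<in> N \<and> hausdorff_null s (snd ` (D1 \<inter> N))"
        by (intro exI[of _ N] conjI) (auto elim: hausdorff_null_subset)
    qed
    moreover have "hausdorff_null s (snd ` (D - D1))"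
    proof (rule hausdorff_null_corank[where d = 2, OF U P1 s'(2)])
      show "p \<in> U" "P p = 0" if "p \<in> D - D1" for p using that by (auto simp: D_def)
      show "c = 0" if "p \<in> D - D1" "\<And>v. c \<bullet> frechet_derivative P (at p) v = 0" for p c
        using tr[OF _ _ that(2)] that(1) by (simp add: D_def)
      show "\<exists>N. subspace N \<and> 2 \<le> dim N \<and> (\<forall>c\<in>N. \<forall>v. c \<bullet> frechet_derivative P (at p) (v, 0) = 0)"
        if p: "p \<in> D - D1" for p
      proof (intro exI[of _ "N p"] conjI N)
        obtain c where c: "c \<noteq> 0" "\<And>v. c \<bullet> frechet_derivative P (at p) (v, 0) = 0" and pU: "p \<in> U"
          using p by (auto simp: D_def)
        have "linear (\<lambda>v. frechet_derivative P (at p) (v, 0))"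
          using linear_compose[of "\<lambda>v. (v, 0)", OF linearI has_derivative_linear[OF Ck_on_has_derivative[OF P k pU]]]
          by (simp add: comp_def)
        moreover have "\<not> inj (\<lambda>v. frechet_derivative P (at p) (v, 0) + (u \<bullet> v) *\<^sub>R c)" for u c
          using p unfolding D1_def by blast
        ultimately show "2 \<le> dim (N p)"
          unfolding N_def by (rule two_dim_cokernel[OF _ c])
      qed (simp add: N_def)
      fix p r and \<mu> :: real assume p: "p \<in> D - D1" "0 < r" "0 < \<mu>" "ball p r \<subseteq> U" and m2: "2 \<le> ?m"
      obtain r' L where L: "0 < r'" "0 \<le> L" "\<And>x y. x \<in> ball p r' \<Longrightarrow> y \<in> ball p r' \<Longrightarrow>
          (\<Sum>b\<in>Basis. norm (frechet_derivative P (at x) b - frechet_derivative P (at y) b)) \<le> L * norm (x - y)"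
        by (rule Ck_on_deriv_locally_Lipschitz[OF U _ P2, of p]) (use p(1) in \<open>auto simp: D_def\<close>)
      \<comment> \<open>\<open>L / \<mu>\<close> makes \<open>\<tau> = L * \<epsilon>\<close>
        compatible with \<open>\<eta> = K * \<epsilon>\<^sup>2\<close>; the maximum with 1 ensures
        that \<open>K * \<epsilon> \<le> 1\<close> implies
        \<open>\<epsilon> \<le> 1\<close>.\<close>
      define K where "K = max (L / \<mu>) 1"
      have K: "1 \<le> K" "L \<le> \<mu> * K" using p(3) by (auto simp: K_def max_def field_simps)
      have sc: "\<exists>\<epsilon> \<eta> \<tau>. 0 < \<eta> \<and> \<eta> \<le> \<epsilon> \<and> \<epsilon> \<le> 1 \<and> (\<epsilon> / \<eta>) ^ (?m - 2) * \<eta> powr s \<le> e * \<epsilon> ^ ?m \<and>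
         0 \<le> \<tau> \<and> \<tau> * \<epsilon> \<le> \<mu> * \<eta> \<and> (\<forall>p0\<in>ball p (min r r'). \<forall>q\<in>ball p (min r r'). norm (q - p0) \<le> \<epsilon> \<longrightarrow>
           (\<Sum>b\<in>Basis. norm (frechet_derivative P (at q) b - frechet_derivative P (at p0) b)) \<le> \<tau>)"
        if e: "0 < e" for e
      proof -
        obtain \<epsilon> where \<epsilon>: "0 < \<epsilon>" "K * \<epsilon> \<le> 1"
          "(\<epsilon> / (K * \<epsilon>\<^sup>2)) ^ (?m - 2) * (K * \<epsilon>\<^sup>2) powr s \<le> e * \<epsilon> ^ ?m"
          by (rule scale_estimate_square[OF s'(1) m2 e K(1)])
        have "1 * \<epsilon> \<le> K * \<epsilon>" using K(1) \<epsilon>(1) by (intro mult_right_mono) auto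
        then have "\<epsilon> \<le> 1" using \<epsilon>(2) by simp
        moreover have "K * \<epsilon>\<^sup>2 \<le> \<epsilon>" using mult_right_mono[OF \<epsilon>(2), of \<epsilon>] \<epsilon>(1) by (simp add: power2_eq_square mult_ac)
        moreover have "L * \<epsilon> * \<epsilon> \<le> \<mu> * (K * \<epsilon>\<^sup>2)"
          using mult_right_mono[OF K(2), of "\<epsilon> * \<epsilon>"] by (simp add: power2_eq_square mult_ac)
        moreover have "(\<Sum>b\<in>Basis. norm (frechet_derivative P (at q) b - frechet_derivative P (at p0) b)) \<le> L * \<epsilon>"
          if "p0 \<in> ball p (min r r')" "q \<in> ball p (min r r')" "norm (q - p0) \<le> \<epsilon>" for p0 q
          using that by (intro order_trans[OF L(3) mult_left_mono[OF that(3) L(2)]]) simp_all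
        moreover have "0 < K * \<epsilon>\<^sup>2" "0 \<le> L * \<epsilon>" using K(1) \<epsilon>(1) L(2) by simp_all
        ultimately show ?thesis
          using \<epsilon>(3)
          by - (rule exI[of _ \<epsilon>], rule exI[of _ "K * \<epsilon>\<^sup>2"], rule exI[of _ "L * \<epsilon>"], intro conjI ballI impI)
      qed
      show "\<exists>\<rho>>0. \<rho> \<le> r \<and> (\<forall>e>0. \<exists>\<epsilon> \<eta> \<tau>. 0 < \<eta> \<and> \<eta> \<le> \<epsilon> \<and> \<epsilon> \<le> 1 \<and>
         (\<epsilon> / \<eta>) ^ (?m - 2) * \<eta> powr s \<le> e * \<epsilon> ^ ?m \<and>
         0 \<le> \<tau> \<and> \<tau> * \<epsilon> \<le> \<mu> * \<eta> \<and> (\<forall>p0\<in>ball p \<rho>. \<forall>q\<in>ball p \<rho>. norm (q - p0) \<le> \<epsilon> \<longrightarrow>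
           (\<Sum>b\<in>Basis. norm (frechet_derivative P (at q) b - frechet_derivative P (at p0) b)) \<le> \<tau>))"
        by (intro exI[of _ "min r r'"] conjI allI impI sc) (use p(2) L(1) in simp_all)
    qed
    ultimately have "hausdorff_null s (snd ` D1 \<union> snd ` (D - D1))" by (rule hausdorff_null_Un)
    then show ?thesis by (rule hausdorff_null_subset) blast
  qed
  then show ?thesis unfolding D_def .
qed

section \<open>Morse functions on manifolds\<close>

text \<open>\<open>L\<close> is the orthogonal projection onto the range of \<open>J\<close>
  followed by the inverse of \<open>J\<close>. Orthogonality is taken in the target because the
  model space carries no inner product.\<close>

lemma adapted_left_inverse:
  fixes J :: "'e::real_normed_vector \<Rightarrow> 'b::euclidean_space"
  assumes J: "linear J" "inj J"
  obtains L where "bounded_linear L" "\<And>x. L (J x) = x" "\<And>x z. J x \<bullet> (z - J (L z)) = 0"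
proof -
  have "subspace (range J)" using linear_subspace_image[OF J(1)] by simp
  then obtain B where B: "B \<subseteq> range J" "pairwise orthogonal B" "\<And>x. x \<in> B \<Longrightarrow> norm x = 1" "independent B"
    "card B = dim (range J)" "span B = range J"
    using orthonormal_basis_subspace[of "range J"] by metis
  have fB: "finite B" using B(4) independent_bound by blast
  define L where "L z = (\<Sum>b\<in>B. (z \<bullet> b) *\<^sub>R inv J b)" for z
  have bl: "bounded_linear L"
    unfolding L_def [abs_def]
    by (intro bounded_linear_sum bounded_linear_compose[OF bounded_linear_scaleR_left bounded_linear_inner_left])
  have JL: "J (L z) = (\<Sum>b\<in>B. (z \<bullet> b) *\<^sub>R b)" for z
    unfolding L_def using B(1) by (simp add: linear_sum[OF J(1)] linear_scale[OF J(1)] f_inv_into_f subset_eq)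
  have "J (L (J x)) = J x" for x
    unfolding JL by (rule orthonormal_basis_expand[OF B(2,3) _ fB]) (simp_all add: B(6))
  then have LJ: "L (J x) = x" for x using J(2) by (simp add: inj_eq)
  have "b \<bullet> (z - J (L z)) = 0" if b: "b \<in> B" for b z
  proof -
    have "b \<bullet> J (L z) = (\<Sum>b'\<in>B. (z \<bullet> b') * (b \<bullet> b'))"
      unfolding JL by (simp add: inner_sum_right)
    also have "\<dots> = (\<Sum>b'\<in>B. if b' = b then z \<bullet> b else 0)"
      using B(2,3) b by (intro sum.cong) (auto simp: pairwise_def orthogonal_def dot_square_norm)
    also have "\<dots> = z \<bullet> b" using b fB by simp
    finally show ?thesis by (simp add: inner_diff_right inner_commute)
  qed
  then have "J x \<bullet> (z - J (L z)) = 0" for x z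
  proof -
    have "J x \<in> span B" by (simp add: B(6))
    moreover have "subspace {y. y \<bullet> (z - J (L z)) = 0}" by (auto intro!: subspaceI simp: inner_add_left)
    ultimately show ?thesis
      using \<open>\<And>b z. b \<in> B \<Longrightarrow> b \<bullet> (z - J (L z)) = 0\<close> span_minimal[of B "{y. y \<bullet> (z - J (L z)) = 0}"] by blast
  qed
  with bl LJ show ?thesis by (rule that)
qed

text \<open>The model space \<open>'e\<close> is only a normed space, and may be zero-dimensional. Therefore the gradient
  equation is transported by \<open>L\<close> to the target space \<open>'b\<close>, where the extra term \<open>w - J (L w)\<close> of \<open>P\<close>
  makes the added directions nondegenerate.\<close>

lemma chart_degenerate_null:
  fixes F :: "'e::real_normed_vector \<Rightarrow> 'b::euclidean_space" and G :: "'e \<Rightarrow> real"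
  assumes S: "open S" and F: "Ck_on (Suc k) F S" and G: "Ck_on (Suc k) G S" and k: "0 < k"
    and inj: "\<And>x. x \<in> S \<Longrightarrow> inj (frechet_derivative F (at x))"
    and s: "s \<ge> real DIM('b) - 1 + 1 / real k"
  shows "hausdorff_null s {\<beta>. \<exists>x\<in>S. (\<forall>v. frechet_derivative (\<lambda>x. G x + \<beta> \<bullet> F x) (at x) v = 0) \<and>
     (\<exists>v. v \<noteq> 0 \<and> (\<forall>w. frechet_derivative (\<lambda>y. frechet_derivative (\<lambda>x. G x + \<beta> \<bullet> F x) (at y) v) (at x) w = 0))}"
proof (cases "S = {}")
  case False
  then obtain x0 where x0: "x0 \<in> S" by blast
  define DF where "DF x = frechet_derivative F (at x)" for x
  define DG where "DG x = frechet_derivative G (at x)" for x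
  have dF: "(F has_derivative DF x) (at x)" and dG: "(G has_derivative DG x) (at x)" if "x \<in> S" for x
    unfolding DF_def DG_def using Ck_on_has_derivative[OF F _ that] Ck_on_has_derivative[OF G _ that] by auto
  have lF: "linear (DF x)" and lG: "linear (DG x)" if "x \<in> S" for x
    using dF[OF that] dG[OF that] by (auto intro: has_derivative_linear)
  have kF: "Ck_on k (\<lambda>x. DF x v) S" and kG: "Ck_on k (\<lambda>x. DG x v) S" for v
    using F G by (simp_all add: DF_def DG_def)
  define DDF where "DDF v x = frechet_derivative (\<lambda>x. DF x v) (at x)" for v x
  define DDG where "DDG v x = frechet_derivative (\<lambda>x. DG x v) (at x)" for v x
  have ddF: "((\<lambda>x. DF x v) has_derivative DDF v x) (at x)" and ddG: "((\<lambda>x. DG x v) has_derivative DDG v x) (at x)"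
    if "x \<in> S" for x v
    unfolding DDF_def DDG_def using Ck_on_has_derivative[OF kF k that] Ck_on_has_derivative[OF kG k that] by auto
  define J where "J = DF x0"
  have J: "linear J" "inj J" using lF[OF x0] inj[OF x0] by (simp_all add: J_def DF_def)
  have blJ: "bounded_linear J" unfolding J_def using dF[OF x0] by (rule has_derivative_bounded_linear)
  obtain L where L: "bounded_linear L" "\<And>x. L (J x) = x" "\<And>x z. J x \<bullet> (z - J (L z)) = 0"
    using adapted_left_inverse[OF J] by metis
  have lL: "linear L" using L(1) by (rule bounded_linear.linear)
  define U :: "('b \<times> 'b) set" where "U = {p. L (fst p) \<in> S}"
  have blLf: "bounded_linear (\<lambda>p :: 'b \<times> 'b. L (fst p))"
    by (rule bounded_linear_compose[OF L(1) bounded_linear_fst])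
  have U: "open U"
    using open_vimage[OF S linear_continuous_on[OF blLf]] by (simp add: U_def vimage_def)
  \<comment> \<open>The sum represents, as a vector of \<open>'b\<close>, the functional sending z
    to the derivative of the function at \<open>L (fst p)\<close> in direction \<open>L z\<close>.
    It kills the kernel of \<open>L\<close>; the second summand is the projection onto exactly that
    kernel.\<close>
  define P where "P p = (\<Sum>i\<in>Basis. (DG (L (fst p)) (L i) + snd p \<bullet> DF (L (fst p)) (L i)) *\<^sub>R i)
     + (fst p - J (L (fst p)))" for p :: "'b \<times> 'b"
  have P: "Ck_on k P U"
  proof -
    have 1: "Ck_on k (\<lambda>p. DG (L (fst p)) (L i)) U" for i
      by (rule Ck_on_precompose_linear[OF U blLf kG]) (auto simp: U_def)
    have 2: "Ck_on k (\<lambda>p. DF (L (fst p)) (L i)) U" for i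
      by (rule Ck_on_precompose_linear[OF U blLf kF]) (auto simp: U_def)
    have 3: "Ck_on k (\<lambda>p. snd p \<bullet> DF (L (fst p)) (L i)) U" for i
      by (rule Ck_on_apply[where A = "\<lambda>p b. b \<bullet> DF (L (fst p)) (L i)" and y = snd])
        (auto intro!: U linearI Ck_on_bounded_linear bounded_linear_snd
          Ck_on_linear_comp[OF U bounded_linear_inner_right 2] simp: inner_add_left)
    show ?thesis
      unfolding P_def [abs_def]
      by (intro Ck_on_add[OF U] Ck_on_sum[OF U] Ck_on_scaleR[OF U] Ck_on_const[OF U] Ck_on_diff[OF U] 1 3
          Ck_on_bounded_linear[OF U] bounded_linear_fst bounded_linear_compose[OF blJ blLf])
  qed
  have cP: "c \<bullet> P p = DG (L (fst p)) (L c) + snd p \<bullet> DF (L (fst p)) (L c) + c \<bullet> (fst p - J (L (fst p)))"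
    if "p \<in> U" for c p
  proof -
    let ?\<Lambda> = "\<lambda>z. DG (L (fst p)) (L z) + snd p \<bullet> DF (L (fst p)) (L z)"
    have "L (fst p) \<in> S" using that by (simp add: U_def)
    then have "linear ?\<Lambda>"
      by (intro linearI)
        (simp_all add: linear_add[OF lL] linear_scale[OF lL] linear_add[OF lF] linear_add[OF lG]
          linear_scale[OF lF] linear_scale[OF lG] inner_add_right distrib_left)
    from linear_euclidean_expand[OF this, of c] show ?thesis
      by (simp add: P_def inner_add_right inner_sum_right mult.commute)
  qed
  have dP: "c \<bullet> frechet_derivative P (at p) v = DDG (L c) (L (fst p)) (L (fst v)) + snd v \<bullet> DF (L (fst p)) (L c)
      + snd p \<bullet> DDF (L c) (L (fst p)) (L (fst v)) + c \<bullet> (fst v - J (L (fst v)))"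
    if p: "p \<in> U" for c p v
  proof -
    have x: "L (fst p) \<in> S" using p by (simp add: U_def)
    note blLf' = bounded_linear_imp_has_derivative[OF blLf, of "at p"]
    have 1: "((\<lambda>p. DG (L (fst p)) (L c)) has_derivative (\<lambda>v. DDG (L c) (L (fst p)) (L (fst v)))) (at p)"
      by (rule has_derivative_compose[OF blLf' ddG[OF x]])
    have 2: "((\<lambda>p. DF (L (fst p)) (L c)) has_derivative (\<lambda>v. DDF (L c) (L (fst p)) (L (fst v)))) (at p)"
      by (rule has_derivative_compose[OF blLf' ddF[OF x]])
    have 3: "((\<lambda>p. snd p \<bullet> DF (L (fst p)) (L c)) has_derivative
        (\<lambda>v. snd p \<bullet> DDF (L c) (L (fst p)) (L (fst v)) + snd v \<bullet> DF (L (fst p)) (L c))) (at p)"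
      by (rule has_derivative_inner[OF bounded_linear_imp_has_derivative[OF bounded_linear_snd] 2])
    have 4: "((\<lambda>p :: 'b \<times> 'b. c \<bullet> (fst p - J (L (fst p)))) has_derivative (\<lambda>v. c \<bullet> (fst v - J (L (fst v))))) (at p)"
      by (intro bounded_linear_imp_has_derivative bounded_linear_compose[OF bounded_linear_inner_right]
          bounded_linear_sub bounded_linear_fst bounded_linear_compose[OF blJ blLf])
    have "((\<lambda>p. c \<bullet> P p) has_derivative (\<lambda>v. DDG (L c) (L (fst p)) (L (fst v)) +
        (snd p \<bullet> DDF (L c) (L (fst p)) (L (fst v)) + snd v \<bullet> DF (L (fst p)) (L c)) + c \<bullet> (fst v - J (L (fst v))))) (at p)"
      by (rule has_derivative_transform_within_open[OF has_derivative_add[OF has_derivative_add[OF 1 3] 4] U p])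
        (simp add: cP)
    moreover have "((\<lambda>p. c \<bullet> P p) has_derivative (\<lambda>v. c \<bullet> frechet_derivative P (at p) v)) (at p)"
      by (rule has_derivative_inner_right[OF Ck_on_has_derivative[OF P k p]])
    ultimately have "(\<lambda>v. c \<bullet> frechet_derivative P (at p) v) = (\<lambda>v. DDG (L c) (L (fst p)) (L (fst v)) +
        (snd p \<bullet> DDF (L c) (L (fst p)) (L (fst v)) + snd v \<bullet> DF (L (fst p)) (L c)) + c \<bullet> (fst v - J (L (fst v))))"
      using has_derivative_unique by blast
    from fun_cong[OF this, of v] show ?thesis by simp
  qed
  have null: "hausdorff_null s (snd ` {p \<in> U. P p = 0 \<and>
      (\<exists>c. c \<noteq> 0 \<and> (\<forall>v. c \<bullet> frechet_derivative P (at p) (v, 0) = 0))})"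
  proof (rule hausdorff_null_degenerate_parameters[OF U P k s])
    fix p c assume p: "p \<in> U" and c: "\<And>v. c \<bullet> frechet_derivative P (at p) v = 0"
    have x: "L (fst p) \<in> S" using p by (simp add: U_def)
    have z: "DDG u (L (fst p)) 0 = 0" "DDF u (L (fst p)) 0 = 0" "L 0 = 0" "J 0 = 0" for u
      using linear_0[OF has_derivative_linear[OF ddG[OF x]]] linear_0[OF has_derivative_linear[OF ddF[OF x]]]
        linear_0[OF lL] linear_0[OF J(1)] by auto
    \<comment> \<open>The one place where the immersion property yields transversality: moving only
      the parameter shows that \<open>DF\<close> kills \<open>L c\<close>, so
      \<open>L c = 0\<close>. The complementary summand, tested in direction \<open>(c, 0)\<close>,
      then gives \<open>c \<bullet> c = 0\<close>.\<close>
    have "\<gamma> \<bullet> DF (L (fst p)) (L c) = 0" for \<gamma>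
      using c[of "(0, \<gamma>)"] unfolding dP[OF p] by (simp add: z)
    then have "DF (L (fst p)) (L c) = 0" by (metis inner_eq_zero_iff)
    then have "L c = 0"
      using inj[OF x] linear_injective_0[OF lF[OF x]] unfolding DF_def by blast
    then have "c \<bullet> c = 0" using c[of "(c, 0)"] unfolding dP[OF p] by (simp add: z)
    then show "c = 0" by simp
  qed
  show ?thesis
  proof (rule hausdorff_null_subset[OF null], rule subsetI)
    fix \<beta> assume "\<beta> \<in> {\<beta>. \<exists>x\<in>S. (\<forall>v. frechet_derivative (\<lambda>x. G x + \<beta> \<bullet> F x) (at x) v = 0) \<and>
     (\<exists>v. v \<noteq> 0 \<and> (\<forall>w. frechet_derivative (\<lambda>y. frechet_derivative (\<lambda>x. G x + \<beta> \<bullet> F x) (at y) v) (at x) w = 0))}"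
    then obtain x v where x: "x \<in> S" and crit: "\<And>v. frechet_derivative (\<lambda>x. G x + \<beta> \<bullet> F x) (at x) v = 0"
      and v: "v \<noteq> 0" and deg: "\<And>w. frechet_derivative (\<lambda>y. frechet_derivative (\<lambda>x. G x + \<beta> \<bullet> F x) (at y) v) (at x) w = 0"
      by blast
    have Dh: "frechet_derivative (\<lambda>x. G x + \<beta> \<bullet> F x) (at y) w = DG y w + \<beta> \<bullet> DF y w" if "y \<in> S" for y w
      using fun_cong[OF frechet_derivative_at[OF has_derivative_add[OF dG[OF that]
            has_derivative_inner_right[OF dF[OF that]]]], of w] by simp
    have "((\<lambda>y. frechet_derivative (\<lambda>x. G x + \<beta> \<bullet> F x) (at y) v) has_derivative
        (\<lambda>w. DDG v x w + \<beta> \<bullet> DDF v x w)) (at x)"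
      by (rule has_derivative_transform_within_open[OF has_derivative_add[OF ddG[OF x]
            has_derivative_inner_right[OF ddF[OF x]]] S x]) (simp add: Dh)
    from fun_cong[OF frechet_derivative_at[OF this]] deg
    have DD: "DDG v x w + \<beta> \<bullet> DDF v x w = 0" for w by simp
    \<comment> \<open>At \<open>J x\<close> the complementary summand vanishes. The degenerate
      direction \<open>v\<close> becomes the cokernel vector \<open>J v\<close>:
      \<open>L (J v) = v\<close> recovers the Hessian row, and \<open>J v\<close> is orthogonal to
      everything the complementary summand adds.\<close>
    let ?p = "(J x, \<beta>)"
    have pU: "?p \<in> U" using x L(2) by (simp add: U_def)
    have "P ?p = 0"
      using crit Dh[OF x] by (simp add: P_def L(2))
    moreover have "J v \<noteq> 0" using v L(2)[of v] linear_0[OF lL] by auto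
    moreover have "J v \<bullet> frechet_derivative P (at ?p) (w, 0) = 0" for w
      unfolding dP[OF pU] using DD[of "L w"] L(3)[of v w] by (simp add: L(2))
    ultimately have "?p \<in> {p \<in> U. P p = 0 \<and> (\<exists>c. c \<noteq> 0 \<and> (\<forall>v. c \<bullet> frechet_derivative P (at p) (v, 0) = 0))}"
      using pU by blast
    then show "\<beta> \<in> snd ` {p \<in> U. P p = 0 \<and> (\<exists>c. c \<noteq> 0 \<and> (\<forall>v. c \<bullet> frechet_derivative P (at p) (v, 0) = 0))}"
      by force
  qed
qed simp

text \<open>No differentiability is assumed: both derivatives are choices from one and the same
  predicate, so they agree in any case.\<close>

lemma frechet_derivative_cong_open:
  assumes "open S" "x \<in> S" "\<And>y. y \<in> S \<Longrightarrow> f y = g y"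
  shows "frechet_derivative f (at x) = frechet_derivative g (at x)"
proof -
  have "(f has_derivative D) (at x) \<longleftrightarrow> (g has_derivative D) (at x)" for D
    using has_derivative_transform_within_open[OF _ assms(1,2), of f D UNIV g]
      has_derivative_transform_within_open[OF _ assms(1,2), of g D UNIV f] assms(3) by auto
  then show ?thesis by (simp add: frechet_derivative_def)
qed

text \<open>The second derivative of \<tau> enters only through the differential of
  \<open>h\<close>, which vanishes at \<open>\<tau> x0\<close>. The pair \<open>J\<close>,
  \<open>L\<close> supplies coordinates on a model space without \<open>Basis\<close>: directions
  are expanded through \<open>'b\<close>, and the product rule is applied term by term.\<close>

lemma hessian_chart_change:
  fixes h :: "'e::real_normed_vector \<Rightarrow> real" and \<tau> :: "'e \<Rightarrow> 'e" and J :: "'e \<Rightarrow> 'b::euclidean_space"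
  assumes J: "bounded_linear J" "linear L" "\<And>x. L (J x) = x"
    and A: "open A" "x0 \<in> A" "\<tau> ` A \<subseteq> B" and B: "open B"
    and \<tau>: "Ck_on (Suc (Suc 0)) \<tau> A" and h: "Ck_on (Suc (Suc 0)) h B"
    and crit: "\<And>v. frechet_derivative h (at (\<tau> x0)) v = 0"
  defines "D \<equiv> frechet_derivative \<tau> (at x0)"
  shows "frechet_derivative (\<lambda>x. frechet_derivative (\<lambda>x. h (\<tau> x)) (at x) v) (at x0) w
    = frechet_derivative (\<lambda>y. frechet_derivative h (at y) (D v)) (at (\<tau> x0)) (D w)"
proof -
  let ?h' = "\<lambda>y. frechet_derivative h (at y)"
  let ?\<tau>' = "\<lambda>x. frechet_derivative \<tau> (at x)"
  have \<tau>B: "\<tau> x \<in> B" if "x \<in> A" for x using A(3) that by blast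
  have dh: "(h has_derivative ?h' y) (at y)" if "y \<in> B" for y
    using Ck_on_has_derivative[OF h _ that] by simp
  have d\<tau>: "(\<tau> has_derivative ?\<tau>' x) (at x)" if "x \<in> A" for x
    using Ck_on_has_derivative[OF \<tau> _ that] by simp
  have lh: "linear (?h' y)" if "y \<in> B" for y using dh[OF that] by (rule has_derivative_linear)
  have h1: "Ck_on (Suc 0) (\<lambda>y. ?h' y b) B" for b using h by (subst (asm) Ck_on.simps(2)) blast
  have \<tau>1: "Ck_on (Suc 0) (\<lambda>x. ?\<tau>' x v) A" for v using \<tau> by (subst (asm) Ck_on.simps(2)) blast
  define H where "H b = frechet_derivative (\<lambda>y. ?h' y b) (at (\<tau> x0))" for b
  have dH: "((\<lambda>y. ?h' y b) has_derivative H b) (at (\<tau> x0))" for b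
    unfolding H_def using Ck_on_has_derivative[OF h1 _ \<tau>B[OF A(2)]] by simp
  have expand: "?h' y b = (\<Sum>i\<in>Basis. (J b \<bullet> i) * ?h' y (L i))" if "y \<in> B" for y b
    using linear_euclidean_expand[OF linear_compose[OF J(2) lh[OF that]], of "J b"] by (simp add: J(3))
  have chain: "?h' (\<tau> x) (?\<tau>' x v) = frechet_derivative (\<lambda>x. h (\<tau> x)) (at x) v" if "x \<in> A" for x
    using fun_cong[OF frechet_derivative_at[OF has_derivative_compose[OF d\<tau>[OF that] dh[OF \<tau>B[OF that]]]]] by simp
  define z where "z i x = J (?\<tau>' x v) \<bullet> i" for i x
  define z' where "z' i = frechet_derivative (z i) (at x0)" for i
  have dz: "(z i has_derivative z' i) (at x0)" for i
  proof -
    have "Ck_on (Suc 0) (z i) A"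
      unfolding z_def [abs_def]
      by (rule Ck_on_linear_comp[OF A(1) bounded_linear_compose[OF bounded_linear_inner_left J(1)] \<tau>1])
    from Ck_on_has_derivative[OF this _ A(2)] show ?thesis by (simp add: z'_def)
  qed
  have "((\<lambda>x. \<Sum>i\<in>Basis. z i x * ?h' (\<tau> x) (L i)) has_derivative
      (\<lambda>w. \<Sum>i\<in>Basis. z i x0 * H (L i) (D w) + z' i w * ?h' (\<tau> x0) (L i))) (at x0)"
    unfolding D_def
    by (intro has_derivative_sum has_derivative_mult dz has_derivative_compose[OF d\<tau>[OF A(2)] dH])
  then have "((\<lambda>x. frechet_derivative (\<lambda>x. h (\<tau> x)) (at x) v) has_derivative
      (\<lambda>w. \<Sum>i\<in>Basis. z i x0 * H (L i) (D w) + z' i w * ?h' (\<tau> x0) (L i))) (at x0)"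
    by (rule has_derivative_transform_within_open[OF _ A(1,2)])
      (simp add: z_def flip: expand[OF \<tau>B] chain)
  from fun_cong[OF frechet_derivative_at[OF this], of w]
  have "frechet_derivative (\<lambda>x. frechet_derivative (\<lambda>x. h (\<tau> x)) (at x) v) (at x0) w
      = (\<Sum>i\<in>Basis. z i x0 * H (L i) (D w))" by (simp add: crit)
  moreover have "H (D v) (D w) = (\<Sum>i\<in>Basis. z i x0 * H (L i) (D w))"
  proof -
    have "((\<lambda>y. \<Sum>i\<in>Basis. (J (D v) \<bullet> i) * ?h' y (L i)) has_derivative
        (\<lambda>w. \<Sum>i\<in>Basis. (J (D v) \<bullet> i) * H (L i) w)) (at (\<tau> x0))"
      by (intro has_derivative_sum has_derivative_mult_right dH)
    then have "((\<lambda>y. ?h' y (D v)) has_derivative (\<lambda>w. \<Sum>i\<in>Basis. (J (D v) \<bullet> i) * H (L i) w)) (at (\<tau> x0))"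
      by (rule has_derivative_transform_within_open[OF _ B \<tau>B[OF A(2)]]) (simp add: expand[of _ "D v"])
    from fun_cong[OF frechet_derivative_at[OF this], of "D w"] show ?thesis
      by (simp add: H_def[of "D v"]) (simp add: z_def D_def)
  qed
  ultimately show ?thesis by (simp add: H_def)
qed

lemma chart_properties:
  assumes "is_chart X (U, \<phi>)"
  shows "openin X U" "open (\<phi> ` U)" "inj_on \<phi> U" "\<And>W. openin X W \<Longrightarrow> open (\<phi> ` (U \<inter> W))"
proof -
  have U: "openin X U" and o: "open (\<phi> ` U)"
    and hom: "homeomorphic_map (subtopology X U) (top_of_set (\<phi> ` U)) \<phi>"
    using assms by (auto simp: is_chart_def)
  show "openin X U" "open (\<phi> ` U)" by fact+
  have ts: "topspace (subtopology X U) = U" using openin_subset[OF U] by auto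
  show "inj_on \<phi> U" using homeomorphic_imp_injective_map[OF hom] ts by simp
  fix W assume "openin X W"
  then have "openin (subtopology X U) (U \<inter> W)" by (auto simp: openin_subtopology)
  then have "openin (top_of_set (\<phi> ` U)) (\<phi> ` (U \<inter> W))"
    using homeomorphic_imp_open_map[OF hom] by (simp add: open_map_def)
  then show "open (\<phi> ` (U \<inter> W))" using o by (rule openin_open_trans)
qed

text \<open>The degenerate chart comes from the whole atlas, which may be uncountable, whereas null
  sets are united over countably many charts; hence degeneracy must be carried to a prescribed
  chart. The degenerate direction there is the image of \<open>v\<close> under the derivative of the
  transition map. The immersion serves to provide the coordinates on the model space.\<close>

lemma degenerate_in_other_chart:
  fixes f :: "'p \<Rightarrow> 'b::euclidean_space" and h :: "'p \<Rightarrow> real" and \<A> :: "('p, 'e::real_normed_vector) chart set"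
  assumes atlas: "Cr_atlas r X \<A>" and r: "2 \<le> r" and f: "Cr_immersion r \<A> f" and h: "Cr_map r \<A> h"
    and c: "(U, \<phi>) \<in> \<A>" "q \<in> U" "(W, \<psi>) \<in> \<A>" "q \<in> W"
    and crit: "\<And>v. chart_deriv (W, \<psi>) h q v = 0"
    and deg: "v \<noteq> 0" "\<And>w. chart_hessian (U, \<phi>) h q v w = 0"
  shows "\<exists>v. v \<noteq> 0 \<and> (\<forall>w. chart_hessian (W, \<psi>) h q v w = 0)"
proof -
  have ch: "is_chart X (U, \<phi>)" "is_chart X (W, \<psi>)" using atlas c by (auto simp: Cr_atlas_def)
  note pU = chart_properties[OF ch(1)] and pW = chart_properties[OF ch(2)]
  define \<tau> where "\<tau> = \<psi> \<circ> inv_into U \<phi>"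
  define \<sigma> where "\<sigma> = \<phi> \<circ> inv_into W \<psi>"
  define A where "A = \<phi> ` (U \<inter> W)"
  define B where "B = \<psi> ` (W \<inter> U)"
  have oA: "open A" and oB: "open B" unfolding A_def B_def using pU(4)[OF pW(1)] pW(4)[OF pU(1)] by auto
  have tr: "Ck_on r \<tau> A" "Ck_on r \<sigma> B"
    using atlas c(1,3) unfolding Cr_atlas_def A_def B_def \<tau>_def \<sigma>_def by fastforce+
  have r2: "Suc (Suc 0) \<le> r" "0 < r" using r by auto
  have \<tau>: "\<tau> (\<phi> p) = \<psi> p" "\<sigma> (\<psi> p) = \<phi> p" if "p \<in> U" "p \<in> W" for p
    using that pU(3) pW(3) by (auto simp: \<tau>_def \<sigma>_def)
  define x0 where "x0 = \<phi> q"
  have x0: "x0 \<in> A" "\<tau> x0 = \<psi> q" "\<psi> q \<in> B" "\<sigma> (\<psi> q) = x0"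
    using c \<tau> by (auto simp: x0_def A_def B_def)
  have \<tau>A: "\<tau> ` A \<subseteq> B" using \<tau> by (force simp: A_def B_def)
  let ?D = "frechet_derivative \<tau> (at x0)" and ?E = "frechet_derivative \<sigma> (at (\<psi> q))"
  have d\<tau>: "(\<tau> has_derivative ?D) (at x0)" using Ck_on_has_derivative[OF tr(1) r2(2) x0(1)] .
  have d\<sigma>: "(\<sigma> has_derivative ?E) (at (\<psi> q))" using Ck_on_has_derivative[OF tr(2) r2(2) x0(3)] .
  have "((\<lambda>x. \<sigma> (\<tau> x)) has_derivative (\<lambda>v. ?E (?D v))) (at x0)"
    using has_derivative_compose[OF d\<tau>] d\<sigma> x0(2) by simp
  then have "((\<lambda>x. x) has_derivative (\<lambda>v. ?E (?D v))) (at x0)"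
    by (rule has_derivative_transform_within_open[OF _ oA x0(1)]) (auto simp: A_def \<tau>)
  then have ED: "?E (?D v) = v" for v
    using has_derivative_unique[OF _ has_derivative_ident] by (metis (no_types))
  have "((\<lambda>y. \<tau> (\<sigma> y)) has_derivative (\<lambda>v. ?D (?E v))) (at (\<psi> q))"
    using has_derivative_compose[OF d\<sigma>] d\<tau> x0(4) by simp
  then have "((\<lambda>y. y) has_derivative (\<lambda>v. ?D (?E v))) (at (\<psi> q))"
    by (rule has_derivative_transform_within_open[OF _ oB x0(3)]) (auto simp: B_def \<tau>)
  then have DE: "?D (?E v) = v" for v
    using has_derivative_unique[OF _ has_derivative_ident] by (metis (no_types))
  define k where "k = h \<circ> inv_into W \<psi>"
  have kW: "Ck_on r k (\<psi> ` W)" using h c(3) unfolding Cr_map_def k_def by blast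
  have k: "Ck_on (Suc (Suc 0)) k B"
    by (rule Ck_on_mono[OF Ck_on_subset[OF kW] r2(1)]) (auto simp: B_def)
  have hk: "(h \<circ> inv_into U \<phi>) x = k (\<tau> x)" if "x \<in> A" for x
    using that pU(3) pW(3) by (auto simp: A_def k_def \<tau>_def)
  define J where "J = chart_deriv (W, \<psi>) f q"
  have J': "(f \<circ> inv_into W \<psi> has_derivative J) (at (\<psi> q))"
  proof -
    have "Ck_on r (f \<circ> inv_into W \<psi>) (\<psi> ` W)" using f c(3) unfolding Cr_immersion_def Cr_map_def by blast
    from Ck_on_has_derivative[OF this r2(2)] show ?thesis using c(4) by (simp add: J_def chart_deriv_def)
  qed
  have "inj J" using f c(3,4) unfolding Cr_immersion_def J_def by fastforce
  then obtain L where L: "bounded_linear L" "\<And>x. L (J x) = x"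
    using adapted_left_inverse[OF has_derivative_linear[OF J']] by metis
  have hess: "frechet_derivative (\<lambda>x. frechet_derivative (\<lambda>x. k (\<tau> x)) (at x) v) (at x0) w
    = frechet_derivative (\<lambda>y. frechet_derivative k (at y) (?D v)) (at (\<tau> x0)) (?D w)" for w
    using crit Ck_on_mono[OF tr(1) r2(1)]
    by (intro hessian_chart_change[OF has_derivative_bounded_linear[OF J'] bounded_linear.linear[OF L(1)] L(2)
          oA x0(1) \<tau>A oB _ k]) (simp_all add: x0(2) chart_deriv_def k_def del: Ck_on.simps)
  have same: "frechet_derivative (\<lambda>x. frechet_derivative (h \<circ> inv_into U \<phi>) (at x) v) (at x0)
      = frechet_derivative (\<lambda>x. frechet_derivative (\<lambda>x. k (\<tau> x)) (at x) v) (at x0)"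
    using hk by (intro frechet_derivative_cong_open[OF oA x0(1)] fun_cong[OF frechet_derivative_cong_open[OF oA]]) auto
  \<comment> \<open>Every direction \<open>w\<close> of the new chart is reached, as the image of
    \<open>?E w\<close>.\<close>
  have "chart_hessian (W, \<psi>) h q (?D v) w = 0" for w
    using hess[of "?E w"] deg(2)[of "?E w"] same
    by (simp add: chart_hessian_def DE x0(2) flip: k_def x0_def)
  moreover have "?D v \<noteq> 0" using ED[of v] deg(1) linear_0[OF has_derivative_linear[OF d\<sigma>]] by metis
  ultimately show ?thesis by blast
qed

section \<open>From the charts to the whole manifold\<close>

lemma dual_coords_inner:
  assumes "linear \<pi>"
  shows "\<pi> y = dual_coords \<pi> \<bullet> y"
proof -
  have "\<pi> y = \<pi> (\<Sum>i\<in>UNIV. (y $ i) *\<^sub>R axis i 1)"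
    using basis_expansion[of y] by (simp add: scalar_mult_eq_scaleR)
  also have "\<dots> = (\<Sum>i\<in>UNIV. (y $ i) * \<pi> (axis i 1))"
    by (simp add: linear_sum[OF assms] linear_scale[OF assms])
  finally show ?thesis by (simp add: dual_coords_def inner_vec_def mult.commute)
qed

lemma countable_subatlas:
  assumes "second_countable X" "Cr_atlas r X \<A>"
  obtains \<B> where "countable \<B>" "\<B> \<subseteq> \<A>" "\<And>q. q \<in> topspace X \<Longrightarrow> \<exists>c\<in>\<B>. q \<in> fst c"
proof -
  have "openin X (fst c)" if "c \<in> \<A>" for c
    using assms(2) that chart_properties(1)[of X "fst c" "snd c"] by (auto simp: Cr_atlas_def)
  moreover have "\<Union>(fst ` \<A>) = topspace X"
    using assms(2) by (auto simp: Cr_atlas_def split_beta)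
  ultimately obtain \<V> where \<V>: "countable \<V>" "\<V> \<subseteq> fst ` \<A>" "\<Union>\<V> = topspace X"
    using second_countable_imp_Lindelof_space[OF assms(1)] unfolding Lindelof_space_def
    by (metis imageE)
  then obtain \<B> where "countable \<B>" "\<B> \<subseteq> \<A>" "\<V> = fst ` \<B>"
    by (metis countable_subset_image)
  with \<V>(3) show ?thesis by (intro that) auto
qed

theorem theorem5p2:
  fixes r :: nat and s :: real
    and X :: "'p topology" and \<A> :: "('p, 'e::real_normed_vector) chart set"
    and f :: "'p \<Rightarrow> real ^ 'm" and V :: "(real ^ 'm) set" and g :: "real ^ 'm \<Rightarrow> real"
  assumes "r \<ge> 2"
    and "Cr_manifold r X \<A>"
    and "open V"
    and "f ` topspace X \<subseteq> V"
    and "Cr_immersion r \<A> f"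
    and "Ck_on r g V"
    and "s \<ge> real CARD('m) - 1 + 1 / (real r - 1)"
  shows "hausdorff_outer_measure s
           (dual_coords ` {\<pi>. linear \<pi> \<and> \<not> Morse_function r X \<A> ((\<lambda>y. g y + \<pi> y) \<circ> f)}) = 0"
proof -
  obtain k where r: "r = Suc k" and k: "0 < k" using assms(1) by (cases r) auto
  have s: "s \<ge> real DIM(real ^ 'm) - 1 + 1 / real k" using assms(7) r by simp
  have "0 < 1 / real k" "1 \<le> real CARD('m)" using k by (simp_all add: Suc_leI)
  moreover have "DIM(real ^ 'm) = CARD('m)" by simp
  \<comment> \<open>Positivity, from \<open>1 / k\<close> and \<open>CARD('m) \<ge> 1\<close>,
    excludes the counting-measure branch of the definition.\<close>
  ultimately have "0 < s" using s by linarith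
  have atlas: "Cr_atlas r X \<A>" and sc: "second_countable X" using assms(2) by (auto simp: Cr_manifold_def)
  define F where "F c = f \<circ> inv_into (fst c) (snd c)" for c :: "('p, 'e) chart"
  define S where "S c = snd c ` fst c" for c :: "('p, 'e) chart"
  have chart: "is_chart X (fst c, snd c)" if "c \<in> \<A>" for c using atlas that by (simp add: Cr_atlas_def)
  have oS: "open (S c)" if "c \<in> \<A>" for c
    unfolding S_def using chart_properties(2)[OF chart[OF that]] .
  have kF: "Ck_on r (F c) (S c)" if "c \<in> \<A>" for c
    using assms(5) that unfolding Cr_immersion_def Cr_map_def F_def S_def by (auto simp: split_beta)
  have FV: "F c ` S c \<subseteq> V" if c: "c \<in> \<A>" for c
  proof -
    have "fst c \<subseteq> topspace X" using chart_properties(1)[OF chart[OF c]] by (rule openin_subset)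
    moreover have "inv_into (fst c) (snd c) x \<in> fst c" if "x \<in> S c" for x
      using that unfolding S_def by (rule inv_into_into)
    ultimately show ?thesis using assms(4) unfolding F_def by auto
  qed
  have kG: "Ck_on r (\<lambda>x. g (F c x)) (S c)" if "c \<in> \<A>" for c
    by (rule Ck_on_compose[OF oS[OF that] assms(6) kF[OF that] FV[OF that]])
  define h where "h \<pi> = (\<lambda>y. g y + \<pi> y) \<circ> f" for \<pi> :: "real ^ 'm \<Rightarrow> real"
  have h: "h \<pi> \<circ> inv_into (fst c) (snd c) = (\<lambda>x. g (F c x) + dual_coords \<pi> \<bullet> F c x)"
    if "linear \<pi>" for \<pi> c
    using dual_coords_inner[OF that] by (auto simp: h_def F_def)
  \<comment> \<open>Regularity holds for every linear functional, so a function that is not Morse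
    always has a degenerate critical point.\<close>
  have map: "Cr_map r \<A> (h \<pi>)" if \<pi>: "linear \<pi>" for \<pi>
  proof -
    have "Ck_on r (h \<pi> \<circ> inv_into (fst c) (snd c)) (S c)" if "c \<in> \<A>" for c
      unfolding h[OF \<pi>]
      by (intro Ck_on_add[OF oS] Ck_on_linear_comp[OF oS bounded_linear_inner_right] kG kF that)
    then show ?thesis by (auto simp: Cr_map_def S_def)
  qed
  define \<Sigma> where "\<Sigma> c = {\<beta>. \<exists>x\<in>S c. (\<forall>v. frechet_derivative (\<lambda>x. g (F c x) + \<beta> \<bullet> F c x) (at x) v = 0) \<and>
     (\<exists>v. v \<noteq> 0 \<and> (\<forall>w. frechet_derivative (\<lambda>y. frechet_derivative (\<lambda>x. g (F c x) + \<beta> \<bullet> F c x) (at y) v) (at x) w = 0))}"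
    for c
  have null: "hausdorff_null s (\<Sigma> c)" if c: "c \<in> \<A>" for c
    unfolding \<Sigma>_def
  proof (rule chart_degenerate_null[OF oS[OF c] _ _ k _ s])
    show "Ck_on (Suc k) (F c) (S c)" "Ck_on (Suc k) (\<lambda>x. g (F c x)) (S c)"
      using kF[OF c] kG[OF c] unfolding r by blast+
    fix x assume "x \<in> S c"
    then obtain q where "q \<in> fst c" "x = snd c q" by (auto simp: S_def)
    then show "inj (frechet_derivative (F c) (at x))"
      using assms(5) c unfolding Cr_immersion_def chart_deriv_def F_def by (auto simp: split_beta)
  qed
  obtain \<B> where \<B>: "countable \<B>" "\<B> \<subseteq> \<A>" "\<And>q. q \<in> topspace X \<Longrightarrow> \<exists>c\<in>\<B>. q \<in> fst c"
    using countable_subatlas[OF sc atlas] by metis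
  have "dual_coords ` {\<pi>. linear \<pi> \<and> \<not> Morse_function r X \<A> (h \<pi>)} \<subseteq> (\<Union>c\<in>\<B>. \<Sigma> c)"
  proof (rule image_subsetI)
    fix \<pi> assume "\<pi> \<in> {\<pi>. linear \<pi> \<and> \<not> Morse_function r X \<A> (h \<pi>)}"
    then have \<pi>: "linear \<pi>" and "\<not> Morse_function r X \<A> (h \<pi>)" by auto
    then obtain q where q: "q \<in> topspace X" "critical_point \<A> (h \<pi>) q" "\<not> nondegenerate_at \<A> (h \<pi>) q"
      using map[OF \<pi>] unfolding Morse_function_def by blast
    then obtain U \<phi> v where U: "(U, \<phi>) \<in> \<A>" "q \<in> U" and v: "v \<noteq> 0" "\<And>w. chart_hessian (U, \<phi>) (h \<pi>) q v w = 0"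
      unfolding nondegenerate_at_def nonsingular_form_def by (metis fst_conv surj_pair)
    \<comment> \<open>The chart \<open>(U, \<phi>)\<close> need not belong to the countable family
      \<open>\<B>\<close>, hence the passage to a member of \<open>\<B>\<close> around the same
      point.\<close>
    obtain W \<psi> where W: "(W, \<psi>) \<in> \<B>" "q \<in> W" using \<B>(3)[OF q(1)] by (metis fst_conv surj_pair)
    have WA: "(W, \<psi>) \<in> \<A>" using W(1) \<B>(2) by blast
    have "dim (range (chart_deriv (W, \<psi>) (h \<pi>) q)) = 0"
      using q(2) WA W(2) unfolding critical_point_def by fastforce
    then have crit: "chart_deriv (W, \<psi>) (h \<pi>) q v = 0" for v by auto
    obtain v' where v': "v' \<noteq> 0" "\<And>w. chart_hessian (W, \<psi>) (h \<pi>) q v' w = 0"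
      using degenerate_in_other_chart[OF atlas assms(1,5) map[OF \<pi>] U WA W(2) crit v] by blast
    have "dual_coords \<pi> \<in> \<Sigma> (W, \<psi>)"
      unfolding \<Sigma>_def
      using crit v' W(2) h[OF \<pi>, of "(W, \<psi>)"]
      by (auto simp: chart_deriv_def chart_hessian_def S_def intro!: bexI[of _ "\<psi> q"])
    then show "dual_coords \<pi> \<in> (\<Union>c\<in>\<B>. \<Sigma> c)" using W(1) by blast
  qed
  moreover have "hausdorff_null s (\<Union>c\<in>\<B>. \<Sigma> c)"
    using \<B>(1,2) null by (intro hausdorff_null_UN) auto
  ultimately have "hausdorff_null s (dual_coords ` {\<pi>. linear \<pi> \<and> \<not> Morse_function r X \<A> (h \<pi>)})"
    using hausdorff_null_subset by blast
  then show ?thesis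
    unfolding h_def by (rule hausdorff_null_imp_outer_measure_zero[OF _ \<open>0 < s\<close>])
qed

end
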